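(* Let $0<k\le m$ and let $X_1,\dots,X_k\in\mathbb{R}^m$ be random vectors with $X_i=M_i(c_i+\xi_i)$, where $M_i:\mathbb{R}^m\to\mathbb{R}^m$ are invertible linear maps, $c_i\in\mathbb{R}^m$ are fixed vectors and $\xi_1,\dots,\xi_k\in\mathbb{R}^m$ are i.i.d. standard Gaussian vectors. Let $\Gamma=(X_1,\dots,X_k)\in\mathbb{R}^{m\times k}$ be the random matrix with columns $X_i$, and define the ellipsoids $\mathcal{E}_i:=M_i\circ T_{c_i}(B_m)$, $i=1,\dots,k$. Then $$(b_\infty)^k\alpha_{m,k}\operatorname{MV}(\mathcal{E}_1,\dots,\mathcal{E}_k,B_m[m-k])\le\mathbb{E}\sqrt{\det(\Gamma^t\Gamma)}\le\alpha_{m,k}\operatorname{MV}(\mathcal{E}_1,\dots,\mathcal{E}_k,B_m[m-k]),$$ where $\alpha_{m,k}:=\frac{m!}{(2\pi)^{k/2}(m-k)!\,\kappa_{m-k}}$.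
   Context: $B_m$ is the unit ball of $\mathbb{R}^m$, $\kappa_j$ is the volume of the unit ball of $\mathbb{R}^j$ ($\kappa_0=1$). For convex bodies $K_1,\dots,K_m\subset\mathbb{R}^m$, $\operatorname{vol}_m(t_1K_1+\cdots+t_mK_m)$ (Minkowski sum) is a polynomial in $t_1,\dots,t_m\ge0$, and the mixed volume $\operatorname{MV}(K_1,\dots,K_m)$ is the coefficient of $t_1\cdots t_m$; $B_m[m-k]$ means $B_m$ repeated $m-k$ times. For $c\in\mathbb{R}^m$, $T_c:\mathbb{R}^m\to\mathbb{R}^m$ is the identity if $c=0$, and if $c\ne0$ it sends $c\mapsto\lambda(\|c\|)c$ and is the identity on $c^\perp$, where $\lambda(s)=e^{-s^2/2}+\sqrt{\pi/2}\,s\,\operatorname{erf}(s/\sqrt2)$ and $\operatorname{erf}(t)=\frac{2}{\sqrt\pi}\int_0^te^{-s^2}ds$. $\varphi_\infty(x,z)=|z|e^{-x^2/(\pi z^2)}+x\operatorname{erf}\left(\frac{x}{\sqrt\pi|z|}\right)$ (equal to $|x|$ at $z=0$) and $b_\infty:=\min\{\varphi_\infty(\cos t,\sin t):t\in[0,2\pi]\}\approx0.91$.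
   Formalization: MV is taken as the coefficient of t_1…t_m divided by m! (so MV(K,…,K)=vol K), not the coefficient itself; with the latter the lower bound fails for every m≥2, e.g. m=k=2, c_i=0, M_i=I. *)

theory Defs
  imports "HOL-Probability.Probability"
begin

definition erf :: "real \<Rightarrow> real" where
  "erf t = 2 / sqrt pi * (LBINT s=0..t. exp (- (s ^ 2)))"

definition lam :: "real \<Rightarrow> real" where
  "lam s = exp (- (s ^ 2) / 2) + sqrt (pi / 2) * s * erf (s / sqrt 2)"

(* T_c: identity if c = 0; otherwise c \<mapsto> lam(|c|) c and identity on c^\<perp> *)
definition Tmap :: "'a::real_inner \<Rightarrow> 'a \<Rightarrow> 'a" where
  "Tmap c x = (if c = 0 then x
     else x + ((lam (norm c) - 1) * ((x \<bullet> c) / (norm c) ^ 2)) *\<^sub>R c)"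

definition phi_inf :: "real \<Rightarrow> real \<Rightarrow> real" where
  "phi_inf x z = (if z = 0 then \<bar>x\<bar>
     else \<bar>z\<bar> * exp (- (x ^ 2) / (pi * z ^ 2)) + x * erf (x / (sqrt pi * \<bar>z\<bar>)))"

definition b_inf :: real where
  "b_inf = Inf ((\<lambda>t. phi_inf (cos t) (sin t)) ` {0..2 * pi})"

definition mink_comb :: "nat \<Rightarrow> (nat \<Rightarrow> real) \<Rightarrow> (nat \<Rightarrow> 'a::real_vector set) \<Rightarrow> 'a set" where
  "mink_comb m t K = {\<Sum>i<m. t i *\<^sub>R x i | x. \<forall>i<m. x i \<in> K i}"

(* Mixed volume of K_0,...,K_{m-1} in R^m (m = CARD('n)), standard normalisation
   MV(K,...,K) = vol K : vol(t_0 K_0 + ... + t_{m-1} K_{m-1}) is a polynomial in t \<ge> 0,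
   and MV is its coefficient of t_0 ... t_{m-1} divided by m!. *)
definition mixed_volume :: "(nat \<Rightarrow> (real ^ 'n::finite) set) \<Rightarrow> real" where
  "mixed_volume K = (THE v. \<exists>(D::nat) (a :: (nat \<Rightarrow> nat) \<Rightarrow> real).
      (\<forall>t. (\<forall>i<CARD('n). t i \<ge> 0) \<longrightarrow>
         measure lebesgue (mink_comb CARD('n) t K)
           = (\<Sum>\<alpha>\<in>PiE {..<CARD('n)} (\<lambda>_. {..D}). a \<alpha> * (\<Prod>i<CARD('n). t i ^ \<alpha> i)))
      \<and> v = a (restrict (\<lambda>_. 1) {..<CARD('n)}) / fact CARD('n))"

definition det_k :: "nat \<Rightarrow> (nat \<Rightarrow> nat \<Rightarrow> real) \<Rightarrow> real" where
  "det_k k A = (\<Sum>p | p permutes {..<k}. of_int (sign p) * (\<Prod>i<k. A i (p i)))"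

definition alpha_mk :: "nat \<Rightarrow> nat \<Rightarrow> real" where
  "alpha_mk m k = fact m / ((2 * pi) powr (real k / 2) * fact (m - k) * unit_ball_vol (real (m - k)))"

end

theory Submission
  imports Defs
begin

text \<open>
  Put \<open>A i = M i \<circ> T (c i)\<close> for \<open>i < k\<close> and \<open>A i = id\<close> otherwise, and let \<open>B\<close> be the unit ball. The function
  \<open>u \<mapsto> \<Sum>i. t i * sqrt (1 + \<bar>A i\<^sup>T u\<bar>\<^sup>2)\<close> is a smooth approximation of the support function of the body
  \<open>\<Sum>i. t i A i B\<close>; its gradient is injective and covers exactly this body up to boundary points, and its
  Jacobian matrix is \<open>\<Sum>i. t i E (exp (- \<langle>u, A i \<xi>\<rangle>\<^sup>2 / 2) (A i \<xi>) (A i \<xi>)\<^sup>T)\<close> with \<open>\<xi>\<close> standard Gaussian.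
  By an integral Cauchy-Binet formula and a Gaussian integration over \<open>u\<close>, the volume of the body is
  \<open>(2\<pi>)\<^bsup>m/2\<^esup> / m! * (\<Sum>f. (\<Prod>a. t (f a)) * E \<bar>det (A (f a) \<xi> a)\<bar>)\<close>, so the mixed volume of the \<open>A i B\<close> is
  \<open>(2\<pi>)\<^bsup>m/2\<^esup> / m! * E \<bar>det (A i \<xi> i)\<bar>\<close>.

  Integrating out the last \<open>m - k\<close> columns one at a time, each contributing the mean length of a
  Gaussian vector in the orthogonal complement of the previous columns, turns \<open>\<alpha> * MV\<close> into the mean
  of the \<open>k\<close>-dimensional volume spanned by \<open>A 0 \<xi> 0, \<dots>, A (k - 1) \<xi> (k - 1)\<close>, and the same computation
  applies with \<open>M i (c i + \<xi> i)\<close> in place of \<open>A i \<xi> i\<close>. As a function of a single column, \<open>\<bar>det\<bar>\<close> is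
  \<open>\<bar>\<langle>x, w\<rangle>\<bar>\<close>, so the columns can be exchanged one by one once
  \<open>b E \<bar>\<langle>T c \<xi>, w\<rangle>\<bar> \<le> E \<bar>\<langle>c + \<xi>, w\<rangle>\<bar> \<le> E \<bar>\<langle>T c \<xi>, w\<rangle>\<bar>\<close> is known. Since \<open>E \<bar>a + Z\<bar> = sqrt (2/\<pi>) lam a\<close> for a
  standard normal \<open>Z\<close>, this amounts to \<open>(lam s\<^sup>2 - 1) / s\<^sup>2\<close> being increasing on the positive half-line
  with upper bound \<open>\<pi>/2\<close>.
\<close>

text \<open>The smoothing by \<open>sqrt (1 + s^2)\<close> is what ties geometry to probability. The
  gradient of an unsmoothed support function only reaches the boundary of the body, whereas the
  gradient of sqrt (1 + |w|^2) fills the open unit ball, and its Hessian is exactly the Gaussian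
  mean of exp (- (w . x)^2 / 2) x x^T, with no further constant. Cauchy-Binet then produces squared
  determinants, and the integral over u turns each det^2 into (2 pi)^(m/2) |det|, which is the
  source of the power of 2 pi.

  Both the volume formula and the linearity of the determinant in one column concern m full columns.
  The comparison is therefore made after padding the k given columns with m - k Gaussian ones, and
  the padding costs both sides the same constant.

  The constant \<open>b_inf\<close> is the infimum of lam r / sqrt (1 + pi/2 r^2) over real r,
  written on the unit circle. The denominator comes from replacing the quotient (lam s^2 - 1) / s^2
  by its supremum pi/2.\<close>

section \<open>Change of variables for an arbitrary finite index type\<close>

text \<open>A separate copy of the type carries the chosen well-order, so that it cannot clash with
  an order that the index type may already have.\<close>

typedef 'a wordered = "UNIV :: 'a set" ..

lemma wordered_wellorder_exists: "\<exists>r :: 'a rel. Well_order r \<and> Field r = UNIV"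
  using Zorn.well_ordering by metis

definition wordered_rel :: "'a rel" where
  "wordered_rel = (SOME r. Well_order r \<and> Field r = UNIV)"

lemma wordered_rel: "Well_order (wordered_rel :: 'a rel)" "Field (wordered_rel :: 'a rel) = UNIV"
proof -
  have "Well_order (wordered_rel :: 'a rel) \<and> Field (wordered_rel :: 'a rel) = UNIV"
    unfolding wordered_rel_def by (rule someI_ex[OF wordered_wellorder_exists])
  then show "Well_order (wordered_rel :: 'a rel)" "Field (wordered_rel :: 'a rel) = UNIV" by auto
qed

instantiation wordered :: (type) wellorder
begin

definition less_eq_wordered :: "'a wordered \<Rightarrow> 'a wordered \<Rightarrow> bool" where
  "less_eq_wordered x y \<longleftrightarrow> (Rep_wordered x, Rep_wordered y) \<in> wordered_rel"

definition less_wordered :: "'a wordered \<Rightarrow> 'a wordered \<Rightarrow> bool" where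
  "less_wordered x y \<longleftrightarrow> x \<le> y \<and> \<not> y \<le> (x :: 'a wordered)"

instance
proof
  have W: "refl_on UNIV (wordered_rel :: 'a rel)" "trans (wordered_rel :: 'a rel)"
    "antisym (wordered_rel :: 'a rel)" "total (wordered_rel :: 'a rel)" "wf ((wordered_rel :: 'a rel) - Id)"
    using wordered_rel[where 'a = 'a]
    by (auto simp: well_order_on_def linear_order_on_def partial_order_on_def preorder_on_def)
  fix x y z :: "'a wordered"
  show "(x < y) = (x \<le> y \<and> \<not> y \<le> x)" by (rule less_wordered_def)
  show "x \<le> x" using W(1) by (auto simp: less_eq_wordered_def refl_on_def)
  show "x \<le> y \<Longrightarrow> y \<le> z \<Longrightarrow> x \<le> z" using W(2) unfolding less_eq_wordered_def by (meson transD)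
  show "x \<le> y \<Longrightarrow> y \<le> x \<Longrightarrow> x = y"
    using antisymD[OF W(3)] unfolding less_eq_wordered_def by (simp flip: Rep_wordered_inject)
  show "x \<le> y \<or> y \<le> x" 
    unfolding less_eq_wordered_def
    using W(4)[unfolded total_on_def, rule_format, of "Rep_wordered x" "Rep_wordered y"]
      refl_onD[OF W(1) UNIV_I, of "Rep_wordered x"]
    by (cases "Rep_wordered x = Rep_wordered y") simp_all
  fix Q :: "'a wordered \<Rightarrow> bool" and a
  assume step: "\<And>x. (\<And>y. y < x \<Longrightarrow> Q y) \<Longrightarrow> Q x"
  have "\<forall>x. Rep_wordered x = v \<longrightarrow> Q x" for v
  proof (induction v rule: wf_induct[OF W(5)])
    fix v
    assume IH: "\<forall>u. (u, v) \<in> wordered_rel - Id \<longrightarrow> (\<forall>x. Rep_wordered x = u \<longrightarrow> Q x)"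
    show "\<forall>x. Rep_wordered x = v \<longrightarrow> Q x"
    proof (intro allI impI, rule step)
      fix x y :: "'a wordered" assume "Rep_wordered x = v" "y < x"
      then have "(Rep_wordered y, v) \<in> wordered_rel - Id"
        by (simp add: less_wordered_def less_eq_wordered_def) metis
      from IH[rule_format, OF this refl] show "Q y" .
    qed
  qed
  from this[rule_format, OF refl] show "Q a" .
qed

end

instance wordered :: (finite) finite
proof
  have "(UNIV :: 'a wordered set) = range Abs_wordered"
    by (auto intro: Abs_wordered_cases)
  moreover have "finite (range (Abs_wordered :: 'a \<Rightarrow> _))" by (rule finite_imageI) simp
  ultimately show "finite (UNIV :: 'a wordered set)" by (rule ssubst)
qed

lemma bij_Rep_wordered: "bij Rep_wordered"
  using type_definition.Rep_range[OF type_definition_wordered]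
  by (simp add: bij_def inj_def Rep_wordered_inject)

text \<open>Conjugation with \<open>r\<close> carries the permutations of one index type bijectively
  to those of the other and preserves the sign, so the two Leibniz sums agree term by term.\<close>

lemma det_reindex:
  fixes A :: "'a::comm_ring_1 ^ 'n ^ 'n" and r :: "'m::finite \<Rightarrow> 'n::finite"
  assumes "bij r"
  shows "det (\<chi> i j. A $ r i $ r j) = det A"
proof -
  have inj: "inj_on r UNIV" and ran: "range r = UNIV"
    using assms by (auto simp: bij_def)
  have "det A = (\<Sum>p | p permutes (UNIV :: 'm set). of_int (sign (map_permutation UNIV r p)) *
      (\<Prod>i\<in>UNIV. A $ i $ map_permutation UNIV r p i))"
    unfolding det_def
    by (rule sum.reindex_bij_betw[symmetric])
      (use bij_betw_permutations[of r UNIV UNIV] assms in \<open>simp add: map_permutation_def restrict_id_def bij_betw_def\<close>)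
  also have "\<dots> = det (\<chi> i j. A $ r i $ r j)"
    unfolding det_def
  proof (intro sum.cong refl, goal_cases)
    case (1 p)
    have "(\<Prod>i\<in>UNIV. A $ i $ map_permutation UNIV r p i) = (\<Prod>i\<in>UNIV. A $ r i $ map_permutation UNIV r p (r i))"
      by (rule prod.reindex_bij_betw[symmetric, OF assms])
    moreover have "sign (map_permutation UNIV r p) = sign p" "map_permutation UNIV r p (r i) = r (p i)" for i
      using 1 inj by (auto intro: sign_map_permutation map_permutation_apply)
    ultimately show ?case by (simp only: vec_lambda_beta)
  qed
  finally show ?thesis by simp
qed

definition to_wordered :: "real ^ 'n \<Rightarrow> real ^ ('n::finite) wordered" where
  "to_wordered x = (\<chi> i. x $ Rep_wordered i)"

definition of_wordered :: "real ^ ('n::finite) wordered \<Rightarrow> real ^ 'n" where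
  "of_wordered x = (\<chi> i. x $ Abs_wordered i)"

lemma of_to_wordered [simp]: "of_wordered (to_wordered x) = x"
  by (simp add: of_wordered_def to_wordered_def Abs_wordered_inverse vec_eq_iff)

lemma to_of_wordered [simp]: "to_wordered (of_wordered x) = x"
  by (simp add: of_wordered_def to_wordered_def Rep_wordered_inverse vec_eq_iff)

lemma linear_to_wordered: "linear to_wordered"
  by (rule linearI) (auto simp: to_wordered_def vec_eq_iff)

lemma linear_of_wordered: "linear of_wordered"
  by (rule linearI) (auto simp: of_wordered_def vec_eq_iff)

lemma measurable_to_wordered [measurable]: "to_wordered \<in> borel_measurable borel"
  using linear_continuous_on[OF linear_conv_bounded_linear[THEN iffD1, OF linear_to_wordered]]
  by (rule borel_measurable_continuous_onI)

lemma measurable_of_wordered [measurable]: "of_wordered \<in> borel_measurable borel"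
  using linear_continuous_on[OF linear_conv_bounded_linear[THEN iffD1, OF linear_of_wordered]]
  by (rule borel_measurable_continuous_onI)

lemma prod_Basis_vec:
  fixes f :: "real ^ 'n::finite \<Rightarrow> 'b::comm_monoid_mult"
  shows "(\<Prod>b\<in>Basis. f b) = (\<Prod>i\<in>UNIV. f (axis i 1))"
proof -
  have eq: "Basis = range (\<lambda>i::'n. axis i (1::real))" by (auto simp: Basis_vec_def)
  have inj: "inj (\<lambda>i::'n. axis i (1::real))" by (auto simp: inj_def axis_eq_axis)
  show ?thesis unfolding eq prod.reindex[OF inj] by simp
qed

text \<open>Lebesgue measure is determined by its values on boxes, and relabelling coordinates only
  permutes the sides of a box.\<close>

lemma distr_to_wordered: "distr lborel borel to_wordered = (lborel :: (real ^ ('n::finite) wordered) measure)"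
proof (rule lborel_eqI[symmetric])
  fix l u :: "real ^ 'n wordered"
  assume le: "\<And>b. b \<in> Basis \<Longrightarrow> l \<bullet> b \<le> u \<bullet> b"
  have le': "l $ i \<le> u $ i" for i
    using le[of "axis i 1"] by (simp add: inner_axis)
  have "to_wordered -` box l u = box (of_wordered l) (of_wordered u)"
    by (auto simp: mem_box_cart to_wordered_def of_wordered_def) (metis Abs_wordered_inverse Rep_wordered_inverse UNIV_I)+
  then have "emeasure (distr lborel borel to_wordered) (box l u) = emeasure lborel (box (of_wordered l) (of_wordered u))"
    by (subst emeasure_distr) auto
  also have "\<dots> = ennreal (\<Prod>b\<in>Basis. (of_wordered u - of_wordered l) \<bullet> b)"
    using le' by (intro emeasure_lborel_box) (auto simp: of_wordered_def Basis_vec_def inner_axis)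
  also have "(\<Prod>b\<in>Basis. (of_wordered u - of_wordered l) \<bullet> b) = (\<Prod>i\<in>UNIV. u $ Abs_wordered i - l $ Abs_wordered i)"
    by (simp add: prod_Basis_vec inner_axis of_wordered_def)
  also have "\<dots> = (\<Prod>i\<in>UNIV. u $ Abs_wordered (Rep_wordered i) - l $ Abs_wordered (Rep_wordered i))"
    by (rule prod.reindex_bij_betw[symmetric, OF bij_Rep_wordered])
  also have "\<dots> = (\<Prod>b\<in>Basis. (u - l) \<bullet> b)"
    by (simp add: prod_Basis_vec inner_axis Rep_wordered_inverse)
  finally show "emeasure (distr lborel borel to_wordered) (box l u) = (\<Prod>b\<in>Basis. (u - l) \<bullet> b)" .
qed simp

lemma emeasure_image_to_wordered:
  assumes "S \<in> sets borel"
  shows "to_wordered ` S \<in> sets borel" "emeasure lborel (to_wordered ` S) = emeasure lborel S"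
proof -
  have eq: "to_wordered ` S = of_wordered -` S"
    by (auto simp: image_iff) (metis to_of_wordered)
  show S: "to_wordered ` S \<in> sets borel"
    unfolding eq using measurable_sets[OF measurable_of_wordered assms] by simp
  have "emeasure lborel (to_wordered ` S) = emeasure (distr lborel borel to_wordered) (to_wordered ` S)"
    by (simp add: distr_to_wordered)
  also have "\<dots> = emeasure lborel (to_wordered -` (to_wordered ` S))"
    using S by (subst emeasure_distr) auto
  also have "to_wordered -` (to_wordered ` S) = S"
    by auto (metis of_to_wordered)
  finally show "emeasure lborel (to_wordered ` S) = emeasure lborel S" .
qed

text \<open>The change of variables theorem of \<open>HOL-Analysis\<close> needs a well-ordered index type;
  conjugating with the coordinate relabelling \<open>to_wordered\<close> removes that requirement.\<close>

theorem emeasure_differentiable_image: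
  fixes f :: "real ^ 'n \<Rightarrow> real ^ 'n::finite"
  assumes S: "S \<in> sets borel" and der: "\<And>x. x \<in> S \<Longrightarrow> (f has_derivative f' x) (at x within S)"
    and inj: "inj_on f S" and fS: "f ` S \<in> sets borel" and fin: "emeasure lborel (f ` S) < \<infinity>"
    and meas [measurable]: "(\<lambda>x. det (matrix (f' x))) \<in> borel_measurable borel"
  shows "(\<integral>\<^sup>+x\<in>S. ennreal \<bar>det (matrix (f' x))\<bar> \<partial>lborel) = emeasure lborel (f ` S)"
proof -
  define g where "g = to_wordered \<circ> f \<circ> of_wordered"
  define g' where "g' y = to_wordered \<circ> f' (of_wordered y) \<circ> of_wordered" for y
  let ?T = "to_wordered ` S"
  have [measurable]: "S \<in> sets borel" by (rule S)
  have ofT: "of_wordered ` ?T = S" by (simp add: image_image)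
  have dto: "(to_wordered has_derivative to_wordered) F" for F :: "(real ^ 'n) filter"
    by (intro bounded_linear_imp_has_derivative linear_conv_bounded_linear[THEN iffD1] linear_to_wordered)
  have dof: "(of_wordered has_derivative of_wordered) F" for F :: "(real ^ 'n wordered) filter"
    by (intro bounded_linear_imp_has_derivative linear_conv_bounded_linear[THEN iffD1] linear_of_wordered)
  have dg: "(g has_derivative g' y) (at y within ?T)" if "y \<in> ?T" for y
    unfolding g_def g'_def comp_assoc
    by (rule diff_chain_within[OF _ dto])
      (rule diff_chain_within[OF dof], use that der ofT in auto)
  have ing: "inj_on g ?T"
    using inj by (auto simp: g_def inj_on_def) (metis of_to_wordered)
  have gT: "g ` ?T = to_wordered ` (f ` S)"
    by (auto simp: g_def image_image)
  have em: "emeasure lborel (g ` ?T) = emeasure lborel (f ` S)"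
    and gb: "g ` ?T \<in> sets borel"
    unfolding gT using emeasure_image_to_wordered[OF fS] by auto
  have Tb [measurable]: "?T \<in> sets borel" by (rule emeasure_image_to_wordered[OF S])
  have lm: "g ` ?T \<in> lmeasurable"
    using em fin gb by (auto simp: fmeasurable_def)
  have hi: "((\<lambda>x. \<bar>det (matrix (g' x))\<bar>) has_integral measure lebesgue (g ` ?T)) ?T"
    using has_measure_differentiable_image[of ?T g g' "measure lebesgue (g ` ?T)"] dg ing lm Tb
    by auto
  have det_eq: "det (matrix (g' y)) = det (matrix (f' (of_wordered y)))" for y
  proof -
    have "matrix (g' y) = (\<chi> i j. matrix (f' (of_wordered y)) $ Rep_wordered i $ Rep_wordered j)"
    proof -
      have "of_wordered (axis j 1) = axis (Rep_wordered j) (1::real)" for j :: "'n wordered"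
        by (auto simp: of_wordered_def vec_eq_iff axis_def Abs_wordered_inverse Rep_wordered_inverse)
      then have "to_wordered (f' (of_wordered y) (of_wordered (axis j 1))) $ i
          = f' (of_wordered y) (axis (Rep_wordered j) 1) $ Rep_wordered i" for i j :: "'n wordered"
        by (simp only: to_wordered_def vec_lambda_beta)
      then show ?thesis
        by (simp only: vec_eq_iff matrix_def g'_def comp_apply vec_lambda_beta) simp
    qed
    then show ?thesis by (simp add: det_reindex[OF bij_Rep_wordered])
  qed
  have "(\<integral>\<^sup>+x\<in>S. ennreal \<bar>det (matrix (f' x))\<bar> \<partial>lborel)
      = (\<integral>\<^sup>+x. ennreal \<bar>det (matrix (g' (to_wordered x)))\<bar> * indicator ?T (to_wordered x) \<partial>lborel)"
    by (intro nn_integral_cong) (auto simp: det_eq indicator_def, metis of_to_wordered)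
  also have "\<dots> = (\<integral>\<^sup>+y. ennreal \<bar>det (matrix (g' y))\<bar> * indicator ?T y \<partial>distr lborel borel to_wordered)"
    by (subst nn_integral_distr) (auto simp: det_eq)
  also have "\<dots> = (\<integral>\<^sup>+y. ennreal \<bar>det (matrix (g' y))\<bar> * indicator ?T y \<partial>lborel)"
    by (simp add: distr_to_wordered)
  also have "\<dots> = ennreal (measure lebesgue (g ` ?T))"
    by (rule nn_integral_has_integral_lebesgue'[OF _ hi]) auto
  also have "\<dots> = emeasure lborel (g ` ?T)"
    using gb emeasure_eq_ennreal_measure[of lborel "g ` ?T"] em fin by (simp add: measure_completion)
  finally show ?thesis by (simp add: em)
qed

text \<open>Tested on boxes: the preimage of a box under \<open>A\<close> is its image under the
  inverse \<open>B\<close>, whose volume is the volume of the box times |det B|, and |det A| |det B|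
  = 1.\<close>

lemma lborel_eq_density_distr_matrix:
  fixes A :: "real ^ 'n ^ 'n::finite"
  assumes A: "invertible A"
  shows "lborel = density (distr lborel borel ((*v) A)) (\<lambda>_. ennreal \<bar>det A\<bar>)"
proof (rule lborel_eqI)
  fix l u :: "real ^ 'n"
  assume le: "\<And>b. b \<in> Basis \<Longrightarrow> l \<bullet> b \<le> u \<bullet> b"
  obtain B where B: "A ** B = mat 1" "B ** A = mat 1" using A by (auto simp: invertible_def)
  have [measurable]: "(*v) A \<in> borel_measurable borel"
    by (intro borel_measurable_continuous_onI matrix_vector_mult_linear_continuous_on)
  have AB: "A *v (B *v x) = x" "B *v (A *v x) = x" for x
    by (simp_all add: matrix_vector_mul_assoc B)
  have im: "(*v) B ` box l u = (*v) A -` box l u"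
    using AB by (auto simp: image_iff) metis
  have bd: "bounded ((*v) B ` box l u)"
    by (intro bounded_linear_image bounded_box matrix_vector_mul_bounded_linear)
  have bs: "(*v) A -` box l u \<in> sets borel"
    using measurable_sets[of "(*v) A" borel borel "box l u"] by simp
  have dA: "\<bar>det A\<bar> * \<bar>det B\<bar> = 1"
    using B by (metis abs_mult abs_one det_I det_mul)
  have "(\<integral>\<^sup>+x\<in>box l u. ennreal \<bar>det (matrix ((*v) B))\<bar> \<partial>lborel) = emeasure lborel ((*v) B ` box l u)"
  proof (rule emeasure_differentiable_image)
    show "((*v) B has_derivative (*v) B) (at x within box l u)" for x
      by (intro bounded_linear_imp_has_derivative matrix_vector_mul_bounded_linear)
    show "inj_on ((*v) B) (box l u)" using AB by (metis inj_on_inverseI)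
    show "emeasure lborel ((*v) B ` box l u) < \<infinity>"
      using bd by (rule emeasure_bounded_finite)
  qed (use bs im in auto)
  then have "emeasure lborel ((*v) A -` box l u) = \<bar>det B\<bar> * emeasure lborel (box l u)"
    by (simp add: im nn_integral_cmult_indicator)
  then have "emeasure (density (distr lborel borel ((*v) A)) (\<lambda>_. ennreal \<bar>det A\<bar>)) (box l u)
      = ennreal \<bar>det A\<bar> * (\<bar>det B\<bar> * emeasure lborel (box l u))"
    by (subst emeasure_density) (simp_all add: nn_integral_cmult emeasure_distr nn_integral_cmult_indicator)
  also have "\<dots> = emeasure lborel (box l u)"
    using dA by (simp flip: mult.assoc ennreal_mult)
  also have "\<dots> = (\<Prod>b\<in>Basis. (u - l) \<bullet> b)"
    using le by simp
  finally show "emeasure (density (distr lborel borel ((*v) A)) (\<lambda>_. ennreal \<bar>det A\<bar>)) (box l u) = (\<Prod>b\<in>Basis. (u - l) \<bullet> b)" .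
qed simp

lemma nn_integral_lborel_matrix:
  fixes A :: "real ^ 'n ^ 'n::finite"
  assumes A: "invertible A" and [measurable]: "f \<in> borel_measurable borel"
  shows "(\<integral>\<^sup>+x. f x \<partial>lborel) = ennreal \<bar>det A\<bar> * (\<integral>\<^sup>+x. f (A *v x) \<partial>lborel)"
proof -
  have [measurable]: "(*v) A \<in> borel_measurable borel"
    by (intro borel_measurable_continuous_onI matrix_vector_mult_linear_continuous_on)
  show ?thesis
    by (subst lborel_eq_density_distr_matrix[OF A])
      (simp add: nn_integral_density nn_integral_distr nn_integral_cmult)
qed

section \<open>Gaussian integrals\<close>

abbreviation std_normal_measure :: "real measure" where
  "std_normal_measure \<equiv> density lborel (\<lambda>x. ennreal (std_normal_density x))"

definition std_gauss :: "(real ^ 'n::finite) measure" where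
  "std_gauss = density lborel (\<lambda>x. ennreal ((2 * pi) powr (- real CARD('n) / 2) * exp (- (norm x ^ 2) / 2)))"

lemma sets_std_gauss [simp, measurable_cong]: "sets std_gauss = sets borel"
  by (simp add: std_gauss_def)

lemma space_std_gauss [simp]: "space std_gauss = UNIV"
  by (simp add: std_gauss_def)

lemma prob_space_std_normal: "prob_space std_normal_measure"
  using prob_space_normal_density[of 1 0] by simp

lemma std_gauss_density_eq_prod:
  fixes x :: "real ^ 'n::finite"
  shows "(2 * pi) powr (- real CARD('n) / 2) * exp (- (norm x ^ 2) / 2) = (\<Prod>b\<in>Basis. std_normal_density (x \<bullet> b))"
proof -
  have "(\<Prod>i\<in>(UNIV::'n set). std_normal_density (x $ i))
      = (1 / sqrt (2 * pi)) ^ CARD('n) * exp (\<Sum>i\<in>UNIV. - (x $ i)\<^sup>2 / 2)"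
    by (simp add: std_normal_density_def prod.distrib exp_sum prod_dividef power_divide)
  also have "(\<Sum>i\<in>UNIV. - (x $ i)\<^sup>2 / 2) = - (norm x ^ 2) / 2"
    by (simp add: norm_vec_def L2_set_def sum_nonneg sum_negf sum_divide_distrib)
  also have "(1 / sqrt (2 * pi)) ^ CARD('n) = (2 * pi) powr (- real CARD('n) / 2)"
  proof -
    have "1 / sqrt (2 * pi) = (2 * pi) powr (- 1 / 2)"
      by (simp add: powr_minus powr_half_sqrt divide_simps)
    then have "(1 / sqrt (2 * pi)) ^ CARD('n) = ((2 * pi) powr (- 1 / 2)) powr real CARD('n)"
      by (simp add: powr_realpow)
    then show ?thesis by (simp add: powr_powr)
  qed
  finally show ?thesis by (simp add: prod_Basis_vec inner_axis)
qed

lemma nn_integral_std_gauss_prod_Basis: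
  fixes f :: "real ^ 'n::finite \<Rightarrow> real \<Rightarrow> ennreal"
  assumes [measurable]: "\<And>b. b \<in> Basis \<Longrightarrow> f b \<in> borel_measurable borel"
  shows "(\<integral>\<^sup>+x. (\<Prod>b\<in>Basis. f b (x \<bullet> b)) \<partial>std_gauss) = (\<Prod>b\<in>Basis. \<integral>\<^sup>+z. f b z \<partial>std_normal_measure)"
proof -
  have "(\<integral>\<^sup>+x. (\<Prod>b\<in>Basis. f b (x \<bullet> b)) \<partial>std_gauss)
      = (\<integral>\<^sup>+x. (\<Prod>b\<in>Basis. ennreal (std_normal_density (x \<bullet> b)) * f b (x \<bullet> b)) \<partial>lborel)"
    unfolding std_gauss_def std_gauss_density_eq_prod
    by (subst nn_integral_density) (auto simp: prod_ennreal[symmetric] prod.distrib)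
  also have "\<dots> = (\<Prod>b\<in>Basis. \<integral>\<^sup>+z. ennreal (std_normal_density z) * f b z \<partial>lborel)"
    by (rule nn_integral_lborel_prod) auto
  also have "\<dots> = (\<Prod>b\<in>Basis. \<integral>\<^sup>+z. f b z \<partial>std_normal_measure)"
    by (intro prod.cong refl, subst nn_integral_density) auto
  finally show ?thesis .
qed

lemma prob_space_std_gauss: "prob_space (std_gauss :: (real ^ 'n::finite) measure)"
proof
  have "emeasure std_normal_measure UNIV = 1"
    using prob_space.emeasure_space_1[OF prob_space_std_normal] by simp
  then show "emeasure (std_gauss :: (real ^ 'n) measure) (space std_gauss) = 1"
    using nn_integral_std_gauss_prod_Basis[of "\<lambda>(b::real^'n) x. 1"] by simp
qed

interpretation std_normal: prob_space std_normal_measure by (rule prob_space_std_normal)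

interpretation std_gauss: prob_space "std_gauss :: (real ^ 'n::finite) measure"
  by (rule prob_space_std_gauss)

lemma emeasure_std_gauss_UNIV [simp]: "emeasure (std_gauss :: (real ^ 'n::finite) measure) UNIV = 1"
  by (rule std_gauss.emeasure_space_1[unfolded space_std_gauss])

lemma emeasure_std_normal_UNIV [simp]: "emeasure std_normal_measure UNIV = 1"
  using std_normal.emeasure_space_1 by simp

lemma inner_matrix_vector_transpose:
  fixes A :: "real ^ 'n::finite ^ 'm::finite"
  shows "(A *v x) \<bullet> y = x \<bullet> (transpose A *v y)"
proof -
  have "(A *v x) \<bullet> y = y \<bullet> (A *v x)" by (rule inner_commute)
  also have "\<dots> = (y v* A) \<bullet> x" by (rule dot_lmul_matrix[symmetric])
  also have "y v* A = transpose A *v y" by (rule transpose_matrix_vector[symmetric])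
  finally show ?thesis by (simp add: inner_commute)
qed

lemma orthonormal_extension:
  fixes B :: "'a::euclidean_space set"
  assumes B: "pairwise orthogonal B" "\<And>b. b \<in> B \<Longrightarrow> norm b = 1"
  obtains C where "B \<subseteq> C" "pairwise orthogonal C" "\<And>b. b \<in> C \<Longrightarrow> norm b = 1"
    "finite C" "card C = DIM('a)"
proof -
  let ?S = "{y \<in> UNIV. \<forall>x \<in> span B. orthogonal x y}"
  have indep: "independent B" by (intro pairwise_orthogonal_independent B(1)) (metis B(2) norm_zero zero_neq_one)
  then have finB: "finite B" by (rule independent_imp_finite)
  have subS: "subspace ?S" by (auto simp: subspace_def orthogonal_def inner_right_distrib)
  have "dim ?S + dim (span B) = dim (UNIV :: 'a set)"
    by (rule dim_subspace_orthogonal_to_vectors) auto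
  then have dimS: "dim ?S + card B = DIM('a)"
    using indep by (simp add: dim_eq_card_independent)
  obtain C where C: "C \<subseteq> ?S" "pairwise orthogonal C" "\<And>x. x \<in> C \<Longrightarrow> norm x = 1"
    "independent C" "card C = dim ?S" "span C = ?S"
    by (rule orthonormal_basis_subspace[OF subS]) (rule that)
  have finC: "finite C" using C(4) by (rule independent_imp_finite)
  have disj: "B \<inter> C = {}"
  proof (rule ccontr)
    assume "B \<inter> C \<noteq> {}"
    then obtain b where b: "b \<in> B" "b \<in> C" by blast
    then have "orthogonal b b" using C(1) span_base[of b B] by blast
    then show False using B(2)[OF b(1)] by (simp add: orthogonal_self)
  qed
  show thesis
  proof (rule that[of "B \<union> C"])
    show "pairwise orthogonal (B \<union> C)"
    proof -
      have "orthogonal b c" if "b \<in> B" "c \<in> C" for b c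
        using C(1) span_base[OF that(1)] that(2) by blast
      moreover from this have "orthogonal c b" if "b \<in> B" "c \<in> C" for b c
        using that by (simp add: orthogonal_commute)
      ultimately show ?thesis
        using B(1) C(2) by (auto simp: pairwise_def)
    qed
    show "card (B \<union> C) = DIM('a)"
      using dimS C(5) by (simp add: card_Un_disjoint finB finC disj)
  qed (use B C finB finC in auto)
qed

text \<open>Coordinates along orthonormal directions are independent standard normals: the density
  depends only on the norm, so an orthogonal matrix can rotate a completed orthonormal basis to the
  coordinate axes.\<close>

theorem nn_integral_std_gauss_orthonormal:
  fixes f :: "real ^ 'n::finite \<Rightarrow> real \<Rightarrow> ennreal"
  assumes B: "pairwise orthogonal B" "\<And>b. b \<in> B \<Longrightarrow> norm b = 1"
    and f [measurable]: "\<And>b. b \<in> B \<Longrightarrow> f b \<in> borel_measurable borel"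
  shows "(\<integral>\<^sup>+x. (\<Prod>b\<in>B. f b (x \<bullet> b)) \<partial>std_gauss) = (\<Prod>b\<in>B. \<integral>\<^sup>+z. f b z \<partial>std_normal_measure)"
proof -
  obtain C where C: "B \<subseteq> C" "pairwise orthogonal C" "\<And>b. b \<in> C \<Longrightarrow> norm b = 1"
    "finite C" "card C = DIM(real ^ 'n)"
    using orthonormal_extension[OF B] by metis
  have finB: "finite B" using C finite_subset by metis
  obtain e :: "'n \<Rightarrow> real ^ 'n" where e: "bij_betw e UNIV C"
    using C(4,5) by (metis finite_same_card_bij DIM_cart DIM_real finite mult.right_neutral)
  \<comment> \<open>Directions added by the completion get the constant factor 1. Its integral is
    also 1, so neither product changes.\<close>
  define g where "g b = (if b \<in> B then f b else (\<lambda>_. 1))" for b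
  have [measurable]: "g b \<in> borel_measurable borel" for b
    using f by (auto simp: g_def)
  have gB: "(\<Prod>b\<in>B. F (g b) b) = (\<Prod>b\<in>B. F (f b) b)" for F :: "(real \<Rightarrow> ennreal) \<Rightarrow> real ^ 'n \<Rightarrow> ennreal"
    by (intro prod.cong) (auto simp: g_def)
  \<comment> \<open>\<open>F\<close> is instantiated twice: as evaluation of a factor at a
    coordinate, and as integration of that factor.\<close>
  have gBC: "(\<Prod>b\<in>B. F (f b) b) = (\<Prod>i\<in>UNIV. F (g (e i)) (e i))"
    if "\<And>b. F (\<lambda>_. 1) b = 1" for F :: "(real \<Rightarrow> ennreal) \<Rightarrow> real ^ 'n \<Rightarrow> ennreal"
  proof -
    have "(\<Prod>b\<in>B. F (f b) b) = (\<Prod>b\<in>C. F (g b) b)"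
      unfolding gB[symmetric] using C that by (intro prod.mono_neutral_left) (auto simp: g_def)
    also have "\<dots> = (\<Prod>i\<in>UNIV. F (g (e i)) (e i))"
      by (rule prod.reindex_bij_betw[symmetric, OF e])
    finally show ?thesis .
  qed
  have ee: "e i \<bullet> e j = (if i = j then 1 else 0)" for i j
  proof (cases "i = j")
    case True
    have "norm (e i) = 1" using C(3) e by (auto simp: bij_betw_def)
    then show ?thesis using True by (simp add: dot_square_norm)
  next
    case False
    then have "e i \<noteq> e j" "e i \<in> C" "e j \<in> C" using e by (auto simp: bij_betw_def inj_on_def)
    then show ?thesis using C(2) False by (auto simp: pairwise_def orthogonal_def)
  qed
  define A :: "real ^ 'n ^ 'n" where "A = (\<chi> i j. e j $ i)"
  have AA: "transpose A ** A = mat 1"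
    using ee by (simp add: A_def matrix_matrix_mult_def transpose_def mat_def vec_eq_iff inner_vec_def mult.commute)
  then have orth: "orthogonal_matrix A" by (simp add: orthogonal_matrix)
  then have inv: "invertible A" and det1: "\<bar>det A\<bar> = 1"
    using det_orthogonal_matrix[OF orth] by (auto simp: invertible_det_nz)
  have comp: "(A *v x) \<bullet> e j = x $ j" for x j
  proof -
    have "(A *v x) \<bullet> e j = x \<bullet> (transpose A *v e j)"
      by (rule inner_matrix_vector_transpose)
    also have "transpose A *v e j = axis j 1"
      using ee by (auto simp: A_def matrix_vector_mult_def transpose_def vec_eq_iff axis_def inner_vec_def)
    finally show ?thesis by (simp add: inner_axis)
  qed
  have nrm: "norm (A *v x) = norm x" for x
  proof -
    have "(A *v x) \<bullet> (A *v x) = x \<bullet> (transpose A *v (A *v x))"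
      by (rule inner_matrix_vector_transpose)
    also have "\<dots> = x \<bullet> x" by (simp add: matrix_vector_mul_assoc AA)
    finally show ?thesis by (simp add: norm_eq_sqrt_inner)
  qed
  have [measurable]: "(*v) A \<in> borel_measurable borel"
    by (intro borel_measurable_continuous_onI matrix_vector_mult_linear_continuous_on)
  let ?d = "\<lambda>x. ennreal ((2 * pi) powr (- real CARD('n) / 2) * exp (- (norm (x :: real ^ 'n) ^ 2) / 2))"
  have "(\<integral>\<^sup>+x. (\<Prod>b\<in>B. f b (x \<bullet> b)) \<partial>std_gauss) = (\<integral>\<^sup>+x. (\<Prod>i\<in>UNIV. g (e i) (x \<bullet> e i)) \<partial>std_gauss)"
    by (subst gBC[where F = "\<lambda>h b. h (_ \<bullet> b)"]) auto
  also have "\<dots> = (\<integral>\<^sup>+x. ?d x * (\<Prod>i\<in>UNIV. g (e i) (x \<bullet> e i)) \<partial>lborel)"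
    unfolding std_gauss_def by (subst nn_integral_density) auto
  also have "\<dots> = (\<integral>\<^sup>+x. ?d (A *v x) * (\<Prod>i\<in>UNIV. g (e i) ((A *v x) \<bullet> e i)) \<partial>lborel)"
    by (subst nn_integral_lborel_matrix[OF inv]) (simp_all add: det1)
  also have "\<dots> = (\<integral>\<^sup>+x. (\<Prod>i\<in>UNIV. g (e i) (x $ i)) \<partial>std_gauss)"
    unfolding std_gauss_def by (subst nn_integral_density) (auto simp: comp nrm)
  also have "\<dots> = (\<Prod>i\<in>UNIV. \<integral>\<^sup>+z. g (e i) z \<partial>std_normal_measure)"
  proof -
    \<comment> \<open>The product formula is indexed by basis vectors; \<open>h\<close> recovers the
      index from \<open>axis i 1\<close>.\<close>
    define h where "h b = g (e (SOME i. b = axis i 1))" for b :: "real ^ 'n"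
    have h: "h (axis i 1) = g (e i)" for i
      by (simp add: h_def axis_eq_axis)
    have [measurable]: "h b \<in> borel_measurable borel" for b by (simp add: h_def)
    show ?thesis
      using nn_integral_std_gauss_prod_Basis[of h] by (simp add: prod_Basis_vec h inner_axis)
  qed
  also have "\<dots> = (\<Prod>b\<in>B. \<integral>\<^sup>+z. f b z \<partial>std_normal_measure)"
    by (subst gBC[where F = "\<lambda>h b. \<integral>\<^sup>+z. h z \<partial>std_normal_measure"]) auto
  finally show ?thesis .
qed

lemma nn_integral_std_gauss_inner:
  fixes w :: "real ^ 'n::finite"
  assumes [measurable]: "f \<in> borel_measurable borel"
  shows "(\<integral>\<^sup>+x. f (x \<bullet> w) \<partial>std_gauss) = (\<integral>\<^sup>+z. f (norm w * z) \<partial>std_normal_measure)"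
proof (cases "w = 0")
  case True
  then show ?thesis by simp
next
  case False
  let ?b = "w /\<^sub>R norm w"
  have "(\<integral>\<^sup>+x. (\<Prod>b\<in>{?b}. f (norm w * (x \<bullet> b))) \<partial>std_gauss) = (\<Prod>b\<in>{?b}. \<integral>\<^sup>+z. f (norm w * z) \<partial>std_normal_measure)"
    using False by (intro nn_integral_std_gauss_orthonormal) auto
  then show ?thesis using False by (simp add: mult.assoc[symmetric])
qed

text \<open>Inverse variances of Gaussian exponentials add, here 1 and t, so the product is an
  unnormalised normal density of variance 1 / (1 + t).\<close>

lemma std_normal_density_times_exp:
  assumes "t \<ge> 0"
  shows "std_normal_density z * exp (- t * z\<^sup>2 / 2) = (1 / sqrt (1 + t)) * normal_density 0 (1 / sqrt (1 + t)) z"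
proof -
  have "- z\<^sup>2 / 2 + - t * z\<^sup>2 / 2 = - z\<^sup>2 / (2 * (1 / sqrt (1 + t))\<^sup>2)"
    using assms by (simp add: power_divide field_simps)
  then have "exp (- z\<^sup>2 / 2) * exp (- t * z\<^sup>2 / 2) = exp (- z\<^sup>2 / (2 * (1 / sqrt (1 + t))\<^sup>2))"
    by (simp flip: exp_add)
  then show ?thesis
    using assms by (simp add: std_normal_density_def normal_density_def real_sqrt_divide real_sqrt_mult power_divide)
qed

lemma std_normal_density_times_exp_ennreal:
  assumes "t \<ge> 0"
  shows "ennreal (std_normal_density z) * ennreal (exp (- t * z\<^sup>2 / 2))
    = ennreal ((1 / sqrt (1 + t)) * normal_density 0 (1 / sqrt (1 + t)) z)"
  by (subst ennreal_mult'[symmetric]) (simp_all only: std_normal_density_times_exp[OF assms] normal_density_nonneg)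

lemma nn_integral_std_normal_exp:
  assumes "t \<ge> 0"
  shows "(\<integral>\<^sup>+z. ennreal (exp (- t * z\<^sup>2 / 2)) \<partial>std_normal_measure) = ennreal (1 / sqrt (1 + t))"
proof -
  have "(\<integral>\<^sup>+z. ennreal (exp (- t * z\<^sup>2 / 2)) \<partial>std_normal_measure)
      = (\<integral>\<^sup>+z. ennreal (1 / sqrt (1 + t) * normal_density 0 (1 / sqrt (1 + t)) z) \<partial>lborel)"
    by (subst nn_integral_density, measurable) (simp only: std_normal_density_times_exp_ennreal[OF assms])
  also have "\<dots> = ennreal (\<integral>z. 1 / sqrt (1 + t) * normal_density 0 (1 / sqrt (1 + t)) z \<partial>lborel)"
    using assms by (intro nn_integral_eq_integral) (auto intro!: mult_nonneg_nonneg)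
  also have "(\<integral>z. 1 / sqrt (1 + t) * normal_density 0 (1 / sqrt (1 + t)) z \<partial>lborel) = 1 / sqrt (1 + t)"
    using assms by simp
  finally show ?thesis .
qed

text \<open>With s = 1 / sqrt (1 + t), one factor s is the mass of the weighted density and s^2 is
  the variance of its normalisation.\<close>

lemma nn_integral_std_normal_square_exp:
  assumes "t \<ge> 0"
  shows "(\<integral>\<^sup>+z. ennreal (z\<^sup>2 * exp (- t * z\<^sup>2 / 2)) \<partial>std_normal_measure) = ennreal (1 / sqrt (1 + t) ^ 3)"
proof -
  let ?s = "1 / sqrt (1 + t)"
  have s: "?s > 0" using assms by simp
  have "(\<integral>\<^sup>+z. ennreal (z\<^sup>2 * exp (- t * z\<^sup>2 / 2)) \<partial>std_normal_measure)
      = (\<integral>\<^sup>+z. ennreal (?s * (normal_density 0 ?s z * z ^ 2)) \<partial>lborel)"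
  proof (subst nn_integral_density, measurable, intro nn_integral_cong)
    fix z :: real
    have "ennreal (std_normal_density z) * ennreal (z\<^sup>2 * exp (- t * z\<^sup>2 / 2))
        = ennreal (z\<^sup>2) * (ennreal (std_normal_density z) * ennreal (exp (- t * z\<^sup>2 / 2)))"
      by (simp add: ennreal_mult mult_ac)
    also have "\<dots> = ennreal (?s * (normal_density 0 ?s z * z ^ 2))"
      unfolding std_normal_density_times_exp_ennreal[OF assms] by (simp add: ennreal_mult'[symmetric] mult_ac)
    finally show "ennreal (std_normal_density z) * ennreal (z\<^sup>2 * exp (- t * z\<^sup>2 / 2))
        = ennreal (?s * (normal_density 0 ?s z * z ^ 2))" .
  qed
  also have "\<dots> = ennreal (\<integral>z. ?s * (normal_density 0 ?s z * z ^ 2) \<partial>lborel)"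
    using s integrable_normal_moment[OF s, of 0 2] by (intro nn_integral_eq_integral) auto
  also have "(\<integral>z. ?s * (normal_density 0 ?s z * z ^ 2) \<partial>lborel) = ?s ^ 3"
    using s integral_normal_moment_even[OF s, of 0 1] by (simp add: power2_eq_square power3_eq_cube divide_simps)
  finally show ?thesis using assms by (simp add: power_divide)
qed

lemma nn_integral_std_gauss_inner_square:
  fixes w :: "real ^ 'n::finite"
  shows "(\<integral>\<^sup>+x. ennreal ((x \<bullet> w)\<^sup>2) \<partial>std_gauss) = ennreal ((norm w)\<^sup>2)"
proof -
  have "(\<integral>\<^sup>+x. ennreal ((x \<bullet> w)\<^sup>2) \<partial>std_gauss) = (\<integral>\<^sup>+z. ennreal ((norm w)\<^sup>2) * ennreal (z\<^sup>2 * exp (- 0 * z\<^sup>2 / 2)) \<partial>std_normal_measure)"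
    by (subst nn_integral_std_gauss_inner) (auto simp: power_mult_distrib ennreal_mult)
  also have "\<dots> = ennreal ((norm w)\<^sup>2) * (\<integral>\<^sup>+z. ennreal (z\<^sup>2 * exp (- 0 * z\<^sup>2 / 2)) \<partial>std_normal_measure)"
    by (rule nn_integral_cmult) simp
  also have "\<dots> = ennreal ((norm w)\<^sup>2)"
    by (subst nn_integral_std_normal_square_exp) simp_all
  finally show ?thesis .
qed

lemma nn_integral_lborel_exp_norm:
  "(\<integral>\<^sup>+u. ennreal (exp (- (norm (u :: real ^ 'n::finite))\<^sup>2 / 2)) \<partial>lborel) = ennreal ((2 * pi) powr (real CARD('n) / 2))"
proof -
  let ?c = "(2 * pi) powr (real CARD('n) / 2)" and ?d = "(2 * pi) powr (- real CARD('n) / 2)"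
  have "?c * ?d = 1" by (simp add: powr_add[symmetric])
  then have cd: "ennreal ?c * ennreal ?d = 1"
    by (subst ennreal_mult[symmetric]) (simp_all only: powr_ge_zero ennreal_1)
  have "1 = (\<integral>\<^sup>+u. 1 \<partial>(std_gauss :: (real ^ 'n) measure))" by simp
  also have "\<dots> = (\<integral>\<^sup>+u. ennreal ?d * ennreal (exp (- (norm (u :: real ^ 'n))\<^sup>2 / 2)) \<partial>lborel)"
    unfolding std_gauss_def by (subst nn_integral_density) (auto simp: ennreal_mult)
  also have "\<dots> = ennreal ?d * (\<integral>\<^sup>+u. ennreal (exp (- (norm (u :: real ^ 'n))\<^sup>2 / 2)) \<partial>lborel)"
    by (rule nn_integral_cmult) simp
  finally have "ennreal ?c * 1 = (ennreal ?c * ennreal ?d) * (\<integral>\<^sup>+u. ennreal (exp (- (norm (u :: real ^ 'n))\<^sup>2 / 2)) \<partial>lborel)"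
    by (simp only: mult.assoc)
  then show ?thesis by (simp only: cd mult_1_left mult_1_right)
qed

text \<open>One of the two factors |det Y| is spent on the substitution of Y u for u, the other one
  remains. If Y is singular the integral is infinite, but 0 times infinity is 0 in
  \<open>ennreal\<close>.\<close>

lemma nn_integral_lborel_exp_matrix:
  fixes Y :: "real ^ 'n ^ 'n::finite"
  shows "ennreal ((det Y)\<^sup>2) * (\<integral>\<^sup>+u. ennreal (exp (- (norm (Y *v u))\<^sup>2 / 2)) \<partial>lborel)
    = ennreal ((2 * pi) powr (real CARD('n) / 2) * \<bar>det Y\<bar>)"
proof (cases "det Y = 0")
  case False
  then have inv: "invertible Y" by (simp add: invertible_det_nz)
  have "ennreal ((2 * pi) powr (real CARD('n) / 2))
      = ennreal \<bar>det Y\<bar> * (\<integral>\<^sup>+u. ennreal (exp (- (norm (Y *v u))\<^sup>2 / 2)) \<partial>lborel)"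
    by (subst nn_integral_lborel_matrix[OF inv, symmetric]) (measurable, simp only: nn_integral_lborel_exp_norm)
  then have "ennreal \<bar>det Y\<bar> * ennreal ((2 * pi) powr (real CARD('n) / 2))
      = (ennreal \<bar>det Y\<bar> * ennreal \<bar>det Y\<bar>) * (\<integral>\<^sup>+u. ennreal (exp (- (norm (Y *v u))\<^sup>2 / 2)) \<partial>lborel)"
    by (simp only: mult.assoc)
  then show ?thesis
    by (simp add: ennreal_mult[symmetric] power2_eq_square mult.commute flip: abs_mult)
qed simp

text \<open>Multiplying the Gaussian density by \<open>exp (- (x \<bullet> w)\<^sup>2 / 2)\<close> amounts, up to the total mass,
  to pushing the Gaussian forward by the map \<open>T\<close> below, which shrinks the direction of \<open>w\<close>.\<close>

lemma nn_integral_std_gauss_exp_inner_square: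
  fixes v w :: "real ^ 'n::finite"
  shows "(\<integral>\<^sup>+x. ennreal (exp (- (x \<bullet> w)\<^sup>2 / 2) * (x \<bullet> v)\<^sup>2) \<partial>std_gauss)
    = ennreal ((1 / sqrt (1 + (norm w)\<^sup>2)) * ((norm v)\<^sup>2 - (v \<bullet> w)\<^sup>2 / (1 + (norm w)\<^sup>2)))"
proof -
  define s where "s = 1 / sqrt (1 + (norm w)\<^sup>2)"
  \<comment> \<open>Chosen so that \<open>T\<close> multiplies the direction of \<open>w\<close> by
    \<open>s\<close> and fixes its complement. For w = 0 the division by zero gives 0, which is
    consistent because then s = 1.\<close>
  define \<kappa> where "\<kappa> = (1 - s) / (norm w)\<^sup>2"
  define T where "T x = x - (\<kappa> * (x \<bullet> w)) *\<^sub>R w" for x :: "real ^ 'n"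
  define A where "A = matrix T"
  have pos: "1 + (norm w)\<^sup>2 > 0" by (simp add: add_pos_nonneg)
  have s0: "s > 0" and s2: "s\<^sup>2 * (1 + (norm w)\<^sup>2) = 1"
    using pos by (auto simp: s_def power_divide)
  have k1: "\<kappa> * (norm w)\<^sup>2 = 1 - s"
  proof (cases "w = 0")
    case True then show ?thesis by (simp add: s_def)
  qed (simp add: \<kappa>_def)
  have k2: "\<kappa>\<^sup>2 * (norm w)\<^sup>2 - 2 * \<kappa> = - s\<^sup>2" if "w \<noteq> 0"
  proof -
    have n0: "(norm w)\<^sup>2 \<noteq> 0" using that by simp
    have "(\<kappa>\<^sup>2 * (norm w)\<^sup>2 - 2 * \<kappa> + s\<^sup>2) * (norm w)\<^sup>2 = (\<kappa> * (norm w)\<^sup>2)\<^sup>2 - 2 * (\<kappa> * (norm w)\<^sup>2) + s\<^sup>2 * (norm w)\<^sup>2"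
      by (simp add: algebra_simps power2_eq_square)
    also have "\<dots> = 0"
      unfolding k1 using s2 by (simp add: algebra_simps power2_eq_square)
    finally show ?thesis using n0 by simp
  qed
  have linT: "linear T"
    by (rule linearI) (auto simp: T_def inner_left_distrib algebra_simps scaleR_add_left)
  have AT: "A *v x = T x" for x unfolding A_def by (rule fun_cong[OF matrix_vector_mul(2)[OF linT]])
  have Tw: "T x \<bullet> w = s * (x \<bullet> w)" for x
  proof -
    have "T x \<bullet> w = (x \<bullet> w) * (1 - \<kappa> * (norm w)\<^sup>2)"
      by (simp add: T_def inner_diff_left power2_norm_eq_inner algebra_simps)
    then show ?thesis by (simp add: k1)
  qed
  have Tn: "(norm (T x))\<^sup>2 = (norm x)\<^sup>2 - s\<^sup>2 * (x \<bullet> w)\<^sup>2" for x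
  proof (cases "w = 0")
    case False
    have "T x \<bullet> T x = x \<bullet> x + (\<kappa>\<^sup>2 * (w \<bullet> w) - 2 * \<kappa>) * (x \<bullet> w)\<^sup>2"
      by (simp add: T_def inner_diff_left inner_diff_right algebra_simps power2_eq_square inner_commute)
    then have "(norm (T x))\<^sup>2 = (norm x)\<^sup>2 + (\<kappa>\<^sup>2 * (norm w)\<^sup>2 - 2 * \<kappa>) * (x \<bullet> w)\<^sup>2"
      by (simp only: power2_norm_eq_inner)
    then show ?thesis unfolding k2[OF False] by simp
  qed (simp add: T_def)
  \<comment> \<open>After substituting T x, the exponents of the density and of the weight add up to
    the exponent of the unweighted density.\<close>
  have Tsum: "(norm (T x))\<^sup>2 + (T x \<bullet> w)\<^sup>2 = (norm x)\<^sup>2" for x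
    by (simp add: Tn Tw power_mult_distrib)
  have inv: "invertible A"
    unfolding invertible_left_inverse matrix_left_invertible_ker AT
  proof (intro allI impI)
    fix x assume "T x = 0"
    then show "x = 0" using Tsum[of x] by simp
  qed
  have [measurable]: "(*v) A \<in> borel_measurable borel"
    by (intro borel_measurable_continuous_onI matrix_vector_mult_linear_continuous_on)
  let ?c = "(2 * pi) powr (- real CARD('n) / 2)"
  have push: "(\<integral>\<^sup>+x. ennreal (exp (- (x \<bullet> w)\<^sup>2 / 2)) * f x \<partial>std_gauss) = ennreal \<bar>det A\<bar> * (\<integral>\<^sup>+x. f (T x) \<partial>std_gauss)"
    if [measurable]: "f \<in> borel_measurable borel" for f :: "real ^ 'n \<Rightarrow> ennreal"
  proof -
    let ?D = "\<lambda>x :: real ^ 'n. ennreal (?c * exp (- (norm x)\<^sup>2 / 2))"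
    have D: "?D (T x) * ennreal (exp (- (T x \<bullet> w)\<^sup>2 / 2)) = ?D x" for x
    proof -
      have "exp (- (norm (T x))\<^sup>2 / 2) * exp (- (T x \<bullet> w)\<^sup>2 / 2) = exp (- (norm x)\<^sup>2 / 2)"
        unfolding exp_add[symmetric] Tsum[of x, symmetric] by (simp add: field_simps)
      then show ?thesis by (simp only: ennreal_mult'[symmetric] mult.assoc powr_ge_zero exp_ge_zero mult_nonneg_nonneg)
    qed
    have "(\<integral>\<^sup>+x. ennreal (exp (- (x \<bullet> w)\<^sup>2 / 2)) * f x \<partial>std_gauss)
        = (\<integral>\<^sup>+x. (?D x * ennreal (exp (- (x \<bullet> w)\<^sup>2 / 2))) * f x \<partial>lborel)"
      unfolding std_gauss_def by (subst nn_integral_density) (auto simp: mult.assoc)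
    also have "\<dots> = ennreal \<bar>det A\<bar> * (\<integral>\<^sup>+x. (?D (A *v x) * ennreal (exp (- ((A *v x) \<bullet> w)\<^sup>2 / 2))) * f (A *v x) \<partial>lborel)"
      by (subst nn_integral_lborel_matrix[OF inv]) auto
    also have "(\<integral>\<^sup>+x. (?D (A *v x) * ennreal (exp (- ((A *v x) \<bullet> w)\<^sup>2 / 2))) * f (A *v x) \<partial>lborel)
        = (\<integral>\<^sup>+x. ?D x * f (A *v x) \<partial>lborel)"
      unfolding AT D ..
    also have "\<dots> = (\<integral>\<^sup>+x. f (A *v x) \<partial>std_gauss)"
      unfolding std_gauss_def by (subst nn_integral_density) auto
    finally show ?thesis by (simp add: AT)
  qed
  \<comment> \<open>The determinant is not computed from the matrix: it is the total mass in
    \<open>push\<close> for the constant function 1.\<close>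
  have "ennreal \<bar>det A\<bar> = (\<integral>\<^sup>+x. ennreal (exp (- (x \<bullet> w)\<^sup>2 / 2)) * 1 \<partial>std_gauss)"
    by (subst push) auto
  also have "\<dots> = (\<integral>\<^sup>+z. ennreal (exp (- ((norm w)\<^sup>2) * z\<^sup>2 / 2)) \<partial>std_normal_measure)"
    using nn_integral_std_gauss_inner[of "\<lambda>z. ennreal (exp (- z\<^sup>2 / 2))" w] by (simp add: power_mult_distrib)
  also have "\<dots> = ennreal s"
    unfolding s_def by (rule nn_integral_std_normal_exp) simp
  finally have det: "ennreal \<bar>det A\<bar> = ennreal s" .
  have Tv: "T x \<bullet> v = x \<bullet> T v" for x
    by (simp add: T_def inner_diff_left inner_diff_right inner_commute algebra_simps)
  have "(\<integral>\<^sup>+x. ennreal (exp (- (x \<bullet> w)\<^sup>2 / 2) * (x \<bullet> v)\<^sup>2) \<partial>std_gauss)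
      = ennreal s * (\<integral>\<^sup>+x. ennreal ((T x \<bullet> v)\<^sup>2) \<partial>std_gauss)"
    by (subst det[symmetric], subst push[symmetric]) (auto simp: ennreal_mult)
  also have "\<dots> = ennreal (s * (norm (T v))\<^sup>2)"
    unfolding Tv nn_integral_std_gauss_inner_square using s0 by (simp add: ennreal_mult)
  also have "s * (norm (T v))\<^sup>2 = s * ((norm v)\<^sup>2 - (v \<bullet> w)\<^sup>2 / (1 + (norm w)\<^sup>2))"
    unfolding Tn using s2 pos by (simp add: s_def power_divide)
  finally show ?thesis by (simp add: s_def)
qed

section \<open>Shifted Gaussian vectors in one direction\<close>

lemma has_real_derivative_erf: "(erf has_real_derivative 2 / sqrt pi * exp (- (t\<^sup>2))) (at t)"
proof -
  let ?a = "- \<bar>t\<bar> - 1" and ?b = "\<bar>t\<bar> + 1"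
  have "((\<lambda>u. LBINT y=0..u. exp (- (y\<^sup>2))) has_vector_derivative exp (- (t\<^sup>2))) (at t within {?a..?b})"
  proof -
    have "continuous_on {?a..?b} (\<lambda>y. exp (- (y\<^sup>2)))" by (intro continuous_intros)
    moreover have "?a \<le> 0" "0 \<le> ?b" "?a \<le> t" "t \<le> ?b" by auto
    ultimately show ?thesis
      using interval_integral_FTC2[of ?a 0 ?b "\<lambda>y. exp (- (y\<^sup>2))" t] by (simp add: zero_ereal_def)
  qed
  then have "((\<lambda>u. LBINT y=0..u. exp (- (y\<^sup>2))) has_real_derivative exp (- (t\<^sup>2))) (at t)"
    by (subst (asm) at_within_interior) (auto simp: has_real_derivative_iff_has_vector_derivative)
  from DERIV_cmult[OF this, of "2 / sqrt pi"] show ?thesis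
    by (simp add: erf_def[abs_def])
qed

lemma erf_0 [simp]: "erf 0 = 0"
  by (simp add: erf_def zero_ereal_def)

lemma erf_minus: "erf (- t) = - erf t"
proof -
  have "(LBINT s=0..ereal (- t). exp (- (s\<^sup>2))) = (LBINT s=ereal t..0. exp (- (s\<^sup>2)))"
    by (subst interval_integral_reflect) (simp add: zero_ereal_def)
  also have "\<dots> = - (LBINT s=0..ereal t. exp (- (s\<^sup>2)))"
    by (rule interval_integral_endpoints_reverse)
  finally show ?thesis by (simp add: erf_def)
qed

lemma erf_tendsto_1: "(erf \<longlongrightarrow> 1) at_top"
proof -
  let ?f = "\<lambda>x::real. indicator {0..} x *\<^sub>R exp (- x\<^sup>2)"
  have g: "has_bochner_integral lborel ?f (sqrt pi / 2)" by (rule gaussian_moment_0)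
  have "((\<lambda>y. \<integral>x. indicator {..y} x *\<^sub>R ?f x \<partial>lborel) \<longlongrightarrow> (\<integral>x. ?f x \<partial>lborel)) at_top"
    by (rule tendsto_integral_at_top) (use g in \<open>auto simp: has_bochner_integral_iff\<close>)
  then have "((\<lambda>y. 2 / sqrt pi * (\<integral>x. indicator {..y} x *\<^sub>R ?f x \<partial>lborel)) \<longlongrightarrow> 2 / sqrt pi * (sqrt pi / 2)) at_top"
    unfolding has_bochner_integral_integral_eq[OF g] by (intro tendsto_mult tendsto_const)
  moreover have "\<forall>\<^sub>F y in at_top. 2 / sqrt pi * (\<integral>x. indicator {..y} x *\<^sub>R ?f x \<partial>lborel) = erf y"
  proof (rule eventually_mono[OF eventually_ge_at_top[of 0]])
    fix y :: real assume "0 \<le> y"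
    then have "(LBINT s=0..ereal y. exp (- (s\<^sup>2))) = (LBINT s:{0..y}. exp (- (s\<^sup>2)))"
      using interval_integral_Icc[of 0 y] by (simp add: zero_ereal_def)
    also have "\<dots> = (\<integral>x. indicator {..y} x *\<^sub>R ?f x \<partial>lborel)"
      unfolding set_lebesgue_integral_def by (intro Bochner_Integration.integral_cong) (auto simp: indicator_def)
    finally show "2 / sqrt pi * (\<integral>x. indicator {..y} x *\<^sub>R ?f x \<partial>lborel) = erf y"
      by (simp add: erf_def)
  qed
  ultimately show ?thesis
    by (simp add: tendsto_cong)
qed

text \<open>The integral of exp (- s^2 / 2) from 0 to x. It is the derivative of \<open>lam\<close>,
  which is therefore the second antiderivative of exp (- x^2 / 2) with value 1 and slope 0 at
  0.\<close>

definition gauss_int :: "real \<Rightarrow> real" where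
  "gauss_int x = sqrt (pi / 2) * erf (x / sqrt 2)"

lemma lam_eq: "lam x = exp (- (x\<^sup>2) / 2) + x * gauss_int x"
  by (simp add: lam_def gauss_int_def)

lemma has_real_derivative_gauss_int: "(gauss_int has_real_derivative exp (- (x\<^sup>2) / 2)) (at x)"
proof -
  have "((\<lambda>x. sqrt (pi / 2) * erf (x / sqrt 2)) has_real_derivative
      sqrt (pi / 2) * (2 / sqrt pi * exp (- ((x / sqrt 2)\<^sup>2)) * (1 / sqrt 2))) (at x)"
    by (intro DERIV_cmult DERIV_chain2[OF has_real_derivative_erf] DERIV_cdivide DERIV_ident)
  also have "sqrt (pi / 2) * (2 / sqrt pi * exp (- ((x / sqrt 2)\<^sup>2)) * (1 / sqrt 2)) = exp (- (x\<^sup>2) / 2)"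
    by (simp add: real_sqrt_divide power_divide)
  finally show ?thesis by (simp add: gauss_int_def[abs_def])
qed

lemma has_real_derivative_lam: "(lam has_real_derivative gauss_int x) (at x)"
proof -
  have "((\<lambda>x. exp (- (x\<^sup>2) / 2) + x * gauss_int x) has_real_derivative gauss_int x) (at x)"
    by (rule derivative_eq_intros has_real_derivative_gauss_int refl | simp)+
  then show ?thesis by (simp add: lam_eq[abs_def])
qed

lemma gauss_int_0 [simp]: "gauss_int 0 = 0" by (simp add: gauss_int_def)

lemma lam_0 [simp]: "lam 0 = 1" by (simp add: lam_eq)

lemma gauss_int_minus: "gauss_int (- x) = - gauss_int x"
  using erf_minus[of "x / sqrt 2"] by (simp add: gauss_int_def)

lemma lam_minus: "lam (- x) = lam x"
  by (simp add: lam_eq gauss_int_minus)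

lemma lam_abs [simp]: "lam \<bar>x\<bar> = lam x"
  by (cases "x \<ge> 0") (auto simp: lam_minus)

lemma gauss_int_mono: "x \<le> y \<Longrightarrow> gauss_int x \<le> gauss_int y"
  by (rule DERIV_nonneg_imp_nondecreasing) (auto intro!: exI has_real_derivative_gauss_int)

lemma gauss_int_nonneg: "0 \<le> x \<Longrightarrow> 0 \<le> gauss_int x"
  using gauss_int_mono[of 0 x] by simp

lemma gauss_int_le: "0 \<le> x \<Longrightarrow> gauss_int x \<le> x"
proof -
  assume x: "0 \<le> x"
  have "(\<lambda>x. x - gauss_int x) 0 \<le> (\<lambda>x. x - gauss_int x) x"
    by (rule DERIV_nonneg_imp_nondecreasing[OF x])
      (auto intro!: exI derivative_eq_intros has_real_derivative_gauss_int)
  then show ?thesis by simp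
qed

lemma gauss_int_tendsto: "(gauss_int \<longlongrightarrow> sqrt (pi / 2)) at_top"
proof -
  have "filterlim (\<lambda>x::real. x / sqrt 2) at_top at_top" by real_asymp
  from filterlim_compose[OF erf_tendsto_1 this]
  have "((\<lambda>x. sqrt (pi / 2) * erf (x / sqrt 2)) \<longlongrightarrow> sqrt (pi / 2) * 1) at_top"
    by (intro tendsto_mult tendsto_const)
  then show ?thesis by (simp add: gauss_int_def[abs_def])
qed

lemma gauss_int_le_sqrt: "gauss_int x \<le> sqrt (pi / 2)"
  by (rule tendsto_lowerbound[OF gauss_int_tendsto])
    (auto intro!: eventually_mono[OF eventually_ge_at_top[of x]] gauss_int_mono)

lemma lam_ge_1: "lam x \<ge> 1"
proof -
  have "lam 0 \<le> lam \<bar>x\<bar>"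
    by (rule DERIV_nonneg_imp_nondecreasing) (auto intro!: exI has_real_derivative_lam gauss_int_nonneg)
  then show ?thesis by simp
qed

text \<open>The values agree at 0, and the derivatives satisfy gauss_int y <= y <= y exp (y^2 / 2).
  The bound fixes the sign of the derivative in \<open>lam_square_quotient_mono\<close>.\<close>

lemma lam_le_exp: "0 \<le> x \<Longrightarrow> lam x \<le> exp (x\<^sup>2 / 2)"
proof -
  assume x: "0 \<le> x"
  have "(\<lambda>x. exp (x\<^sup>2 / 2) - lam x) 0 \<le> (\<lambda>x. exp (x\<^sup>2 / 2) - lam x) x"
  proof (rule DERIV_nonneg_imp_nondecreasing[OF x])
    fix y :: real assume y: "0 \<le> y"
    have "((\<lambda>x. exp (x\<^sup>2 / 2) - lam x) has_real_derivative y * exp (y\<^sup>2 / 2) - gauss_int y) (at y)"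
      by (rule derivative_eq_intros has_real_derivative_lam refl | simp)+
    moreover have "gauss_int y \<le> y * exp (y\<^sup>2 / 2)"
      using gauss_int_le[OF y] mult_left_mono[OF one_le_exp_iff[THEN iffD2, of "y\<^sup>2 / 2"] y] by simp
    ultimately show "\<exists>d. ((\<lambda>x. exp (x\<^sup>2 / 2) - lam x) has_real_derivative d) (at y) \<and> 0 \<le> d" by force
  qed
  then show ?thesis by simp
qed

text \<open>Since x * gauss_int x = lam x - exp (- x^2 / 2), the numerator of the derivative factors
  as 2 x (1 - lam x exp (- x^2 / 2)), which \<open>lam_le_exp\<close> makes nonnegative.\<close>

lemma lam_square_quotient_mono:
  assumes "0 < x" "x \<le> y"
  shows "((lam x)\<^sup>2 - 1) / x\<^sup>2 \<le> ((lam y)\<^sup>2 - 1) / y\<^sup>2"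
proof (rule DERIV_nonneg_imp_nondecreasing[OF assms(2)])
  fix z assume "x \<le> z"
  then have z: "z > 0" using assms by simp
  have "((\<lambda>z. ((lam z)\<^sup>2 - 1) / z\<^sup>2) has_real_derivative
      (2 * lam z * gauss_int z * z\<^sup>2 - ((lam z)\<^sup>2 - 1) * (2 * z)) / (z\<^sup>2 * z\<^sup>2)) (at z)"
    using z by (auto intro!: derivative_eq_intros has_real_derivative_lam simp: power2_eq_square)
  moreover have "0 \<le> (2 * lam z * gauss_int z * z\<^sup>2 - ((lam z)\<^sup>2 - 1) * (2 * z)) / (z\<^sup>2 * z\<^sup>2)"
  proof -
    have "lam z * exp (- (z\<^sup>2) / 2) \<le> exp (z\<^sup>2 / 2) * exp (- (z\<^sup>2) / 2)"
      using lam_le_exp[of z] z by (intro mult_right_mono) auto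
    then have "lam z * exp (- (z\<^sup>2) / 2) \<le> 1" by (simp flip: exp_add)
    moreover have "2 * lam z * gauss_int z * z\<^sup>2 - ((lam z)\<^sup>2 - 1) * (2 * z) = 2 * z * (1 - lam z * exp (- (z\<^sup>2) / 2))"
    proof -
      have "exp (- (z\<^sup>2) / 2) = lam z - z * gauss_int z" by (simp add: lam_eq)
      then show ?thesis by (simp only:) (simp add: algebra_simps power2_eq_square)
    qed
    ultimately show ?thesis using z by (auto intro!: divide_nonneg_nonneg mult_nonneg_nonneg)
  qed
  ultimately show "\<exists>d. ((\<lambda>z. ((lam z)\<^sup>2 - 1) / z\<^sup>2) has_real_derivative d) (at z) \<and> 0 \<le> d" by blast
qed

text \<open>By monotonicity the quotient is at most its limit at infinity. As gauss_int is at most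
  sqrt (pi / 2), lam y is at most 1 + y sqrt (pi / 2) for y > 0, which bounds that limit by pi /
  2.\<close>

lemma lam_square_quotient_le:
  assumes x: "0 < x"
  shows "((lam x)\<^sup>2 - 1) / x\<^sup>2 \<le> pi / 2"
proof (rule tendsto_lowerbound)
  let ?r = "sqrt (pi / 2)"
  have "((\<lambda>y. ?r ^ 2 + 2 * ?r / y) \<longlongrightarrow> ?r ^ 2) at_top" by real_asymp
  then show "((\<lambda>y. pi / 2 + 2 * ?r / y) \<longlongrightarrow> pi / 2) at_top" by simp
  show "\<forall>\<^sub>F y in at_top. ((lam x)\<^sup>2 - 1) / x\<^sup>2 \<le> pi / 2 + 2 * ?r / y"
  proof (rule eventually_mono[OF eventually_ge_at_top[of x]])
    fix y assume xy: "x \<le> y"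
    then have y: "y > 0" using x by simp
    have "lam y \<le> 1 + y * ?r"
      unfolding lam_eq using gauss_int_le_sqrt[of y] y by (intro add_mono mult_left_mono) auto
    then have "(lam y)\<^sup>2 \<le> (1 + y * ?r)\<^sup>2"
      using lam_ge_1[of y] by (intro power_mono) auto
    also have "\<dots> = 1 + 2 * ?r * y + y\<^sup>2 * (pi / 2)"
      by (simp add: power2_sum power_mult_distrib)
    finally have "((lam y)\<^sup>2 - 1) / y\<^sup>2 \<le> (2 * ?r * y + y\<^sup>2 * (pi / 2)) / y\<^sup>2"
      by (intro divide_right_mono) auto
    also have "\<dots> = pi / 2 + 2 * ?r / y" using y by (simp add: add_divide_distrib power2_eq_square)
    finally show "((lam x)\<^sup>2 - 1) / x\<^sup>2 \<le> pi / 2 + 2 * ?r / y"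
      using lam_square_quotient_mono[OF x xy] by simp
  qed
qed simp

section \<open>The function \<open>phi_inf\<close> and the constant \<open>b_inf\<close>\<close>

lemma phi_inf_eq_lam:
  assumes "z > 0"
  shows "phi_inf x z = z * lam (x * sqrt (2 / pi) / z)"
proof -
  have "(x * sqrt (2 / pi) / z)\<^sup>2 / 2 = x\<^sup>2 / (pi * z\<^sup>2)"
    by (simp add: power_mult_distrib power_divide)
  moreover have "x * sqrt (2 / pi) / z / sqrt 2 = x / (sqrt pi * z)"
    by (simp add: real_sqrt_divide)
  moreover have "sqrt (pi / 2) * (x * sqrt (2 / pi) / z) = x / z"
    by (simp add: real_sqrt_divide)
  ultimately show ?thesis
    using assms unfolding phi_inf_def lam_def by (simp add: distrib_left)
qed

lemma phi_inf_nonneg: "phi_inf x z \<ge> 0"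
proof (cases "z = 0")
  case False
  then have "phi_inf x z = phi_inf x \<bar>z\<bar>" by (simp add: phi_inf_def)
  also have "\<dots> \<ge> 0"
    using phi_inf_eq_lam[of "\<bar>z\<bar>" x] False lam_ge_1[of "x * sqrt (2 / pi) / \<bar>z\<bar>"] by simp
  finally show ?thesis .
qed (simp add: phi_inf_def)

lemma b_inf_nonneg: "b_inf \<ge> 0"
  unfolding b_inf_def by (rule cInf_greatest) (auto intro: phi_inf_nonneg)

lemma b_inf_le_phi_inf:
  assumes "x\<^sup>2 + z\<^sup>2 = 1"
  shows "b_inf \<le> phi_inf x z"
proof -
  obtain t where t: "0 \<le> t" "t < 2 * pi" "x = cos t" "z = sin t"
    using sincos_total_2pi[OF assms] by metis
  then show ?thesis
    unfolding b_inf_def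
    by (intro cInf_lower) (auto intro!: bdd_belowI[of _ 0] phi_inf_nonneg)
qed

text \<open>The point (r sqrt (pi / 2), 1), divided by its norm sqrt (1 + pi/2 r^2), lies on the
  unit circle, and \<open>phi_inf\<close> takes there the value lam r divided by the same
  norm.\<close>

lemma b_inf_le_lam: "b_inf * sqrt (1 + pi / 2 * r\<^sup>2) \<le> lam r"
proof -
  let ?q = "sqrt (1 + pi / 2 * r\<^sup>2)"
  have q2: "?q\<^sup>2 = 1 + pi / 2 * r\<^sup>2" by (simp add: add_nonneg_nonneg)
  have q: "?q > 0" by (simp add: add_pos_nonneg)
  let ?x = "r * sqrt (pi / 2) / ?q" and ?z = "1 / ?q"
  have "?x\<^sup>2 + ?z\<^sup>2 = (r\<^sup>2 * (pi / 2) + 1) / ?q\<^sup>2"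
    by (simp add: power_divide power_mult_distrib add_divide_distrib del: real_sqrt_pow2_iff)
  also have "\<dots> = 1" unfolding q2 using q2 q by (simp add: field_simps)
  finally have "b_inf \<le> phi_inf ?x ?z" by (rule b_inf_le_phi_inf)
  also have "phi_inf ?x ?z = ?z * lam r"
  proof -
    have 1: "sqrt (pi / 2) * sqrt (2 / pi) = 1" by (simp flip: real_sqrt_mult)
    have "?x * sqrt (2 / pi) / ?z = r * (sqrt (pi / 2) * sqrt (2 / pi)) * (?q / ?q)"
      by (simp only: divide_divide_eq_right times_divide_eq_left times_divide_eq_right mult_ac mult_1_left div_by_1)
    also have "\<dots> = r" unfolding 1 using q by simp
    finally have "lam (?x * sqrt (2 / pi) / ?z) = lam r" by (simp only:)
    then show ?thesis using phi_inf_eq_lam[of ?z ?x] q by (simp only: zero_less_divide_1_iff)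
  qed
  finally show ?thesis using q by (simp add: pos_le_divide_eq)
qed

text \<open>To be read with s = |c| and r = (c . w) / |w|: the square root is then |Tmap c w| / |w|.
  The upper bound compares the monotone quotient at |r| and s; the lower bound replaces the quotient
  at s by pi / 2 and applies \<open>b_inf_le_lam\<close>.\<close>

lemma lam_comparison:
  assumes "0 < s" "\<bar>r\<bar> \<le> s"
  shows "lam r \<le> sqrt (1 + ((lam s)\<^sup>2 - 1) * r\<^sup>2 / s\<^sup>2)"
    and "b_inf * sqrt (1 + ((lam s)\<^sup>2 - 1) * r\<^sup>2 / s\<^sup>2) \<le> lam r"
proof -
  have "(lam r)\<^sup>2 \<le> 1 + ((lam s)\<^sup>2 - 1) * r\<^sup>2 / s\<^sup>2"
  proof (cases "r = 0")
    case False
    then have "((lam \<bar>r\<bar>)\<^sup>2 - 1) / \<bar>r\<bar>\<^sup>2 \<le> ((lam s)\<^sup>2 - 1) / s\<^sup>2"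
      using assms by (intro lam_square_quotient_mono) auto
    then have "((lam r)\<^sup>2 - 1) / r\<^sup>2 * r\<^sup>2 \<le> ((lam s)\<^sup>2 - 1) / s\<^sup>2 * r\<^sup>2"
      by (intro mult_right_mono) auto
    then show ?thesis using False by simp
  qed simp
  then show "lam r \<le> sqrt (1 + ((lam s)\<^sup>2 - 1) * r\<^sup>2 / s\<^sup>2)"
    by (rule real_le_rsqrt)
  have "((lam s)\<^sup>2 - 1) / s\<^sup>2 * r\<^sup>2 \<le> pi / 2 * r\<^sup>2"
    using lam_square_quotient_le[OF assms(1)] by (intro mult_right_mono) auto
  then have "sqrt (1 + ((lam s)\<^sup>2 - 1) * r\<^sup>2 / s\<^sup>2) \<le> sqrt (1 + pi / 2 * r\<^sup>2)"
    by simp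
  then have "b_inf * sqrt (1 + ((lam s)\<^sup>2 - 1) * r\<^sup>2 / s\<^sup>2) \<le> b_inf * sqrt (1 + pi / 2 * r\<^sup>2)"
    by (rule mult_left_mono[OF _ b_inf_nonneg])
  also have "\<dots> \<le> lam r" by (rule b_inf_le_lam)
  finally show "b_inf * sqrt (1 + ((lam s)\<^sup>2 - 1) * r\<^sup>2 / s\<^sup>2) \<le> lam r" .
qed

section \<open>Mean absolute value of a shifted normal variable, and the comparison for one
  column\<close>

lemma nn_integral_std_normal_tail:
  "(\<integral>\<^sup>+z. ennreal (z - c) * indicator {c..} z \<partial>std_normal_measure)
    = ennreal (std_normal_density c + c * erf (c / sqrt 2) / 2 - c / 2)"
proof -
  \<comment> \<open>An antiderivative of (z - c) times the normal density. The quotient of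
    \<open>gauss_int\<close> by sqrt (2 pi) is the normal distribution function minus 1/2, so
    \<open>?F\<close> tends to - c / 2.\<close>
  let ?F = "\<lambda>z. - std_normal_density z - c * (gauss_int z / sqrt (2 * pi))"
  have sq: "gauss_int z / sqrt (2 * pi) = erf (z / sqrt 2) / 2" for z
    by (simp add: gauss_int_def real_sqrt_divide real_sqrt_mult field_simps)
  have "(\<integral>\<^sup>+z. ennreal (z - c) * indicator {c..} z \<partial>std_normal_measure)
      = (\<integral>\<^sup>+z. ennreal ((z - c) * std_normal_density z) * indicator {c..} z \<partial>lborel)"
    by (subst nn_integral_density) (auto intro!: nn_integral_cong simp: ennreal_mult'[symmetric] indicator_def mult.commute)
  also have "\<dots> = ennreal (- c * (1 / 2) - ?F c)"
  proof (rule nn_integral_FTC_atLeast[where F = ?F])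
    fix z assume "c \<le> z"
    show "(?F has_real_derivative (z - c) * std_normal_density z) (at z)"
      unfolding std_normal_density_def
      by (rule derivative_eq_intros has_real_derivative_gauss_int refl | simp)+
        (simp add: field_simps)
    show "0 \<le> (z - c) * std_normal_density z" using \<open>c \<le> z\<close> by simp
  next
    have d: "(std_normal_density \<longlongrightarrow> 0) at_top"
      unfolding std_normal_density_def by real_asymp
    have "((\<lambda>z. gauss_int z / sqrt (2 * pi)) \<longlongrightarrow> sqrt (pi / 2) / sqrt (2 * pi)) at_top"
      by (intro tendsto_divide gauss_int_tendsto tendsto_const) auto
    moreover have "sqrt (pi / 2) / sqrt (2 * pi) = 1 / 2"
      by (simp add: real_sqrt_divide real_sqrt_mult field_simps)
    ultimately have g: "((\<lambda>z. gauss_int z / sqrt (2 * pi)) \<longlongrightarrow> 1 / 2) at_top"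
      by (simp only:)
    have "(?F \<longlongrightarrow> - 0 - c * (1 / 2)) at_top"
      by (intro tendsto_diff tendsto_minus tendsto_mult tendsto_const d g)
    then show "(?F \<longlongrightarrow> - c * (1 / 2)) at_top" by simp
  qed measurable
  also have "- c * (1 / 2) - ?F c = std_normal_density c + c * erf (c / sqrt 2) / 2 - c / 2"
    by (simp add: sq)
  finally show ?thesis .
qed

lemma nn_integral_std_normal_abs:
  "(\<integral>\<^sup>+z. ennreal \<bar>a + z\<bar> \<partial>std_normal_measure) = ennreal (sqrt (2 / pi) * lam a)"
proof -
  let ?H = "\<lambda>c. std_normal_density c + c * erf (c / sqrt 2) / 2 - c / 2"
  \<comment> \<open>Adding two tails under \<open>ennreal\<close> needs nonnegative values. A
    negative \<open>?H c\<close> would be truncated to 0 by \<open>ennreal\<close>, and the positive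
    integrand on the interval from c to c + 1 would vanish almost everywhere.\<close>
  have H: "?H c \<ge> 0" for c
  proof (rule ccontr)
    assume "\<not> ?H c \<ge> 0"
    then have neg: "?H c < 0" by simp
    have z: "(\<integral>\<^sup>+z. ennreal (z - c) * indicator {c..} z \<partial>std_normal_measure) = 0"
      using nn_integral_std_normal_tail[of c] neg by (simp add: ennreal_neg)
    have [measurable]: "(\<lambda>z. ennreal (z - c) * indicator {c..} z) \<in> borel_measurable std_normal_measure"
      by measurable
    from z have "AE z in std_normal_measure. ennreal (z - c) * indicator {c..} z = 0"
      by (subst (asm) nn_integral_0_iff_AE) auto
    then have "AE z in lborel. ennreal (z - c) * indicator {c..} z = 0"
      by (subst (asm) AE_density) (auto simp: normal_density_pos)
    then have "AE z in lborel. z \<notin> {c<..c + 1}"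
      by (rule AE_mp) (auto intro!: AE_I2 simp: indicator_def split: if_splits)
    then have "emeasure lborel {c<..c + 1} = 0"
      by (subst (asm) AE_iff_measurable[of "{c<..c + 1}"]) auto
    then show False by simp
  qed
  have "(\<integral>\<^sup>+z. ennreal \<bar>a + z\<bar> \<partial>std_normal_measure)
      = (\<integral>\<^sup>+z. ennreal (z - (- a)) * indicator {- a..} z + ennreal ((- z) - a) * indicator {a..} (- z) \<partial>std_normal_measure)"
  proof (intro nn_integral_cong)
    fix z
    consider "z < - a" | "z = - a" | "z > - a" by linarith
    then show "ennreal \<bar>a + z\<bar> = ennreal (z - (- a)) * indicator {- a..} z + ennreal ((- z) - a) * indicator {a..} (- z)"
      by cases (simp_all add: indicator_def add.commute)
  qed
  also have "\<dots> = (\<integral>\<^sup>+z. ennreal (z - (- a)) * indicator {- a..} z \<partial>std_normal_measure)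
      + (\<integral>\<^sup>+z. ennreal ((- z) - a) * indicator {a..} (- z) \<partial>std_normal_measure)"
    by (rule nn_integral_add) auto
  also have "(\<integral>\<^sup>+z. ennreal ((- z) - a) * indicator {a..} (- z) \<partial>std_normal_measure)
      = (\<integral>\<^sup>+z. ennreal (std_normal_density (- z)) * (ennreal ((- z) - a) * indicator {a..} (- z)) \<partial>lborel)"
    by (subst nn_integral_density) (auto simp: std_normal_density_def)
  also have "\<dots> = (\<integral>\<^sup>+z. ennreal (std_normal_density z) * (ennreal (z - a) * indicator {a..} z) \<partial>lborel)"
    using nn_integral_real_affine[of "\<lambda>z. ennreal (std_normal_density z) * (ennreal (z - a) * indicator {a..} z)" "-1" 0]
    by simp
  also have "\<dots> = (\<integral>\<^sup>+z. ennreal (z - a) * indicator {a..} z \<partial>std_normal_measure)"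
    by (subst nn_integral_density) auto
  finally have "(\<integral>\<^sup>+z. ennreal \<bar>a + z\<bar> \<partial>std_normal_measure) = ennreal (?H (- a)) + ennreal (?H a)"
    by (simp only: nn_integral_std_normal_tail)
  also have "\<dots> = ennreal (?H (- a) + ?H a)"
    by (rule ennreal_plus[symmetric]) (rule H)+
  also have "?H (- a) + ?H a = 2 * std_normal_density a + a * erf (a / sqrt 2)"
  proof -
    have "std_normal_density (- a) = std_normal_density a" by (simp add: std_normal_density_def)
    then show ?thesis using erf_minus[of "a / sqrt 2"] by simp
  qed
  also have "\<dots> = sqrt (2 / pi) * lam a"
  proof -
    have "sqrt (2 / pi) * sqrt (pi / 2) = 1" by (simp flip: real_sqrt_mult)
    then have "sqrt (2 / pi) * lam a = sqrt (2 / pi) * exp (- (a\<^sup>2) / 2) + a * erf (a / sqrt 2)"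
      by (simp add: lam_def distrib_left flip: mult.assoc)
    moreover have "2 * (1 / sqrt (2 * pi)) = sqrt (2 / pi)"
      by (simp add: real_sqrt_divide real_sqrt_mult divide_simps)
    ultimately show ?thesis unfolding std_normal_density_def by (simp only: mult.assoc[symmetric])
  qed
  finally show ?thesis .
qed

lemma norm_Tmap_square:
  assumes "c \<noteq> 0"
  shows "(norm (Tmap c w))\<^sup>2 = (norm w)\<^sup>2 + ((lam (norm c))\<^sup>2 - 1) * (w \<bullet> c)\<^sup>2 / (norm c)\<^sup>2"
proof -
  define \<kappa> where "\<kappa> = (lam (norm c) - 1) * ((w \<bullet> c) / (norm c)\<^sup>2)"
  have n: "(norm c)\<^sup>2 \<noteq> 0" using assms by simp
  have "Tmap c w \<bullet> Tmap c w = w \<bullet> w + 2 * \<kappa> * (w \<bullet> c) + \<kappa>\<^sup>2 * (c \<bullet> c)"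
  proof -
    have "Tmap c w = w + \<kappa> *\<^sub>R c" using assms by (simp add: Tmap_def \<kappa>_def)
    then show ?thesis
      by (simp add: inner_add_left inner_add_right inner_commute algebra_simps power2_eq_square)
  qed
  also have "\<dots> = (norm w)\<^sup>2 + 2 * \<kappa> * (w \<bullet> c) + \<kappa>\<^sup>2 * (norm c)\<^sup>2"
    by (simp only: power2_norm_eq_inner)
  also have "\<dots> = (norm w)\<^sup>2 + ((lam (norm c))\<^sup>2 - 1) * (w \<bullet> c)\<^sup>2 / (norm c)\<^sup>2"
  proof -
    have "2 * ((l - 1) * (p / n)) * p + ((l - 1) * (p / n))\<^sup>2 * n = (l\<^sup>2 - 1) * p\<^sup>2 / n" if "n \<noteq> 0" for l p n :: real
      using that by (simp add: field_simps power2_eq_square)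
    from this[OF n] show ?thesis unfolding \<kappa>_def by simp
  qed
  finally show ?thesis by (simp only: power2_norm_eq_inner)
qed

lemma inner_Tmap: "Tmap c x \<bullet> w = x \<bullet> Tmap c w"
  by (simp add: Tmap_def inner_add_left inner_add_right inner_commute)

text \<open>Both means reduce to one normal variable: \<open>E2\<close> is sqrt (2/pi) |Tmap c w|
  because \<open>Tmap c\<close> is self-adjoint, and for w nonzero \<open>E1\<close> is sqrt (2/pi)
  |w| lam r with r = (c . w) / |w|. Cauchy-Schwarz gives |r| <= |c|, as
  \<open>lam_comparison\<close> requires.\<close>

theorem Gaussian_comparison:
  fixes c w :: "real ^ 'n::finite"
  defines "E1 \<equiv> (\<integral>\<^sup>+x. ennreal \<bar>(c + x) \<bullet> w\<bar> \<partial>std_gauss)"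
    and "E2 \<equiv> (\<integral>\<^sup>+x. ennreal \<bar>Tmap c x \<bullet> w\<bar> \<partial>std_gauss)"
  shows "E1 \<le> E2" and "ennreal b_inf * E2 \<le> E1"
proof -
  let ?\<sigma> = "norm w" and ?a = "c \<bullet> w" and ?s = "norm c"
  have E2: "E2 = ennreal (sqrt (2 / pi) * norm (Tmap c w))"
  proof -
    have "E2 = (\<integral>\<^sup>+z. ennreal \<bar>norm (Tmap c w) * z\<bar> \<partial>std_normal_measure)"
      unfolding E2_def inner_Tmap by (rule nn_integral_std_gauss_inner) measurable
    also have "\<dots> = (\<integral>\<^sup>+z. ennreal (norm (Tmap c w)) * ennreal \<bar>0 + z\<bar> \<partial>std_normal_measure)"
      by (simp add: abs_mult ennreal_mult)
    also have "\<dots> = ennreal (norm (Tmap c w)) * ennreal (sqrt (2 / pi) * lam 0)"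
      by (subst nn_integral_cmult) (auto simp only: nn_integral_std_normal_abs, measurable)
    finally show ?thesis by (simp add: ennreal_mult[symmetric] mult.commute)
  qed
  have "E1 \<le> E2 \<and> ennreal b_inf * E2 \<le> E1"
  proof (cases "w = 0")
    case True
    then show ?thesis by (simp add: E1_def E2_def)
  next
    case False
    let ?r = "?a / ?\<sigma>"
    have \<sigma>: "?\<sigma> > 0" using False by simp
    have E1: "E1 = ennreal (sqrt (2 / pi) * (?\<sigma> * lam ?r))"
    proof -
      have "E1 = (\<integral>\<^sup>+z. ennreal \<bar>?a + ?\<sigma> * z\<bar> \<partial>std_normal_measure)"
        unfolding E1_def inner_add_left by (rule nn_integral_std_gauss_inner) measurable
      also have "\<dots> = (\<integral>\<^sup>+z. ennreal ?\<sigma> * ennreal \<bar>?r + z\<bar> \<partial>std_normal_measure)"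
      proof (intro nn_integral_cong)
        fix z
        have "?a + ?\<sigma> * z = ?\<sigma> * (?r + z)" using \<sigma> by (simp add: field_simps)
        then show "ennreal \<bar>?a + ?\<sigma> * z\<bar> = ennreal ?\<sigma> * ennreal \<bar>?r + z\<bar>"
          by (simp only: abs_mult abs_norm_cancel ennreal_mult norm_ge_zero abs_ge_zero)
      qed
      also have "\<dots> = ennreal ?\<sigma> * ennreal (sqrt (2 / pi) * lam ?r)"
        by (subst nn_integral_cmult) (auto simp only: nn_integral_std_normal_abs, measurable)
      finally show ?thesis using lam_ge_1[of ?r] by (simp add: ennreal_mult[symmetric] mult_ac)
    qed
    have "?\<sigma> * lam ?r \<le> norm (Tmap c w) \<and> b_inf * norm (Tmap c w) \<le> ?\<sigma> * lam ?r"
    proof (cases "c = 0")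
      case True
      \<comment> \<open>For c = 0 the map is the identity and both means coincide, so only this
        bound on the constant is left; it is the case r = 0 with lam 0 = 1.\<close>
      have "b_inf \<le> 1" using b_inf_le_lam[of 0] by simp
      then show ?thesis using True \<sigma> by (simp add: Tmap_def)
    next
      case c: False
      let ?q = "1 + ((lam ?s)\<^sup>2 - 1) * ?r\<^sup>2 / ?s\<^sup>2"
      have "(norm (Tmap c w))\<^sup>2 = ?\<sigma>\<^sup>2 * ?q"
        unfolding norm_Tmap_square[OF c] using \<sigma> c by (simp add: field_simps inner_commute)
      then have n: "norm (Tmap c w) = ?\<sigma> * sqrt ?q"
        by (metis abs_norm_cancel norm_ge_zero real_sqrt_abs real_sqrt_mult)
      have "\<bar>?r\<bar> \<le> ?s"
        using Cauchy_Schwarz_ineq2[of c w] \<sigma> by (simp add: divide_le_eq)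
      note cmp = lam_comparison[OF _ this]
      show ?thesis
        unfolding n using cmp c \<sigma> mult_left_mono[OF cmp(1), of ?\<sigma>] mult_left_mono[OF cmp(2), of ?\<sigma>]
        by (simp add: mult_ac)
    qed
    then show ?thesis
      unfolding E1 E2 using b_inf_nonneg
      by (auto simp: ennreal_mult[symmetric] mult.left_commute[of b_inf] simp del: real_sqrt_eq_iff
          intro!: ennreal_leI mult_left_mono)
  qed
  then show "E1 \<le> E2" "ennreal b_inf * E2 \<le> E1" by auto
qed

section \<open>Gram determinants and Gaussian columns\<close>

definition gram_det :: "nat \<Rightarrow> (nat \<Rightarrow> 'a::real_inner) \<Rightarrow> real" where
  "gram_det k z = det_k k (\<lambda>i j. z i \<bullet> z j)"

lemma det_k_cong: "(\<And>i j. i < k \<Longrightarrow> j < k \<Longrightarrow> A i j = B i j) \<Longrightarrow> det_k k A = det_k k B"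
  unfolding det_k_def
  by (intro sum.cong refl arg_cong2[where f = "(*)"] prod.cong) (auto simp: permutes_in_image dest: permutes_in_image)

lemma gram_det_cong: "(\<And>i. i < k \<Longrightarrow> z i = z' i) \<Longrightarrow> gram_det k z = gram_det k z'"
  unfolding gram_det_def by (rule det_k_cong) simp

text \<open>A permutation that moves j meets column j in some row i < j, where the entry is 0. Those
  that fix j are the permutations of the first j indices.\<close>

lemma det_k_Suc_column:
  assumes z: "\<And>i. i < j \<Longrightarrow> A i j = 0"
  shows "det_k (Suc j) A = det_k j A * A j j"
proof -
  have "det_k (Suc j) A = (\<Sum>p | p permutes {..<j}. of_int (sign p) * (\<Prod>i<Suc j. A i (p i)))"
    unfolding det_k_def
  proof (rule sum.mono_neutral_right)
    show "finite {p. p permutes {..<Suc j}}" by (simp add: finite_permutations)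
    show "{p. p permutes {..<j}} \<subseteq> {p. p permutes {..<Suc j}}"
      by (auto intro: permutes_subset)
    show "\<forall>p\<in>{p. p permutes {..<Suc j}} - {p. p permutes {..<j}}. of_int (sign p) * (\<Prod>i<Suc j. A i (p i)) = 0"
    proof
      fix p assume "p \<in> {p. p permutes {..<Suc j}} - {p. p permutes {..<j}}"
      then have p: "p permutes {..<Suc j}" "\<not> p permutes {..<j}" by auto
      have pj: "p j \<noteq> j"
      proof
        assume "p j = j"
        then have "p permutes {..<j}"
          by (intro permutes_superset[OF p(1)]) (auto simp: less_Suc_eq)
        then show False using p by simp
      qed
      define i where "i = inv p j"
      have pi: "p i = j" unfolding i_def using p(1) by (simp add: permutes_inverses)
      then have "i \<noteq> j" using pj by auto
      moreover have "i < Suc j" using pi permutes_in_image[OF p(1), of i] by simp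
      ultimately have "i < j" by simp
      then have "A i (p i) = 0" using z pi by simp
      then have "(\<Prod>i<Suc j. A i (p i)) = 0" using \<open>i < Suc j\<close> by (intro prod_zero) auto
      then show "of_int (sign p) * (\<Prod>i<Suc j. A i (p i)) = 0" by simp
    qed
  qed
  also have "\<dots> = (\<Sum>p | p permutes {..<j}. of_int (sign p) * (\<Prod>i<j. A i (p i)) * A j j)"
    by (intro sum.cong refl) (auto simp: permutes_not_in)
  finally show ?thesis by (simp add: det_k_def sum_distrib_right)
qed

lemma gram_det_orthonormal_extension:
  assumes "k \<le> m" "\<And>i. k \<le> i \<Longrightarrow> i < m \<Longrightarrow> norm (z i) = 1"
    and "\<And>i j. k \<le> i \<Longrightarrow> i < m \<Longrightarrow> j < i \<Longrightarrow> z j \<bullet> z i = 0"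
  shows "gram_det m z = gram_det k z"
  using assms
proof (induction m rule: dec_induct)
  case (step n)
  have "gram_det (Suc n) z = gram_det n z * (z n \<bullet> z n)"
    unfolding gram_det_def using step.prems(2)[of n] step.hyps by (intro det_k_Suc_column) auto
  also have "z n \<bullet> z n = 1" using step.prems(1)[of n] step.hyps by (simp add: dot_square_norm)
  finally show ?case using step by simp
qed simp

text \<open>The Gram matrix is M times its transpose. The index type has no canonical enumeration;
  any bijection \<open>f\<close> serves, since the square absorbs the sign.\<close>

lemma gram_det_eq_det_square:
  fixes z :: "nat \<Rightarrow> real ^ 'n::finite" and f :: "'n \<Rightarrow> nat"
  assumes f: "bij_betw f UNIV {..<CARD('n)}"
  shows "gram_det CARD('n) z = (det (\<chi> a. z (f a)))\<^sup>2"
proof -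
  let ?M = "(\<chi> a. z (f a)) :: real ^ 'n ^ 'n" and ?A = "\<lambda>i j. z i \<bullet> z j"
  have inj: "inj_on f UNIV" and ran: "range f = {..<CARD('n)}"
    using f by (auto simp: bij_betw_def)
  have "gram_det CARD('n) z = (\<Sum>p | p permutes (UNIV :: 'n set). of_int (sign (map_permutation UNIV f p)) *
      (\<Prod>i<CARD('n). ?A i (map_permutation UNIV f p i)))"
    unfolding gram_det_def det_k_def
    by (rule sum.reindex_bij_betw[symmetric])
      (use bij_betw_permutations[OF f] ran in \<open>simp add: map_permutation_def restrict_id_def\<close>)
  also have "\<dots> = det (\<chi> a b. ?A (f a) (f b))"
    unfolding det_def
  proof (intro sum.cong refl, goal_cases)
    case (1 p)
    have "(\<Prod>i<CARD('n). ?A i (map_permutation UNIV f p i)) = (\<Prod>i\<in>UNIV. ?A (f i) (map_permutation UNIV f p (f i)))"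
      by (rule prod.reindex_bij_betw[symmetric, OF f])
    moreover have "sign (map_permutation UNIV f p) = sign p" "map_permutation UNIV f p (f i) = f (p i)" for i
      using 1 inj by (auto intro: sign_map_permutation map_permutation_apply)
    ultimately show ?case by (simp only: vec_lambda_beta)
  qed
  also have "(\<chi> a b. ?A (f a) (f b)) = ?M ** transpose ?M"
    by (simp add: matrix_matrix_mult_def transpose_def vec_eq_iff inner_vec_def)
  also have "det \<dots> = (det ?M)\<^sup>2"
    by (simp add: det_mul power2_eq_square)
  finally show ?thesis .
qed

lemma ex_bij_index: "\<exists>f :: 'n::finite \<Rightarrow> nat. bij_betw f UNIV {..<CARD('n)}"
  by (rule finite_same_card_bij) auto

lemma dim_image_lessThan: "dim (z ` {..<k::nat}) \<le> k"
  for z :: "nat \<Rightarrow> 'a::euclidean_space"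
  using dim_le_card'[of "z ` {..<k}"] card_image_le[of "{..<k}" z] by simp

text \<open>Downward induction on k: a unit vector orthogonal to the first k columns is put at
  position k. With such a completion, statements about k by k Gram determinants become statements
  about ordinary determinants.\<close>

lemma ex_orthonormal_completion:
  fixes z :: "nat \<Rightarrow> real ^ 'n::finite"
  assumes "k \<le> CARD('n)"
  shows "\<exists>z'. (\<forall>i<k. z' i = z i) \<and> (\<forall>i. k \<le> i \<longrightarrow> i < CARD('n) \<longrightarrow> norm (z' i) = 1 \<and> (\<forall>j<i. z' j \<bullet> z' i = 0))"
  using assms
proof (induction k arbitrary: z rule: inc_induct)
  case base
  then show ?case by auto
next
  case (step k)
  have "dim (z ` {..<k}) < DIM(real ^ 'n)"
    using dim_image_lessThan[of z k] step.hyps by simp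
  then obtain u where u: "u \<noteq> 0" "\<And>y. y \<in> span (z ` {..<k}) \<Longrightarrow> orthogonal u y"
    by (rule orthogonal_to_subspace_exists) (rule that)
  define v where "v = u /\<^sub>R norm u"
  have v: "norm v = 1" using u by (simp add: v_def)
  have vz: "z j \<bullet> v = 0" if "j < k" for j
    using u(2)[of "z j"] that by (simp add: v_def span_base orthogonal_def inner_commute)
  from step.IH[of "z(k := v)"] obtain z' where z':
    "\<forall>i<Suc k. z' i = (z(k := v)) i"
    "\<forall>i. Suc k \<le> i \<longrightarrow> i < CARD('n) \<longrightarrow> norm (z' i) = 1 \<and> (\<forall>j<i. z' j \<bullet> z' i = 0)"
    by auto
  show ?case
  proof (intro exI[of _ z'] conjI allI impI)
    fix i assume "i < k" then show "z' i = z i" using z'(1) by simp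
  next
    fix i assume "k \<le> i" "i < CARD('n)"
    then show "norm (z' i) = 1" using z' v by (cases "i = k") auto
  next
    fix i j assume ij: "k \<le> i" "i < CARD('n)" "j < i"
    show "z' j \<bullet> z' i = 0"
    proof (cases "i = k")
      case True
      then show ?thesis using z'(1) vz[of j] ij by simp
    next
      case False
      then show ?thesis using z'(2) ij by auto
    qed
  qed
qed

lemma gram_det_completion:
  fixes z :: "nat \<Rightarrow> real ^ 'n::finite" and f :: "'n \<Rightarrow> nat"
  assumes "k \<le> CARD('n)" and f: "bij_betw f UNIV {..<CARD('n)}"
    and "\<forall>i. k \<le> i \<longrightarrow> i < CARD('n) \<longrightarrow> norm (z i) = 1 \<and> (\<forall>j<i. z j \<bullet> z i = 0)"
  shows "gram_det k z = (det (\<chi> a. z (f a)))\<^sup>2"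
  using gram_det_orthonormal_extension[OF assms(1), of z] assms(3) gram_det_eq_det_square[OF f, of z] by auto

lemma gram_det_nonneg:
  fixes z :: "nat \<Rightarrow> real ^ 'n::finite"
  assumes "k \<le> CARD('n)"
  shows "gram_det k z \<ge> 0"
proof -
  obtain f :: "'n \<Rightarrow> nat" where f: "bij_betw f UNIV {..<CARD('n)}" using ex_bij_index by blast
  obtain z' where z': "\<forall>i<k. z' i = z i"
    "\<forall>i. k \<le> i \<longrightarrow> i < CARD('n) \<longrightarrow> norm (z' i) = 1 \<and> (\<forall>j<i. z' j \<bullet> z' i = 0)"
    using ex_orthonormal_completion[OF assms, of z] by auto
  have "gram_det k z = gram_det k z'" by (rule gram_det_cong) (simp add: z'(1))
  also have "\<dots> = (det (\<chi> a. z' (f a)))\<^sup>2" by (rule gram_det_completion[OF assms f z'(2)])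
  finally show ?thesis by simp
qed

lemma det_add_span_row:
  fixes z :: "nat \<Rightarrow> real ^ 'n::finite" and f :: "'n \<Rightarrow> nat"
  assumes f: "bij_betw f UNIV {..<CARD('n)}" and j: "j < CARD('n)"
    and y: "y \<in> span (z ` ({..<CARD('n)} - {j}))"
  shows "det (\<chi> a. (z(j := z j + y)) (f a)) = det (\<chi> a. z (f a))"
proof -
  obtain b where b: "f b = j" using f j by (metis bij_betw_iff_bijections lessThan_iff)
  let ?M = "(\<chi> a. z (f a)) :: real ^ 'n ^ 'n"
  have fb: "f a = j \<longleftrightarrow> a = b" for a using f b by (auto simp: bij_betw_def inj_on_def)
  have sub: "z ` ({..<CARD('n)} - {j}) \<subseteq> {row a ?M | a. a \<noteq> b}"
  proof
    fix v assume "v \<in> z ` ({..<CARD('n)} - {j})"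
    then obtain i where i: "v = z i" "i < CARD('n)" "i \<noteq> j" by auto
    then obtain a where "f a = i" using f by (metis bij_betw_iff_bijections lessThan_iff)
    then show "v \<in> {row a ?M | a. a \<noteq> b}" using i b by (auto simp: row_def vec_eq_iff intro!: exI[of _ a])
  qed
  have "y \<in> vec.span {row a ?M | a. a \<noteq> b}"
    using y span_mono[OF sub] by (auto simp: span_vec_eq)
  from det_row_span[OF this] show ?thesis
    by (simp add: row_def fb b cong: if_cong)
qed

text \<open>The completion built for the last column \<open>u\<close> is orthogonal to all earlier
  columns, hence to \<open>y\<close>, and so also completes \<open>u + y\<close>. Between the two
  full determinants there is only a row operation, and the column \<open>u\<close> splits off as a
  factor.\<close>

lemma gram_det_add_span:
  fixes z :: "nat \<Rightarrow> real ^ 'n::finite"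
  assumes j: "j < CARD('n)" and y: "y \<in> span (z ` {..<j})" and orth: "\<And>i. i < j \<Longrightarrow> z i \<bullet> u = 0"
  shows "gram_det (Suc j) (z(j := u + y)) = gram_det j z * (u \<bullet> u)"
proof -
  obtain f :: "'n \<Rightarrow> nat" where f: "bij_betw f UNIV {..<CARD('n)}" using ex_bij_index by blast
  have j': "Suc j \<le> CARD('n)" using j by simp
  obtain z' where z': "\<forall>i<Suc j. z' i = (z(j := u)) i"
    "\<forall>i. Suc j \<le> i \<longrightarrow> i < CARD('n) \<longrightarrow> norm (z' i) = 1 \<and> (\<forall>k<i. z' k \<bullet> z' i = 0)"
    using ex_orthonormal_completion[OF j', of "z(j := u)"] by blast
  let ?w = "z'(j := z' j + y)"
  have z'i: "z' i = z i" if "i < j" for i using z'(1) that by auto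
  have z'j: "z' j = u" using z'(1) by simp
  have im: "z ` {..<j} = z' ` {..<j}" using z'i by auto
  have yi: "y \<bullet> z' i = 0" if i: "Suc j \<le> i" "i < CARD('n)" for i
  proof -
    have "orthogonal (z' i) y"
    proof (rule orthogonal_to_span)
      show "y \<in> span (z' ` {..<j})" using y im by simp
      fix x assume "x \<in> z' ` {..<j}"
      then show "orthogonal (z' i) x" using z'(2) i by (auto simp: orthogonal_def inner_commute)
    qed
    then show ?thesis by (simp add: orthogonal_def inner_commute)
  qed
  have "gram_det (Suc j) (z(j := u + y)) = gram_det (Suc j) ?w"
    by (rule gram_det_cong) (use z'(1) in \<open>auto simp: less_Suc_eq\<close>)
  also have "\<dots> = (det (\<chi> a. ?w (f a)))\<^sup>2"
    by (rule gram_det_completion[OF j' f]) (use z'(2) yi in \<open>auto simp: inner_add_left\<close>)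
  also have "det (\<chi> a. ?w (f a)) = det (\<chi> a. z' (f a))"
  proof (rule det_add_span_row[OF f j])
    have "z' ` {..<j} \<subseteq> z' ` ({..<CARD('n)} - {j})" using j by auto
    from subsetD[OF span_mono[OF this]] show "y \<in> span (z' ` ({..<CARD('n)} - {j}))" using y im by simp
  qed
  also have "(det (\<chi> a. z' (f a)))\<^sup>2 = gram_det (Suc j) z'"
    by (rule gram_det_completion[OF j' f z'(2), symmetric])
  also have "\<dots> = gram_det j z' * (z' j \<bullet> z' j)"
    unfolding gram_det_def using orth z'i z'j by (intro det_k_Suc_column) auto
  also have "gram_det j z' = gram_det j z" by (rule gram_det_cong) (simp add: z'i)
  finally show ?thesis by (simp add: z'j fun_upd_def)
qed

text \<open>The columns are rows of a completed square matrix with nonzero determinant, hence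
  independent and pairwise distinct.\<close>

lemma dim_eq_if_gram_det_nonzero:
  fixes z :: "nat \<Rightarrow> real ^ 'n::finite"
  assumes j: "j \<le> CARD('n)" and nz: "gram_det j z \<noteq> 0"
  shows "dim (z ` {..<j}) = j"
proof -
  obtain f :: "'n \<Rightarrow> nat" where f: "bij_betw f UNIV {..<CARD('n)}" using ex_bij_index by blast
  obtain z' where z': "\<forall>i<j. z' i = z i"
    "\<forall>i. j \<le> i \<longrightarrow> i < CARD('n) \<longrightarrow> norm (z' i) = 1 \<and> (\<forall>k<i. z' k \<bullet> z' i = 0)"
    using ex_orthonormal_completion[OF j, of z] by blast
  let ?M = "(\<chi> a. z' (f a)) :: real ^ 'n ^ 'n"
  have "gram_det j z = gram_det j z'" by (rule gram_det_cong) (simp add: z'(1))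
  then have d: "det ?M \<noteq> 0"
    using gram_det_completion[OF j f z'(2)] nz by simp
  have rowM: "row a ?M = z' (f a)" for a by (simp add: row_def vec_eq_iff)
  have "vec.independent (rows ?M)" using det_dependent_rows[of ?M] d by blast
  then have ind: "independent (rows ?M)" by (simp add: dependent_vec_eq)
  have ex: "\<exists>a. f a = i" if "i < j" for i
    using f j that by (metis bij_betw_iff_bijections lessThan_iff order_less_le_trans)
  have "z ` {..<j} \<subseteq> rows ?M"
  proof
    fix v assume "v \<in> z ` {..<j}"
    then obtain i where i: "i < j" "v = z i" by auto
    with ex obtain a where "f a = i" by blast
    then have "v = row a ?M" using i z'(1) rowM by simp
    then show "v \<in> rows ?M" by (auto simp: rows_def)
  qed
  then have ind': "independent (z ` {..<j})" using ind independent_mono by blast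
  have "inj_on z {..<j}"
  proof (rule inj_onI)
    fix i k assume ik: "i \<in> {..<j}" "k \<in> {..<j}" "z i = z k"
    obtain a b where ab: "f a = i" "f b = k" using ex ik by blast
    have "row a ?M = row b ?M" using ab ik z'(1) rowM by simp
    then have "a = b" using det_identical_rows[of a b ?M] d by blast
    then show "i = k" using ab by simp
  qed
  then show ?thesis using ind' by (simp add: dim_eq_card_independent card_image)
qed

text \<open>Base times height: \<open>C\<close> is an orthonormal basis of the orthogonal complement
  of the first j columns, and only the component of \<open>y\<close> in that complement counts.
  Dependent columns make the complement larger, but then the factor \<open>gram_det j z\<close> is
  0.\<close>

lemma gram_det_Suc_orthonormal:
  fixes z :: "nat \<Rightarrow> real ^ 'n::finite"
  assumes j: "j < CARD('n)"
  obtains C where "finite C" "pairwise orthogonal C" "\<And>b. b \<in> C \<Longrightarrow> norm b = 1"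
    "gram_det j z \<noteq> 0 \<Longrightarrow> card C = CARD('n) - j"
    "\<And>y. gram_det (Suc j) (z(j := y)) = gram_det j z * (\<Sum>b\<in>C. (y \<bullet> b)\<^sup>2)"
proof -
  let ?V = "span (z ` {..<j})"
  let ?S = "{y \<in> UNIV. \<forall>x \<in> ?V. orthogonal x y}"
  have subS: "subspace ?S" by (auto simp: subspace_def orthogonal_def inner_right_distrib)
  have "dim ?S + dim ?V = dim (UNIV :: (real ^ 'n) set)"
    by (rule dim_subspace_orthogonal_to_vectors) auto
  then have dimS: "dim ?S = CARD('n) - dim (z ` {..<j})" by simp
  obtain C where C: "C \<subseteq> ?S" "pairwise orthogonal C" "\<And>x. x \<in> C \<Longrightarrow> norm x = 1"
    "independent C" "card C = dim ?S" "span C = ?S"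
    by (rule orthonormal_basis_subspace[OF subS]) (rule that)
  have finC: "finite C" using C(4) by (rule independent_imp_finite)
  show thesis
  proof (rule that[OF finC C(2,3)])
    show "card C = CARD('n) - j" if "gram_det j z \<noteq> 0"
      using dimS C(5) dim_eq_if_gram_det_nonzero[OF _ that] j by simp
    fix y
    obtain v u where vu: "v \<in> ?V" "\<And>w. w \<in> ?V \<Longrightarrow> orthogonal u w" "y = v + u"
      by (rule orthogonal_subspace_decomp_exists[of "z ` {..<j}" y]) (rule that)
    have uS: "u \<in> span C" unfolding C(6) using vu(2) by (simp add: orthogonal_commute)
    have ub: "u \<bullet> b = y \<bullet> b" if "b \<in> C" for b
      using C(1) that vu(1) by (auto simp: vu(3) inner_add_left orthogonal_def)
    have "u \<bullet> u = (\<Sum>b\<in>C. (u \<bullet> b) *\<^sub>R b) \<bullet> u"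
      by (subst orthonormal_basis_expand[OF C(2,3) uS finC]) auto
    also have "\<dots> = (\<Sum>b\<in>C. (y \<bullet> b)\<^sup>2)"
      unfolding inner_sum_left inner_scaleR_left
      by (intro sum.cong refl) (metis ub inner_commute power2_eq_square)
    finally have uu: "u \<bullet> u = (\<Sum>b\<in>C. (y \<bullet> b)\<^sup>2)" .
    have "z i \<bullet> u = 0" if "i < j" for i
      using vu(2)[of "z i"] that by (simp add: span_base orthogonal_def inner_commute)
    then have "gram_det (Suc j) (z(j := u + v)) = gram_det j z * (u \<bullet> u)"
      by (rule gram_det_add_span[OF j vu(1)])
    then show "gram_det (Suc j) (z(j := y)) = gram_det j z * (\<Sum>b\<in>C. (y \<bullet> b)\<^sup>2)"
      unfolding uu vu(3) by (simp add: add.commute)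
  qed
qed

section \<open>One-dimensional Gaussian and Gamma integrals\<close>

lemma nn_integral_lborel_exp_square:
  assumes "R > 0"
  shows "(\<integral>\<^sup>+v. ennreal (exp (- (R * v\<^sup>2 / 2))) \<partial>lborel) = ennreal (sqrt (2 * pi / R))"
proof -
  have eq: "exp (- (R * v\<^sup>2 / 2)) = sqrt (2 * pi / R) * normal_density 0 (1 / sqrt R) v" for v
    using assms by (simp add: normal_density_def real_sqrt_divide real_sqrt_mult power_divide mult.commute)
  have "(\<integral>\<^sup>+v. ennreal (exp (- (R * v\<^sup>2 / 2))) \<partial>lborel)
      = ennreal (\<integral>v. sqrt (2 * pi / R) * normal_density 0 (1 / sqrt R) v \<partial>lborel)"
    unfolding eq using assms by (intro nn_integral_eq_integral) auto
  also have "(\<integral>v. sqrt (2 * pi / R) * normal_density 0 (1 / sqrt R) v \<partial>lborel) = sqrt (2 * pi / R)"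
    using assms by simp
  finally show ?thesis .
qed

text \<open>The integral of exp (- R v^2 / 2) is sqrt (2 pi / R); the prefactor R turns this into
  sqrt R and also covers R = 0.\<close>

lemma sqrt_eq_nn_integral:
  assumes "R \<ge> 0"
  shows "ennreal (sqrt R) = (\<integral>\<^sup>+v. ennreal (R / sqrt (2 * pi) * exp (- (R * v\<^sup>2 / 2))) \<partial>lborel)"
proof (cases "R = 0")
  case False
  then have R: "R > 0" using assms by simp
  have "(\<integral>\<^sup>+v. ennreal (R / sqrt (2 * pi) * exp (- (R * v\<^sup>2 / 2))) \<partial>lborel)
      = (\<integral>\<^sup>+v. ennreal (R / sqrt (2 * pi)) * ennreal (exp (- (R * v\<^sup>2 / 2))) \<partial>lborel)"
    using R by (intro nn_integral_cong ennreal_mult) auto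
  also have "\<dots> = ennreal (R / sqrt (2 * pi)) * ennreal (sqrt (2 * pi / R))"
    by (subst nn_integral_cmult) (auto simp: nn_integral_lborel_exp_square[OF R])
  also have "\<dots> = ennreal (sqrt R)"
  proof -
    have "R / sqrt (2 * pi) * sqrt (2 * pi / R) = R / sqrt R"
      by (simp add: real_sqrt_divide)
    also have "\<dots> = sqrt R" using R by (intro real_div_sqrt) simp
    finally show ?thesis using R by (subst ennreal_mult[symmetric]) auto
  qed
  finally show ?thesis ..
qed simp

lemma nn_integral_Gamma_scale:
  assumes a: "a > 0" and c: "c > 0"
  shows "(\<integral>\<^sup>+u. ennreal (indicator {0..} u * u powr (a - 1) * exp (- (c * u))) \<partial>lborel) = ennreal (Gamma a / c powr a)"
proof -
  let ?f = "\<lambda>t::real. ennreal (indicator {0..} t * t powr (a - 1) / exp t)"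
  have "ennreal (Gamma a) = (\<integral>\<^sup>+t. ?f t \<partial>lborel)" by (rule Gamma_conv_nn_integral_real[OF a])
  also have "\<dots> = ennreal c * (\<integral>\<^sup>+u. ?f (0 + c * u) \<partial>lborel)"
    using c by (subst nn_integral_real_affine[where c = c and t = 0]) auto
  also have "(\<integral>\<^sup>+u. ?f (0 + c * u) \<partial>lborel)
      = (\<integral>\<^sup>+u. ennreal (c powr (a - 1)) * ennreal (indicator {0..} u * u powr (a - 1) * exp (- (c * u))) \<partial>lborel)"
    using c by (intro nn_integral_cong)
      (auto simp: ennreal_mult'[symmetric] powr_mult indicator_def zero_le_mult_iff exp_minus field_simps)
  also have "\<dots> = ennreal (c powr (a - 1)) * (\<integral>\<^sup>+u. ennreal (indicator {0..} u * u powr (a - 1) * exp (- (c * u))) \<partial>lborel)"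
    by (rule nn_integral_cmult) measurable
  finally have "ennreal (1 / c powr a) * ennreal (Gamma a)
     = ennreal (1 / c powr a) * (ennreal c * ennreal (c powr (a - 1))) *
       (\<integral>\<^sup>+u. ennreal (indicator {0..} u * u powr (a - 1) * exp (- (c * u))) \<partial>lborel)"
    by (simp only: mult.assoc)
  also have "ennreal (1 / c powr a) * (ennreal c * ennreal (c powr (a - 1))) = 1"
  proof -
    have "c * c powr (a - 1) = c powr a" using c by (simp add: powr_diff)
    then show ?thesis using c by (simp add: ennreal_mult[symmetric])
  qed
  finally show ?thesis using c a by (simp add: ennreal_mult[symmetric])
qed

text \<open>The integrand is (1 + v^2) to the power - a with a = d / 2 + 1. Times Gamma a, it is the
  integral of u^(a - 1) exp (- (1 + v^2) u) over u > 0. Integrating over v first gives sqrt (pi / u)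
  and leaves Gamma (a - 1/2); the quotient of the Gamma values is one of ball volumes.\<close>

lemma nn_integral_inverse_power:
  fixes d :: nat
  assumes "d > 0"
  shows "(\<integral>\<^sup>+v. ennreal ((1 / sqrt (1 + v\<^sup>2)) ^ (d + 2)) \<partial>lborel) = ennreal (unit_ball_vol (real d) / unit_ball_vol (real (d - 1)))"
proof -
  define a where "a = real d / 2 + 1"
  have a: "a > 0" "a - 1 / 2 > 0" using assms by (auto simp: a_def)
  have pos: "1 + v\<^sup>2 > 0" for v :: real by (simp add: add_pos_nonneg)
  have pw: "(1 / sqrt (1 + v\<^sup>2)) ^ (d + 2) = 1 / (1 + v\<^sup>2) powr a" for v :: real
  proof -
    have "(sqrt (1 + v\<^sup>2)) ^ (d + 2) = sqrt (1 + v\<^sup>2) powr real (d + 2)"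
      using pos[of v] by (intro powr_realpow[symmetric]) simp
    also have "\<dots> = ((1 + v\<^sup>2) powr (1 / 2)) powr real (d + 2)"
      using pos[of v] by (simp only: powr_half_sqrt less_imp_le)
    also have "\<dots> = (1 + v\<^sup>2) powr a" by (simp add: powr_powr a_def field_simps)
    finally show ?thesis by (simp add: power_divide del: power_Suc)
  qed
  have "ennreal (Gamma a) * (\<integral>\<^sup>+v. ennreal ((1 / sqrt (1 + v\<^sup>2)) ^ (d + 2)) \<partial>lborel)
      = (\<integral>\<^sup>+v. ennreal (Gamma a) * ennreal ((1 / sqrt (1 + v\<^sup>2)) ^ (d + 2)) \<partial>lborel)"
    by (rule nn_integral_cmult[symmetric]) measurable
  also have "\<dots> = (\<integral>\<^sup>+v. (\<integral>\<^sup>+u. ennreal (indicator {0..} u * u powr (a - 1) * exp (- ((1 + v\<^sup>2) * u))) \<partial>lborel) \<partial>lborel)"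
    unfolding pw nn_integral_Gamma_scale[OF a(1) pos] using a by (simp add: ennreal_mult'[symmetric])
  also have "\<dots> = (\<integral>\<^sup>+u. (\<integral>\<^sup>+v. ennreal (indicator {0..} u * u powr (a - 1) * exp (- ((1 + v\<^sup>2) * u))) \<partial>lborel) \<partial>lborel)"
    by (rule lborel_pair.Fubini') measurable
  also have "\<dots> = (\<integral>\<^sup>+u. ennreal (sqrt pi) * ennreal (indicator {0..} u * u powr (a - 1 / 2 - 1) * exp (- (1 * u))) \<partial>lborel)"
  \<comment> \<open>The Gaussian integral over v needs u > 0; negative u is killed by the indicator,
    and the single point u = 0 is a null set.\<close>
  proof (rule nn_integral_cong_AE, rule AE_mp[OF AE_lborel_singleton[of 0]], intro AE_I2 impI)
    fix u :: real assume u: "u \<noteq> 0"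
    show "(\<integral>\<^sup>+v. ennreal (indicator {0..} u * u powr (a - 1) * exp (- ((1 + v\<^sup>2) * u))) \<partial>lborel)
      = ennreal (sqrt pi) * ennreal (indicator {0..} u * u powr (a - 1 / 2 - 1) * exp (- (1 * u)))"
    proof (cases "u > 0")
      case True
      have "(\<integral>\<^sup>+v. ennreal (indicator {0..} u * u powr (a - 1) * exp (- ((1 + v\<^sup>2) * u))) \<partial>lborel)
          = (\<integral>\<^sup>+v. ennreal (u powr (a - 1) * exp (- u)) * ennreal (exp (- ((2 * u) * v\<^sup>2 / 2))) \<partial>lborel)"
      proof (intro nn_integral_cong)
        fix v
        have "exp (- ((1 + v\<^sup>2) * u)) = exp (- u) * exp (- ((2 * u) * v\<^sup>2 / 2))"
          by (simp add: exp_add[symmetric] algebra_simps)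
        then show "ennreal (indicator {0..} u * u powr (a - 1) * exp (- ((1 + v\<^sup>2) * u)))
          = ennreal (u powr (a - 1) * exp (- u)) * ennreal (exp (- ((2 * u) * v\<^sup>2 / 2)))"
          using True by (simp add: ennreal_mult[symmetric])
      qed
      also have "\<dots> = ennreal (u powr (a - 1) * exp (- u)) * ennreal (sqrt (2 * pi / (2 * u)))"
        by (subst nn_integral_cmult, measurable) (subst nn_integral_lborel_exp_square, use True in auto)
      also have "\<dots> = ennreal (sqrt pi) * ennreal (indicator {0..} u * u powr (a - 1 / 2 - 1) * exp (- (1 * u)))"
      proof -
        have "a - 1 / 2 - 1 = (a - 1) - 1 / 2" by simp
        then have "u powr (a - 1 / 2 - 1) = u powr (a - 1) / sqrt u"
          using True by (simp only: powr_diff powr_half_sqrt)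
        then show ?thesis
          using True by (simp add: ennreal_mult[symmetric] real_sqrt_divide mult_ac)
      qed
      finally show ?thesis .
    qed (use u in \<open>simp add: indicator_def\<close>)
  qed
  also have "\<dots> = ennreal (sqrt pi) * (\<integral>\<^sup>+u. ennreal (indicator {0..} u * u powr (a - 1 / 2 - 1) * exp (- (1 * u))) \<partial>lborel)"
    by (rule nn_integral_cmult) measurable
  also have "\<dots> = ennreal (sqrt pi * Gamma (a - 1 / 2))"
    unfolding nn_integral_Gamma_scale[OF a(2) zero_less_one] using a by (simp add: ennreal_mult[symmetric])
  finally have "ennreal (1 / Gamma a) * ennreal (Gamma a) * (\<integral>\<^sup>+v. ennreal ((1 / sqrt (1 + v\<^sup>2)) ^ (d + 2)) \<partial>lborel)
      = ennreal (1 / Gamma a) * ennreal (sqrt pi * Gamma (a - 1 / 2))" by (simp only: mult.assoc)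
  moreover have Ga: "Gamma a > 0" "Gamma (a - 1 / 2) > 0" using a by (auto intro: Gamma_real_pos)
  moreover have "ennreal (1 / Gamma a) * ennreal (Gamma a) = 1"
    using Ga by (simp add: ennreal_mult[symmetric])
  ultimately have "(\<integral>\<^sup>+v. ennreal ((1 / sqrt (1 + v\<^sup>2)) ^ (d + 2)) \<partial>lborel)
      = ennreal (sqrt pi * Gamma (a - 1 / 2) / Gamma a)"
    by (simp add: ennreal_mult[symmetric])
  also have "sqrt pi * Gamma (a - 1 / 2) / Gamma a = unit_ball_vol (real d) / unit_ball_vol (real (d - 1))"
  proof -
    have "real (d - 1) / 2 + 1 = a - 1 / 2" using assms by (simp add: a_def of_nat_diff field_simps)
    moreover have "pi powr (real d / 2) = sqrt pi * pi powr (real (d - 1) / 2)"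
    proof -
      have half: "real d / 2 = 1 / 2 + real (d - 1) / 2" using assms by (simp add: of_nat_diff field_simps)
      show ?thesis unfolding half powr_add by (simp add: powr_half_sqrt)
    qed
    ultimately show ?thesis
      unfolding unit_ball_vol_def a_def[symmetric] using Ga by (simp only:) simp
  qed
  finally show ?thesis .
qed

text \<open>The mean of the chi distribution with d degrees of freedom, sqrt 2 Gamma ((d + 1) / 2) /
  Gamma (d / 2) for d > 0. In terms of ball volumes, products over consecutive d telescope.\<close>

definition chi_mean :: "nat \<Rightarrow> real" where
  "chi_mean d = real d * unit_ball_vol (real d) / (sqrt (2 * pi) * unit_ball_vol (real (d - 1)))"

text \<open>The mean length of the projection of a Gaussian vector to a subspace with orthonormal basis \<open>C\<close>.
  The square root is written as a Gaussian integral, which makes the expectation factor over \<open>C\<close>.\<close>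

lemma nn_integral_std_gauss_projection:
  fixes C :: "(real ^ 'n::finite) set"
  assumes fin: "finite C" and C: "pairwise orthogonal C" "\<And>b. b \<in> C \<Longrightarrow> norm b = 1"
  shows "(\<integral>\<^sup>+y. ennreal (sqrt (\<Sum>b\<in>C. (y \<bullet> b)\<^sup>2)) \<partial>std_gauss) = ennreal (chi_mean (card C))"
proof (cases "card C = 0")
  case True
  then show ?thesis using fin by (simp add: chi_mean_def)
next
  case False
  let ?d = "card C"
  let ?R = "\<lambda>y. \<Sum>b\<in>C. (y \<bullet> b)\<^sup>2"
  let ?g = "\<lambda>v b x::real. ennreal (exp (- v\<^sup>2 * x\<^sup>2 / 2))"
  \<comment> \<open>For each summand of R = \<open>?R y\<close>, the term (y . b)^2 exp (- R v^2 /
    2) is spread over \<open>C\<close>; only the factor belonging to \<open>b\<close> carries the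
    square.\<close>
  let ?h = "\<lambda>v b b' x::real. if b' = b then ennreal (x\<^sup>2 * exp (- v\<^sup>2 * x\<^sup>2 / 2)) else ennreal (exp (- v\<^sup>2 * x\<^sup>2 / 2))"
  let ?s = "\<lambda>v::real. 1 / sqrt (1 + v\<^sup>2)"
  have factor: "ennreal (?R y / sqrt (2 * pi) * exp (- (?R y * v\<^sup>2 / 2)))
      = ennreal (1 / sqrt (2 * pi)) * (\<Sum>b\<in>C. \<Prod>b'\<in>C. ?h v b b' (y \<bullet> b'))" for v y
  proof -
    have "(\<Prod>b'\<in>C. ?h v b b' (y \<bullet> b')) = ennreal ((y \<bullet> b)\<^sup>2 * exp (- (?R y * v\<^sup>2 / 2)))" if b: "b \<in> C" for b
    proof -
      have "(\<Prod>b'\<in>C. ?h v b b' (y \<bullet> b')) = (\<Prod>b'\<in>C. ennreal ((if b' = b then (y \<bullet> b)\<^sup>2 else 1) * exp (- v\<^sup>2 * (y \<bullet> b')\<^sup>2 / 2)))"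
        by (intro prod.cong) auto
      also have "\<dots> = ennreal (\<Prod>b'\<in>C. (if b' = b then (y \<bullet> b)\<^sup>2 else 1) * exp (- v\<^sup>2 * (y \<bullet> b')\<^sup>2 / 2))"
        by (rule prod_ennreal) auto
      also have "(\<Prod>b'\<in>C. (if b' = b then (y \<bullet> b)\<^sup>2 else 1) * exp (- v\<^sup>2 * (y \<bullet> b')\<^sup>2 / 2))
          = (y \<bullet> b)\<^sup>2 * exp (\<Sum>b'\<in>C. - v\<^sup>2 * (y \<bullet> b')\<^sup>2 / 2)"
        using fin b by (simp add: prod.distrib exp_sum)
      also have "(\<Sum>b'\<in>C. - v\<^sup>2 * (y \<bullet> b')\<^sup>2 / 2) = - (?R y * v\<^sup>2 / 2)"
      proof -
        have "(\<Sum>b'\<in>C. - v\<^sup>2 * (y \<bullet> b')\<^sup>2 / 2) = (\<Sum>b'\<in>C. (- v\<^sup>2 / 2) * (y \<bullet> b')\<^sup>2)" by simp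
        also have "\<dots> = (- v\<^sup>2 / 2) * ?R y" by (rule sum_distrib_left[symmetric])
        finally show ?thesis by simp
      qed
      finally show ?thesis .
    qed
    then have "(\<Sum>b\<in>C. \<Prod>b'\<in>C. ?h v b b' (y \<bullet> b')) = ennreal (?R y * exp (- (?R y * v\<^sup>2 / 2)))"
      by (simp add: sum_distrib_right)
    then show ?thesis
      by (simp add: ennreal_mult[symmetric] sum_nonneg)
  qed
  \<comment> \<open>The factors other than the one at \<open>b\<close> contribute s each, and the
    squared one contributes s^3, which makes the exponent d + 2.\<close>
  have inner: "(\<integral>\<^sup>+y. (\<Prod>b'\<in>C. ?h v b b' (y \<bullet> b')) \<partial>std_gauss) = ennreal (?s v ^ (?d + 2))" if b: "b \<in> C" for v b
  proof -
    have "(\<integral>\<^sup>+y. (\<Prod>b'\<in>C. ?h v b b' (y \<bullet> b')) \<partial>std_gauss) = (\<Prod>b'\<in>C. \<integral>\<^sup>+x. ?h v b b' x \<partial>std_normal_measure)"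
      by (rule nn_integral_std_gauss_orthonormal[OF C]) auto
    also have "\<dots> = (\<Prod>b'\<in>C. ennreal (?s v * (if b' = b then ?s v ^ 2 else 1)))"
      using nn_integral_std_normal_exp[of "v\<^sup>2"] nn_integral_std_normal_square_exp[of "v\<^sup>2"]
      by (intro prod.cong) (auto simp: power_divide power3_eq_cube power2_eq_square)
    also have "\<dots> = ennreal (\<Prod>b'\<in>C. ?s v * (if b' = b then ?s v ^ 2 else 1))"
      by (rule prod_ennreal) auto
    also have "(\<Prod>b'\<in>C. ?s v * (if b' = b then ?s v ^ 2 else 1)) = ?s v ^ (?d + 2)"
      unfolding prod.distrib using fin b by (simp only: prod.delta prod_constant power_add if_True)
    finally show ?thesis .
  qed
  have "(\<integral>\<^sup>+y. ennreal (sqrt (?R y)) \<partial>std_gauss)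
      = (\<integral>\<^sup>+y. (\<integral>\<^sup>+v. ennreal (?R y / sqrt (2 * pi) * exp (- (?R y * v\<^sup>2 / 2))) \<partial>lborel) \<partial>std_gauss)"
    by (subst sqrt_eq_nn_integral) (auto intro!: sum_nonneg)
  also have "\<dots> = (\<integral>\<^sup>+v. (\<integral>\<^sup>+y. ennreal (?R y / sqrt (2 * pi) * exp (- (?R y * v\<^sup>2 / 2))) \<partial>std_gauss) \<partial>lborel)"
  proof (rule pair_sigma_finite.Fubini')
    show "pair_sigma_finite lborel (std_gauss :: (real ^ 'n) measure)"
      by (intro pair_sigma_finite.intro sigma_finite_lborel prob_space_imp_sigma_finite prob_space_std_gauss)
  qed measurable
  also have "\<dots> = (\<integral>\<^sup>+v. ennreal (1 / sqrt (2 * pi)) * (\<Sum>b\<in>C. ennreal (?s v ^ (?d + 2))) \<partial>lborel)"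
  proof (intro nn_integral_cong)
    fix v :: real
    have "(\<integral>\<^sup>+y. ennreal (?R y / sqrt (2 * pi) * exp (- (?R y * v\<^sup>2 / 2))) \<partial>std_gauss)
        = ennreal (1 / sqrt (2 * pi)) * (\<integral>\<^sup>+y. (\<Sum>b\<in>C. \<Prod>b'\<in>C. ?h v b b' (y \<bullet> b')) \<partial>std_gauss)"
      unfolding factor by (rule nn_integral_cmult) measurable
    also have "(\<integral>\<^sup>+y. (\<Sum>b\<in>C. \<Prod>b'\<in>C. ?h v b b' (y \<bullet> b')) \<partial>std_gauss) = (\<Sum>b\<in>C. ennreal (?s v ^ (?d + 2)))"
      by (subst nn_integral_sum, measurable) (intro sum.cong refl inner)
    finally show "(\<integral>\<^sup>+y. ennreal (?R y / sqrt (2 * pi) * exp (- (?R y * v\<^sup>2 / 2))) \<partial>std_gauss)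
        = ennreal (1 / sqrt (2 * pi)) * (\<Sum>b\<in>C. ennreal (?s v ^ (?d + 2)))" .
  qed
  also have "\<dots> = (\<integral>\<^sup>+v. ennreal (real ?d / sqrt (2 * pi)) * ennreal (?s v ^ (?d + 2)) \<partial>lborel)"
    by (intro nn_integral_cong) (simp add: ennreal_mult'[symmetric] ennreal_of_nat_eq_real_of_nat mult_ac del: power_Suc power_add)
  also have "\<dots> = ennreal (real ?d / sqrt (2 * pi)) * ennreal (unit_ball_vol (real ?d) / unit_ball_vol (real (?d - 1)))"
    using False by (subst nn_integral_cmult) (auto simp only: nn_integral_inverse_power, measurable)
  also have "\<dots> = ennreal (chi_mean ?d)"
    by (simp add: ennreal_mult'[symmetric] chi_mean_def mult_ac)
  finally show ?thesis .
qed

section \<open>Mean volumes spanned by Gaussian columns\<close>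

definition gauss_det_mean :: "nat \<Rightarrow> real" where
  "gauss_det_mean n = fact n * unit_ball_vol (real n) / (2 * pi) powr (real n / 2)"

lemma gauss_det_mean_0 [simp]: "gauss_det_mean 0 = 1"
  by (simp add: gauss_det_mean_def)

text \<open>Hence \<open>gauss_det_mean n\<close> is the product of the chi means for 1 to n degrees
  of freedom, the mean absolute determinant of a Gaussian n by n matrix.\<close>

lemma gauss_det_mean_Suc: "gauss_det_mean (Suc n) = chi_mean (Suc n) * gauss_det_mean n"
proof -
  have "(2 * pi) powr (real (Suc n) / 2) = sqrt (2 * pi) * (2 * pi) powr (real n / 2)"
  proof -
    have "real (Suc n) / 2 = 1 / 2 + real n / 2" by simp
    then show ?thesis by (simp only: powr_add) (simp add: powr_half_sqrt)
  qed
  then show ?thesis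
    using unit_ball_vol_pos[of "real n", THEN less_imp_neq] by (simp add: gauss_det_mean_def chi_mean_def)
qed

lemma gauss_det_mean_pos: "gauss_det_mean n > 0"
  by (simp add: gauss_det_mean_def)

lemma chi_mean_nonneg: "chi_mean n \<ge> 0"
  by (simp add: chi_mean_def)

definition gvol :: "nat \<Rightarrow> (nat \<Rightarrow> real ^ 'n::finite) \<Rightarrow> real" where
  "gvol k z = sqrt (gram_det k z)"

lemma gvol_cong: "(\<And>i. i < k \<Longrightarrow> z i = z' i) \<Longrightarrow> gvol k z = gvol k z'"
  unfolding gvol_def using gram_det_cong[of k z z'] by simp

lemma gvol_nonneg: "k \<le> CARD('n) \<Longrightarrow> gvol k (z :: nat \<Rightarrow> real ^ 'n::finite) \<ge> 0"
  by (simp add: gvol_def gram_det_nonneg)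

lemma measurable_gvol:
  fixes g :: "nat \<Rightarrow> 'b \<Rightarrow> real ^ 'n::finite"
  assumes [measurable]: "\<And>i. i < k \<Longrightarrow> g i \<in> borel_measurable M"
  shows "(\<lambda>x. gvol k (\<lambda>i. g i x)) \<in> borel_measurable M"
proof -
  have [measurable]: "(\<lambda>x. g i x \<bullet> g (p i) x) \<in> borel_measurable M" if "p permutes {..<k}" "i < k" for p i
    using that permutes_in_image[OF that(1), of i] by (intro borel_measurable_inner assms) auto
  have [measurable]: "(\<lambda>x. \<Sum>p | p permutes {..<k}. real_of_int (sign p) * (\<Prod>i<k. g i x \<bullet> g (p i) x)) \<in> borel_measurable M"
    by (intro borel_measurable_sum borel_measurable_times borel_measurable_const borel_measurable_prod) auto
  show ?thesis
    unfolding gvol_def gram_det_def det_k_def by measurable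
qed

text \<open>The height over the first j columns is the length of a Gaussian vector projected to
  their complement, of dimension n - j. If the first j columns are dependent, both sides are
  0.\<close>

lemma nn_integral_gvol_Suc:
  fixes z :: "nat \<Rightarrow> real ^ 'n::finite"
  assumes j: "j < CARD('n)"
  shows "(\<integral>\<^sup>+y. ennreal (gvol (Suc j) (z(j := y))) \<partial>std_gauss) = ennreal (chi_mean (CARD('n) - j)) * ennreal (gvol j z)"
proof -
  obtain C where C: "finite C" "pairwise orthogonal C" "\<And>b. b \<in> C \<Longrightarrow> norm b = 1"
    "gram_det j z \<noteq> 0 \<Longrightarrow> card C = CARD('n) - j"
    "\<And>y. gram_det (Suc j) (z(j := y)) = gram_det j z * (\<Sum>b\<in>C. (y \<bullet> b)\<^sup>2)"
    by (rule gram_det_Suc_orthonormal[OF j, of z]) (rule that)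
  have "(\<integral>\<^sup>+y. ennreal (gvol (Suc j) (z(j := y))) \<partial>std_gauss)
      = (\<integral>\<^sup>+y. ennreal (gvol j z) * ennreal (sqrt (\<Sum>b\<in>C. (y \<bullet> b)\<^sup>2)) \<partial>std_gauss)"
    unfolding gvol_def C(5) real_sqrt_mult
    using gram_det_nonneg[of j z] j by (intro nn_integral_cong ennreal_mult) (auto intro: sum_nonneg)
  also have "\<dots> = ennreal (gvol j z) * (\<integral>\<^sup>+y. ennreal (sqrt (\<Sum>b\<in>C. (y \<bullet> b)\<^sup>2)) \<partial>std_gauss)"
    by (rule nn_integral_cmult) measurable
  also have "\<dots> = ennreal (gvol j z) * ennreal (chi_mean (card C))"
    by (simp only: nn_integral_std_gauss_projection[OF C(1,2,3)])
  also have "\<dots> = ennreal (chi_mean (CARD('n) - j)) * ennreal (gvol j z)"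
    using C(4) by (cases "gram_det j z = 0") (auto simp: gvol_def mult.commute)
  finally show ?thesis .
qed

abbreviation gauss_family :: "'i set \<Rightarrow> ('i \<Rightarrow> real ^ 'n::finite) measure" where
  "gauss_family I \<equiv> PiM I (\<lambda>_. std_gauss)"

interpretation gauss_family: product_sigma_finite "\<lambda>_. std_gauss :: (real ^ 'n::finite) measure"
  by (intro product_sigma_finite.intro prob_space_imp_sigma_finite prob_space_std_gauss)

text \<open>The left side does not change with m: integrating out column j yields the factor
  \<open>chi_mean (n - j)\<close>, which is exactly what turns the constant for n - Suc j into the
  one for n - j.\<close>

theorem nn_integral_gvol_completion:
  fixes g :: "nat \<Rightarrow> real ^ 'n \<Rightarrow> real ^ 'n::finite"
  assumes "k \<le> m" "m \<le> CARD('n)" and g [measurable]: "\<And>i. g i \<in> borel_measurable borel"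
    and id: "\<And>i. k \<le> i \<Longrightarrow> g i = (\<lambda>x. x)"
  shows "ennreal (gauss_det_mean (CARD('n) - m)) * (\<integral>\<^sup>+\<omega>. ennreal (gvol m (\<lambda>i. g i (\<omega> i))) \<partial>gauss_family {..<m})
    = ennreal (gauss_det_mean (CARD('n) - k)) * (\<integral>\<^sup>+\<omega>. ennreal (gvol k (\<lambda>i. g i (\<omega> i))) \<partial>gauss_family {..<k})"
  using assms(1,2)
proof (induction m rule: dec_induct)
  case (step j)
  have j: "j < CARD('n)" using step.prems by simp
  have ins: "{..<Suc j} = insert j {..<j}" by auto
  have [measurable]: "(\<lambda>\<omega>. g i (\<omega> i)) \<in> borel_measurable (gauss_family {..<l})" if "i < l" for i l
  proof -
    have "(\<lambda>\<omega>. \<omega> i) \<in> gauss_family {..<l} \<rightarrow>\<^sub>M (std_gauss :: (real ^ 'n) measure)"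
      using that by (intro measurable_component_singleton) simp
    moreover have "g i \<in> borel_measurable std_gauss" by simp
    ultimately show ?thesis by (rule measurable_compose)
  qed
  have meas [measurable]: "(\<lambda>\<omega>. gvol l (\<lambda>i. g i (\<omega> i))) \<in> borel_measurable (gauss_family {..<l})" for l
    by (rule measurable_gvol) measurable
  have "(\<integral>\<^sup>+\<omega>. ennreal (gvol (Suc j) (\<lambda>i. g i (\<omega> i))) \<partial>gauss_family {..<Suc j})
      = (\<integral>\<^sup>+\<omega>. (\<integral>\<^sup>+y. ennreal (gvol (Suc j) (\<lambda>i. g i (fun_upd \<omega> j y i))) \<partial>std_gauss) \<partial>gauss_family {..<j})"
    using meas[of "Suc j"] unfolding ins by (subst gauss_family.product_nn_integral_insert) auto
  also have "\<dots> = (\<integral>\<^sup>+\<omega>. (\<integral>\<^sup>+y. ennreal (gvol (Suc j) (fun_upd (\<lambda>i. g i (\<omega> i)) j y)) \<partial>std_gauss) \<partial>gauss_family {..<j})"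
    using id[of j] step.hyps
    by (intro nn_integral_cong arg_cong[where f = ennreal] gvol_cong) (auto simp: less_Suc_eq)
  also have "\<dots> = ennreal (chi_mean (CARD('n) - j)) * (\<integral>\<^sup>+\<omega>. ennreal (gvol j (\<lambda>i. g i (\<omega> i))) \<partial>gauss_family {..<j})"
    unfolding nn_integral_gvol_Suc[OF j] by (rule nn_integral_cmult) measurable
  finally have "ennreal (gauss_det_mean (CARD('n) - Suc j)) * (\<integral>\<^sup>+\<omega>. ennreal (gvol (Suc j) (\<lambda>i. g i (\<omega> i))) \<partial>gauss_family {..<Suc j})
      = (ennreal (gauss_det_mean (CARD('n) - Suc j)) * ennreal (chi_mean (CARD('n) - j))) *
        (\<integral>\<^sup>+\<omega>. ennreal (gvol j (\<lambda>i. g i (\<omega> i))) \<partial>gauss_family {..<j})"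
    by (simp only: mult.assoc)
  also have "ennreal (gauss_det_mean (CARD('n) - Suc j)) * ennreal (chi_mean (CARD('n) - j)) = ennreal (gauss_det_mean (CARD('n) - j))"
  proof -
    have "CARD('n) - j = Suc (CARD('n) - Suc j)" using j by simp
    then have "gauss_det_mean (CARD('n) - j) = chi_mean (CARD('n) - j) * gauss_det_mean (CARD('n) - Suc j)"
      by (metis gauss_det_mean_Suc)
    then show ?thesis
      using gauss_det_mean_pos[of "CARD('n) - Suc j"]
      by (simp add: ennreal_mult[symmetric] chi_mean_nonneg mult.commute)
  qed
  also note step.IH
  finally show ?case using step.prems by simp
qed simp

section \<open>Volume of a sum of ellipsoids\<close>

text \<open>An integral form of the Cauchy-Binet formula. The first step expands the determinant by the
  Leibniz formula and Fubini; averaging over the permutations of the integration variables then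
  produces the second determinant.\<close>

theorem Cauchy_Binet_integral:
  fixes X :: "'i \<Rightarrow> 'b \<Rightarrow> real ^ 'n::finite"
  assumes "prob_space N" and I: "finite I"
    and int: "\<And>i a b. i \<in> I \<Longrightarrow> integrable N (\<lambda>x. X i x $ a * X i x $ b)"
  defines "P \<equiv> PiM (UNIV :: 'n set) (\<lambda>_. N)" and "\<F> \<equiv> PiE (UNIV :: 'n set) (\<lambda>_. I)"
  shows "f \<in> \<F> \<Longrightarrow> integrable P (\<lambda>p. (det (\<chi> a. X (f a) (p a)))\<^sup>2)"
    and "fact CARD('n) * det (\<chi> a b. \<Sum>i\<in>I. \<integral>x. X i x $ a * X i x $ b \<partial>N)
      = (\<Sum>f\<in>\<F>. \<integral>p. (det (\<chi> a. X (f a) (p a)))\<^sup>2 \<partial>P)"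
proof -
  interpret N: prob_space N by fact
  interpret PN: product_sigma_finite "\<lambda>_::'n. N"
    by (intro product_sigma_finite.intro prob_space_imp_sigma_finite) fact
  let ?S = "{\<sigma>. \<sigma> permutes (UNIV :: 'n set)}"
  have finS: "finite ?S" by (simp add: finite_permutations)
  have fI: "f a \<in> I" if "f \<in> \<F>" for f a using that by (auto simp: \<F>_def)
  have finF: "finite \<F>" unfolding \<F>_def using I by (intro finite_PiE) auto
  define D where "D f p = (\<chi> a. X (f a) (p a))" for f :: "'n \<Rightarrow> 'i" and p :: "'n \<Rightarrow> 'b"
  define Q where "Q f p \<tau> = (\<Prod>a\<in>UNIV. X (f a) (p a) $ \<tau> a)" for f :: "'n \<Rightarrow> 'i" and p :: "'n \<Rightarrow> 'b" and \<tau>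
  have detD: "det (D f p) = (\<Sum>\<sigma>\<in>?S. of_int (sign \<sigma>) * Q f p \<sigma>)" for f p
    by (simp add: det_def D_def Q_def)
  have intQ: "integrable P (\<lambda>p. Q f p \<tau> * Q f p \<sigma>)" if "f \<in> \<F>" for f \<tau> \<sigma>
  proof -
    have "integrable P (\<lambda>p. \<Prod>a\<in>UNIV. X (f a) (p a) $ \<tau> a * X (f a) (p a) $ \<sigma> a)"
      unfolding P_def using int fI[OF that] by (intro PN.product_integrable_prod) auto
    then show ?thesis by (simp add: Q_def prod.distrib)
  qed
  have intQD: "integrable P (\<lambda>p. Q f p \<tau> * det (D f p))" if "f \<in> \<F>" for f \<tau>
  proof -
    have "integrable P (\<lambda>p. \<Sum>\<sigma>\<in>?S. of_int (sign \<sigma>) * (Q f p \<tau> * Q f p \<sigma>))"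
      using intQ[OF that] by (intro Bochner_Integration.integrable_sum integrable_mult_right)
    then show ?thesis by (simp add: detD sum_distrib_left mult.left_commute)
  qed
  show intD: "integrable P (\<lambda>p. (det (\<chi> a. X (f a) (p a)))\<^sup>2)" if "f \<in> \<F>" for f
  proof -
    have "integrable P (\<lambda>p. \<Sum>\<sigma>\<in>?S. of_int (sign \<sigma>) * (Q f p \<sigma> * det (D f p)))"
      using intQD[OF that] by (intro Bochner_Integration.integrable_sum integrable_mult_right)
    moreover have "(\<Sum>\<sigma>\<in>?S. of_int (sign \<sigma>) * (Q f p \<sigma> * det (D f p))) = (det (D f p))\<^sup>2" for p
      by (simp add: detD[of f p] power2_eq_square sum_distrib_right mult.assoc)
    ultimately show ?thesis by (simp add: D_def)
  qed
  let ?J = "\<chi> a b. \<Sum>i\<in>I. \<integral>x. X i x $ a * X i x $ b \<partial>N"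
  \<comment> \<open>In every entry the first factor has the row index and the second one the column
    index. The first factors give the diagonal product \<open>Q f p id\<close>; the second ones give
    Leibniz terms that add up to a determinant.\<close>
  have "det ?J = (\<Sum>\<sigma>\<in>?S. of_int (sign \<sigma>) * (\<Sum>f\<in>\<F>. \<integral>p. Q f p id * Q f p \<sigma> \<partial>P))"
    unfolding det_def
  proof (intro sum.cong refl arg_cong2[where f = "(*)"])
    fix \<sigma>
    have "(\<Prod>a\<in>UNIV. ?J $ a $ \<sigma> a) = (\<Sum>f\<in>\<F>. \<Prod>a\<in>UNIV. \<integral>x. X (f a) x $ a * X (f a) x $ \<sigma> a \<partial>N)"
      unfolding \<F>_def by (simp add: prod_sum_PiE I)
    also have "\<dots> = (\<Sum>f\<in>\<F>. \<integral>p. Q f p id * Q f p \<sigma> \<partial>P)"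
    proof (intro sum.cong refl)
      fix f assume f: "f \<in> \<F>"
      have "(\<integral>p. (\<Prod>a\<in>UNIV. X (f a) (p a) $ a * X (f a) (p a) $ \<sigma> a) \<partial>P)
          = (\<Prod>a\<in>UNIV. \<integral>x. X (f a) x $ a * X (f a) x $ \<sigma> a \<partial>N)"
        unfolding P_def using int fI[OF f] by (intro PN.product_integral_prod) auto
      then show "(\<Prod>a\<in>UNIV. \<integral>x. X (f a) x $ a * X (f a) x $ \<sigma> a \<partial>N) = (\<integral>p. Q f p id * Q f p \<sigma> \<partial>P)"
        by (simp add: Q_def prod.distrib)
    qed
    finally show "(\<Prod>a\<in>UNIV. ?J $ a $ \<sigma> a) = (\<Sum>f\<in>\<F>. \<integral>p. Q f p id * Q f p \<sigma> \<partial>P)" .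
  qed
  also have "\<dots> = (\<Sum>f\<in>\<F>. \<Sum>\<sigma>\<in>?S. of_int (sign \<sigma>) * (\<integral>p. Q f p id * Q f p \<sigma> \<partial>P))"
    unfolding sum_distrib_left by (rule sum.swap)
  also have "\<dots> = (\<Sum>f\<in>\<F>. \<integral>p. Q f p id * det (D f p) \<partial>P)"
  proof (intro sum.cong refl)
    fix f assume f: "f \<in> \<F>"
    have "(\<integral>p. Q f p id * det (D f p) \<partial>P) = (\<integral>p. (\<Sum>\<sigma>\<in>?S. of_int (sign \<sigma>) * (Q f p id * Q f p \<sigma>)) \<partial>P)"
      by (simp add: detD sum_distrib_left mult.left_commute)
    also have "\<dots> = (\<Sum>\<sigma>\<in>?S. \<integral>p. of_int (sign \<sigma>) * (Q f p id * Q f p \<sigma>) \<partial>P)"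
      using intQ[OF f] by (intro Bochner_Integration.integral_sum integrable_mult_right)
    finally show "(\<Sum>\<sigma>\<in>?S. of_int (sign \<sigma>) * (\<integral>p. Q f p id * Q f p \<sigma> \<partial>P)) = (\<integral>p. Q f p id * det (D f p) \<partial>P)"
      by simp
  qed
  finally have J1: "det ?J = (\<Sum>f\<in>\<F>. \<integral>p. Q f p id * det (D f p) \<partial>P)" .
  \<comment> \<open>The measure and the index set are invariant under simultaneous relabelling of
    \<open>f\<close> and \<open>p\<close> by \<open>\<tau>\<close>. The relabelling permutes the
    rows, which contributes the sign, and turns the diagonal product into the Leibniz product of
    \<open>inv \<tau>\<close>.\<close>
  have J\<tau>: "det ?J = (\<Sum>f\<in>\<F>. \<integral>p. of_int (sign \<tau>) * Q f p (inv \<tau>) * det (D f p) \<partial>P)" if \<tau>: "\<tau> \<in> ?S" for \<tau>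
  proof -
    have bij: "bij \<tau>" using \<tau> by (simp add: permutes_bij)
    have inv\<tau>: "\<tau> \<circ> inv \<tau> = id" "inv \<tau> \<circ> \<tau> = id"
      using \<tau> permutes_inv_o[of \<tau> UNIV] by auto
    have bF: "bij_betw (\<lambda>f. f \<circ> \<tau>) \<F> \<F>"
      by (rule bij_betwI[where g = "\<lambda>f. f \<circ> inv \<tau>"]) (auto simp: \<F>_def PiE_iff comp_assoc inv\<tau>)
    have Q\<tau>: "Q (f \<circ> \<tau>) (p \<circ> \<tau>) id = Q f p (inv \<tau>)" for f p
    proof -
      have "Q f p (inv \<tau>) = (\<Prod>a\<in>UNIV. X (f (\<tau> a)) (p (\<tau> a)) $ inv \<tau> (\<tau> a))"
        unfolding Q_def by (rule prod.reindex_bij_betw[symmetric, OF bij])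
      then show ?thesis using bij by (simp add: Q_def bij_is_inj)
    qed
    have D\<tau>: "det (D (f \<circ> \<tau>) (p \<circ> \<tau>)) = of_int (sign \<tau>) * det (D f p)" for f p
      using det_permute_rows[of \<tau> "D f p"] \<tau> by (simp add: D_def)
    have distr: "distr P P (\<lambda>p. p \<circ> \<tau>) = P"
      using distr_PiM_reindex[of UNIV "\<lambda>_. N" \<tau> UNIV] bij N.prob_space_axioms
      by (simp add: P_def bij_is_inj comp_def restrict_UNIV)
    have meas: "(\<lambda>p. p \<circ> \<tau>) \<in> P \<rightarrow>\<^sub>M P"
      unfolding P_def comp_def by (intro measurable_PiM_single') (auto simp: space_PiM PiE_iff)
    have "det ?J = (\<Sum>f\<in>\<F>. \<integral>p. Q (f \<circ> \<tau>) p id * det (D (f \<circ> \<tau>) p) \<partial>P)"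
      unfolding J1 by (rule sum.reindex_bij_betw[OF bF, symmetric])
    also have "\<dots> = (\<Sum>f\<in>\<F>. \<integral>p. Q (f \<circ> \<tau>) (p \<circ> \<tau>) id * det (D (f \<circ> \<tau>) (p \<circ> \<tau>)) \<partial>P)"
    proof (intro sum.cong refl)
      fix f assume "f \<in> \<F>"
      then have "f \<circ> \<tau> \<in> \<F>" using bF by (auto simp: bij_betw_def)
      from intQD[OF this, of id] have m: "(\<lambda>p. Q (f \<circ> \<tau>) p id * det (D (f \<circ> \<tau>) p)) \<in> borel_measurable P"
        by (rule borel_measurable_integrable)
      show "(\<integral>p. Q (f \<circ> \<tau>) p id * det (D (f \<circ> \<tau>) p) \<partial>P)
          = (\<integral>p. Q (f \<circ> \<tau>) (p \<circ> \<tau>) id * det (D (f \<circ> \<tau>) (p \<circ> \<tau>)) \<partial>P)"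
        by (subst distr[symmetric]) (rule integral_distr[OF meas m])
    qed
    finally show ?thesis by (simp add: Q\<tau> D\<tau> mult_ac)
  qed
  have "fact CARD('n) * det ?J = (\<Sum>\<tau>\<in>?S. det ?J)"
    by (simp add: card_permutations[of UNIV "CARD('n)"])
  also have "\<dots> = (\<Sum>\<tau>\<in>?S. \<Sum>f\<in>\<F>. \<integral>p. of_int (sign \<tau>) * Q f p (inv \<tau>) * det (D f p) \<partial>P)"
    using J\<tau> by (rule sum.cong[OF refl])
  also have "\<dots> = (\<Sum>f\<in>\<F>. \<Sum>\<tau>\<in>?S. \<integral>p. of_int (sign \<tau>) * Q f p (inv \<tau>) * det (D f p) \<partial>P)"
    by (rule sum.swap)
  also have "\<dots> = (\<Sum>f\<in>\<F>. \<integral>p. (det (D f p))\<^sup>2 \<partial>P)"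
  proof (intro sum.cong refl)
    fix f assume f: "f \<in> \<F>"
    \<comment> \<open>Inversion permutes the summation range and keeps signs, so the signed products
      add up to a second copy of the determinant.\<close>
    have "(\<Sum>\<tau>\<in>?S. \<integral>p. of_int (sign \<tau>) * Q f p (inv \<tau>) * det (D f p) \<partial>P)
        = (\<Sum>\<tau>\<in>?S. \<integral>p. of_int (sign (inv \<tau>)) * (Q f p (inv \<tau>) * det (D f p)) \<partial>P)"
    proof (intro sum.cong refl)
      fix \<tau> assume "\<tau> \<in> ?S"
      then have "permutation \<tau>" by (auto simp: permutation_permutes)
      then have "sign (inv \<tau>) = sign \<tau>" by (rule sign_inverse)
      then show "(\<integral>p. of_int (sign \<tau>) * Q f p (inv \<tau>) * det (D f p) \<partial>P)
          = (\<integral>p. of_int (sign (inv \<tau>)) * (Q f p (inv \<tau>) * det (D f p)) \<partial>P)"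
        by (simp add: mult.assoc)
    qed
    also have "\<dots> = (\<Sum>\<tau>\<in>?S. \<integral>p. of_int (sign \<tau>) * (Q f p \<tau> * det (D f p)) \<partial>P)"
      by (rule sum_permutations_inverse[symmetric])
    also have "\<dots> = (\<integral>p. (\<Sum>\<tau>\<in>?S. of_int (sign \<tau>) * (Q f p \<tau> * det (D f p))) \<partial>P)"
      using intQD[OF f] by (intro Bochner_Integration.integral_sum[symmetric] integrable_mult_right)
    also have "\<dots> = (\<integral>p. (det (D f p))\<^sup>2 \<partial>P)"
      by (simp add: detD[of f _] power2_eq_square sum_distrib_right mult.assoc)
    finally show "(\<Sum>\<tau>\<in>?S. \<integral>p. of_int (sign \<tau>) * Q f p (inv \<tau>) * det (D f p) \<partial>P) = (\<integral>p. (det (D f p))\<^sup>2 \<partial>P)" .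
  qed
  finally show "fact CARD('n) * det ?J = (\<Sum>f\<in>\<F>. \<integral>p. (det (\<chi> a. X (f a) (p a)))\<^sup>2 \<partial>P)"
    by (simp add: D_def)
qed

text \<open>Polarisation of the quadratic case. As a bilinear form in \<open>v\<close> and
  \<open>v'\<close> the value is the Hessian of sqrt (1 + |w|^2) at \<open>w\<close>; compare
  \<open>has_derivative_sat\<close>.\<close>

lemma has_bochner_integral_std_gauss_exp_inner:
  fixes v v' w :: "real ^ 'n::finite"
  shows "has_bochner_integral std_gauss (\<lambda>x. exp (- (x \<bullet> w)\<^sup>2 / 2) * ((x \<bullet> v) * (x \<bullet> v')))
    ((1 / sqrt (1 + (norm w)\<^sup>2)) * (v \<bullet> v' - (v \<bullet> w) * (v' \<bullet> w) / (1 + (norm w)\<^sup>2)))"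
proof -
  let ?s = "1 / sqrt (1 + (norm w)\<^sup>2)" and ?n = "1 + (norm w)\<^sup>2"
  have pos: "?n > 0" by (simp add: add_pos_nonneg)
  have sq: "has_bochner_integral std_gauss (\<lambda>x. exp (- (x \<bullet> w)\<^sup>2 / 2) * (x \<bullet> y)\<^sup>2)
      (?s * (y \<bullet> y - (y \<bullet> w)\<^sup>2 / ?n))" for y
  proof (rule has_bochner_integral_nn_integral)
    have "(y \<bullet> w)\<^sup>2 \<le> (norm y)\<^sup>2 * (norm w)\<^sup>2"
      using Cauchy_Schwarz_ineq[of y w] by (simp add: power2_norm_eq_inner)
    also have "\<dots> \<le> (norm y)\<^sup>2 * ?n" by (intro mult_left_mono) auto
    finally show "0 \<le> ?s * (y \<bullet> y - (y \<bullet> w)\<^sup>2 / ?n)"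
      using pos by (simp add: power2_norm_eq_inner pos_divide_le_eq)
    show "(\<integral>\<^sup>+x. ennreal (exp (- (x \<bullet> w)\<^sup>2 / 2) * (x \<bullet> y)\<^sup>2) \<partial>std_gauss) = ennreal (?s * (y \<bullet> y - (y \<bullet> w)\<^sup>2 / ?n))"
      using nn_integral_std_gauss_exp_inner_square[of w y] by (simp add: power2_norm_eq_inner)
  qed auto
  have "has_bochner_integral std_gauss
      (\<lambda>x. (exp (- (x \<bullet> w)\<^sup>2 / 2) * (x \<bullet> (v + v'))\<^sup>2 - exp (- (x \<bullet> w)\<^sup>2 / 2) * (x \<bullet> (v - v'))\<^sup>2) / 4)
      ((?s * ((v + v') \<bullet> (v + v') - ((v + v') \<bullet> w)\<^sup>2 / ?n) - ?s * ((v - v') \<bullet> (v - v') - ((v - v') \<bullet> w)\<^sup>2 / ?n)) / 4)"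
    by (intro has_bochner_integral_divide_zero has_bochner_integral_diff sq)
  moreover have "(exp (- (x \<bullet> w)\<^sup>2 / 2) * (x \<bullet> (v + v'))\<^sup>2 - exp (- (x \<bullet> w)\<^sup>2 / 2) * (x \<bullet> (v - v'))\<^sup>2) / 4
      = exp (- (x \<bullet> w)\<^sup>2 / 2) * ((x \<bullet> v) * (x \<bullet> v'))" for x
    by (simp add: inner_add_right inner_diff_right power2_eq_square algebra_simps)
  moreover have "(?s * ((v + v') \<bullet> (v + v') - ((v + v') \<bullet> w)\<^sup>2 / ?n) - ?s * ((v - v') \<bullet> (v - v') - ((v - v') \<bullet> w)\<^sup>2 / ?n)) / 4
      = ?s * (v \<bullet> v' - (v \<bullet> w) * (v' \<bullet> w) / ?n)"
  proof -
    have *: "(s * (A - p / n) - s * (B - q / n)) / 4 = s * ((A - B) / 4 - ((p - q) / 4) / n)" for s A B p q n :: real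
      by (simp add: diff_divide_distrib right_diff_distrib mult.commute)
    have "((v + v') \<bullet> (v + v') - (v - v') \<bullet> (v - v')) / 4 = v \<bullet> v'"
      by (simp add: inner_add_left inner_add_right inner_diff_left inner_diff_right inner_commute)
    moreover have "(((v + v') \<bullet> w)\<^sup>2 - ((v - v') \<bullet> w)\<^sup>2) / 4 = (v \<bullet> w) * (v' \<bullet> w)"
      by (simp add: inner_add_left inner_diff_left power2_eq_square algebra_simps)
    ultimately show ?thesis unfolding * by (simp only:)
  qed
  ultimately show ?thesis by (simp only:)
qed

lemma measurable_matrix_vector_mult [measurable]:
  fixes A :: "real ^ 'n::finite ^ 'm::finite"
  assumes [measurable]: "g \<in> borel_measurable M"
  shows "(\<lambda>x. A *v g x) \<in> borel_measurable M"
proof -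
  have "(*v) A \<in> borel_measurable borel"
    by (intro borel_measurable_continuous_onI matrix_vector_mult_linear_continuous_on)
  then show ?thesis using assms by (rule measurable_compose[rotated])
qed

lemma measurable_vec_nth [measurable]:
  assumes [measurable]: "g \<in> borel_measurable M"
  shows "(\<lambda>x. (g x :: real ^ 'n::finite) $ i) \<in> borel_measurable M"
proof -
  have "(\<lambda>x. g x \<bullet> axis i 1) \<in> borel_measurable M" by measurable
  then show ?thesis by (simp add: inner_axis)
qed

lemma measurable_det [measurable]:
  fixes g :: "'n::finite \<Rightarrow> 'b \<Rightarrow> real ^ 'n"
  assumes [measurable]: "\<And>a. g a \<in> borel_measurable M"
  shows "(\<lambda>x. det (\<chi> a. g a x)) \<in> borel_measurable M"
  unfolding det_def by simp

lemma norm_matrix_rows_mult: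
  fixes r :: "'m::finite \<Rightarrow> real ^ 'n::finite"
  shows "(norm ((\<chi> a. r a) *v u))\<^sup>2 = (\<Sum>a\<in>UNIV. (u \<bullet> r a)\<^sup>2)"
proof -
  have "((\<chi> a. r a) *v u) $ a = u \<bullet> r a" for a
    by (simp add: matrix_vector_mult_def inner_vec_def mult.commute)
  then show ?thesis by (simp add: norm_vec_def L2_set_def sum_nonneg)
qed

lemma measurable_exp_norm_matrix:
  fixes Y :: "real ^ 'n::finite ^ 'm::finite"
  shows "(\<lambda>u. ennreal (exp (- (norm (Y *v u))\<^sup>2 / 2))) \<in> borel_measurable lborel"
  by measurable

section \<open>The smoothed norm sqrt (1 + |w|^2) and its gradient \<open>sat\<close>\<close>

definition sat :: "'a::real_inner \<Rightarrow> 'a" where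
  "sat w = w /\<^sub>R sqrt (1 + (norm w)\<^sup>2)"

lemma one_plus_norm_pos [simp]: "0 < 1 + (norm (w :: 'a::real_inner))\<^sup>2"
  by (simp add: add_pos_nonneg)

lemma norm_sat_le: "norm (sat w) \<le> 1"
proof -
  have "norm w \<le> sqrt (1 + (norm w)\<^sup>2)" by (rule real_le_rsqrt) simp
  then show ?thesis by (simp add: sat_def divide_simps)
qed

lemma has_derivative_norm_square: "((\<lambda>w::'a::real_inner. (norm w)\<^sup>2) has_derivative (\<lambda>v. 2 * (w \<bullet> v))) (at w)"
  unfolding power2_norm_eq_inner
  by (rule has_derivative_eq_rhs[OF has_derivative_inner[OF has_derivative_ident has_derivative_ident]])
    (simp add: inner_commute)

lemma has_derivative_sqrt_one_plus_norm:
  "((\<lambda>w::'a::real_inner. sqrt (1 + (norm w)\<^sup>2)) has_derivative (\<lambda>v. sat w \<bullet> v)) (at w)"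
proof -
  have "((\<lambda>w::'a. 1 + (norm w)\<^sup>2) has_derivative (\<lambda>v. 0 + 2 * (w \<bullet> v))) (at w)"
    by (intro has_derivative_add has_derivative_const has_derivative_norm_square)
  from has_derivative_real_sqrt[OF one_plus_norm_pos this] show ?thesis
    by (rule has_derivative_eq_rhs) (simp add: sat_def divide_simps fun_eq_iff)
qed

lemma has_derivative_sat:
  "(sat has_derivative (\<lambda>v. (1 / sqrt (1 + (norm w)\<^sup>2)) *\<^sub>R (v - ((w \<bullet> v) / (1 + (norm w)\<^sup>2)) *\<^sub>R w))) (at w)"
proof -
  let ?q = "sqrt (1 + (norm w)\<^sup>2)"
  have q: "?q \<noteq> 0" "?q * ?q = 1 + (norm w)\<^sup>2" 
    using one_plus_norm_pos[of w] by (simp_all add: less_imp_le less_imp_neq[OF one_plus_norm_pos, symmetric])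
  have "((\<lambda>w. inverse (sqrt (1 + (norm w)\<^sup>2)) *\<^sub>R w) has_derivative
      (\<lambda>v. inverse ?q *\<^sub>R v + (- (inverse ?q * (sat w \<bullet> v) * inverse ?q)) *\<^sub>R w)) (at w)"
    by (rule has_derivative_scaleR[OF Deriv.has_derivative_inverse[OF q(1) has_derivative_sqrt_one_plus_norm] has_derivative_ident])
  then have "(sat has_derivative (\<lambda>v. inverse ?q *\<^sub>R v + (- (inverse ?q * (sat w \<bullet> v) * inverse ?q)) *\<^sub>R w)) (at w)"
    by (simp add: sat_def[abs_def])
  then show ?thesis
  proof (rule has_derivative_eq_rhs, intro ext)
    fix v
    have "inverse ?q * (sat w \<bullet> v) * inverse ?q = (1 / ?q) * ((w \<bullet> v) / (?q * ?q))"
      unfolding sat_def divide_inverse inverse_mult_distrib inner_scaleR_left by (simp only: mult_ac mult_1_left)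
    then show "inverse ?q *\<^sub>R v + (- (inverse ?q * (sat w \<bullet> v) * inverse ?q)) *\<^sub>R w
        = (1 / ?q) *\<^sub>R (v - ((w \<bullet> v) / (1 + (norm w)\<^sup>2)) *\<^sub>R w)"
      unfolding q(2) by (simp add: scaleR_diff_right divide_inverse)
  qed
qed

text \<open>With p and q the two square roots, the inner product equals (p + q) / (p q) times p q -
  1 - w . w'. Positivity is the strict Cauchy-Schwarz inequality for (1, w) and (1, w'), which are
  parallel only if w = w'.\<close>

lemma sat_strict_monotone:
  assumes "w \<noteq> w'"
  shows "(sat w - sat w') \<bullet> (w - w') > 0"
proof -
  define p q where "p = sqrt (1 + (norm w)\<^sup>2)" and "q = sqrt (1 + (norm w')\<^sup>2)"
  have p: "p > 0" "p\<^sup>2 = 1 + (norm w)\<^sup>2" and q: "q > 0" "q\<^sup>2 = 1 + (norm w')\<^sup>2"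
    using one_plus_norm_pos[of w] one_plus_norm_pos[of w'] by (simp_all add: p_def q_def less_imp_le)
  let ?i = "w \<bullet> w'"
  have "?i\<^sup>2 \<le> (norm w)\<^sup>2 * (norm w')\<^sup>2"
    using Cauchy_Schwarz_ineq[of w w'] by (simp add: power2_norm_eq_inner)
  moreover have "(norm (w - w'))\<^sup>2 = (norm w)\<^sup>2 + (norm w')\<^sup>2 - 2 * ?i"
    by (simp only: power2_norm_eq_inner) (simp add: inner_diff_left inner_diff_right inner_commute)
  moreover have "(norm (w - w'))\<^sup>2 > 0" using assms by simp
  moreover have "(1 + ?i)\<^sup>2 = 1 + 2 * ?i + ?i\<^sup>2" by (simp add: power2_sum)
  moreover have "(1 + (norm w)\<^sup>2) * (1 + (norm w')\<^sup>2) = 1 + (norm w)\<^sup>2 + (norm w')\<^sup>2 + (norm w)\<^sup>2 * (norm w')\<^sup>2"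
    by (simp add: algebra_simps)
  ultimately have "(1 + ?i)\<^sup>2 < (1 + (norm w)\<^sup>2) * (1 + (norm w')\<^sup>2)"
    by linarith
  also have "\<dots> = (p * q)\<^sup>2" by (simp only: power_mult_distrib p q)
  finally have "1 + ?i < p * q"
    using p q by (meson abs_le_square_iff linorder_not_less mult_pos_pos power2_less_imp_less less_imp_le)
  then have pos: "(p + q) / (p * q) * (p * q - 1 - ?i) > 0"
    using p q by (intro mult_pos_pos divide_pos_pos) auto
  have "(sat w - sat w') \<bullet> (w - w') = (w \<bullet> w) / p + (w' \<bullet> w') / q - ?i * (1 / p + 1 / q)"
    by (simp add: sat_def p_def[symmetric] q_def[symmetric] inner_diff_left inner_diff_right inner_commute divide_inverse algebra_simps)
  also have "w \<bullet> w = p\<^sup>2 - 1" using p by (simp add: power2_norm_eq_inner)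
  also have "w' \<bullet> w' = q\<^sup>2 - 1" using q by (simp add: power2_norm_eq_inner)
  also have "(p\<^sup>2 - 1) / p + (q\<^sup>2 - 1) / q - ?i * (1 / p + 1 / q) = (p + q) / (p * q) * (p * q - 1 - ?i)"
    using p(1) q(1) by (simp add: field_simps power2_eq_square)
  finally show ?thesis using pos by simp
qed

section \<open>The Minkowski sum of ellipsoids as a gradient image\<close>

lemma mink_comb_ellipsoids:
  fixes A :: "nat \<Rightarrow> real ^ 'n::finite ^ 'n"
  shows "mink_comb m t (\<lambda>i. (*v) (A i) ` cball 0 1) = (\<lambda>b. \<Sum>i<m. t i *\<^sub>R (A i *v b i)) ` {b. \<forall>i<m. norm (b i) \<le> 1}"
proof (intro set_eqI iffI)
  fix x assume "x \<in> mink_comb m t (\<lambda>i. (*v) (A i) ` cball 0 1)"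
  then obtain y where y: "x = (\<Sum>i<m. t i *\<^sub>R y i)" "\<forall>i<m. y i \<in> (*v) (A i) ` cball 0 1"
    by (auto simp: mink_comb_def)
  then have "\<forall>i. \<exists>b. i < m \<longrightarrow> y i = A i *v b \<and> norm b \<le> 1" by force
  then obtain b where "\<forall>i. i < m \<longrightarrow> y i = A i *v b i \<and> norm (b i) \<le> 1" by metis
  then show "x \<in> (\<lambda>b. \<Sum>i<m. t i *\<^sub>R (A i *v b i)) ` {b. \<forall>i<m. norm (b i) \<le> 1}"
    using y by (intro image_eqI[of _ _ b]) auto
next
  fix x assume "x \<in> (\<lambda>b. \<Sum>i<m. t i *\<^sub>R (A i *v b i)) ` {b. \<forall>i<m. norm (b i) \<le> 1}"
  then obtain b where "\<forall>i<m. norm (b i) \<le> 1" "x = (\<Sum>i<m. t i *\<^sub>R (A i *v b i))" by auto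
  then show "x \<in> mink_comb m t (\<lambda>i. (*v) (A i) ` cball 0 1)"
    by (auto simp: mink_comb_def intro!: exI[of _ "\<lambda>i. A i *v b i"])
qed

context
  fixes A :: "nat \<Rightarrow> real ^ 'n::finite ^ 'n" and t :: "nat \<Rightarrow> real" and m :: nat
  assumes inv: "\<And>i. i < m \<Longrightarrow> invertible (A i)" and t0: "\<And>i. i < m \<Longrightarrow> t i \<ge> 0"
begin

abbreviation (input) "ell_sum \<equiv> (\<lambda>b. \<Sum>i<m. t i *\<^sub>R (A i *v b i)) ` {b. \<forall>i<m. norm (b i) \<le> 1}"

text \<open>The gradient of \<open>\<Sum>i<m. t i * sqrt (1 + norm (transpose (A i) *v u)\<^sup>2)\<close>, a smoothing of the
  support function of the Minkowski sum of the ellipsoids; it maps the whole space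
  diffeomorphically to the interior of that sum.\<close>

definition sum_grad :: "real ^ 'n \<Rightarrow> real ^ 'n" where
  "sum_grad u = (\<Sum>i<m. t i *\<^sub>R (A i *v sat (transpose (A i) *v u)))"

definition sum_grad' :: "real ^ 'n \<Rightarrow> real ^ 'n \<Rightarrow> real ^ 'n" where
  "sum_grad' u v = (\<Sum>i<m. t i *\<^sub>R (A i *v
     ((1 / sqrt (1 + (norm (transpose (A i) *v u))\<^sup>2)) *\<^sub>R (transpose (A i) *v v -
       (((transpose (A i) *v u) \<bullet> (transpose (A i) *v v)) / (1 + (norm (transpose (A i) *v u))\<^sup>2)) *\<^sub>R (transpose (A i) *v u)))))"

lemma has_derivative_sum_grad: "(sum_grad has_derivative sum_grad' u) (at u)"
proof -
  have bl: "((*v) B has_derivative (*v) B) F" for B :: "real ^ 'n ^ 'n" and F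
    by (intro bounded_linear_imp_has_derivative matrix_vector_mul_bounded_linear)
  have "((\<lambda>u. A i *v sat (transpose (A i) *v u)) has_derivative (\<lambda>v. A i *v
     ((1 / sqrt (1 + (norm (transpose (A i) *v u))\<^sup>2)) *\<^sub>R (transpose (A i) *v v -
       (((transpose (A i) *v u) \<bullet> (transpose (A i) *v v)) / (1 + (norm (transpose (A i) *v u))\<^sup>2)) *\<^sub>R (transpose (A i) *v u))))) (at u)" for i
    by (rule has_derivative_compose[OF has_derivative_compose[OF bl has_derivative_sat] bl])
  then show ?thesis
    unfolding sum_grad_def[abs_def] sum_grad'_def[abs_def]
    by (intro has_derivative_sum has_derivative_scaleR_right)
qed

lemma continuous_on_sum_grad: "continuous_on S sum_grad"
  by (intro continuous_at_imp_continuous_on ballI has_derivative_continuous[OF has_derivative_sum_grad])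

lemma transpose_inject:
  assumes "i < m" "transpose (A i) *v u = transpose (A i) *v v"
  shows "u = v"
proof -
  obtain B where "A i ** B = mat 1" using inv[OF assms(1)] by (auto simp: invertible_def)
  then have "transpose B ** transpose (A i) = mat 1" by (metis matrix_transpose_mul transpose_mat)
  then show ?thesis using assms(2) by (metis matrix_vector_mul_assoc matrix_vector_mul_lid)
qed

text \<open>Tested against u - v, the difference of the two values is a nonnegative combination of
  the monotonicity terms of \<open>sat\<close>. A positive weight makes it strictly positive, as the
  transposed matrices are injective.\<close>

lemma inj_sum_grad:
  assumes "\<exists>i<m. t i > 0"
  shows "inj sum_grad"
proof (rule injI, rule ccontr)
  fix u v assume eq: "sum_grad u = sum_grad v" and ne: "u \<noteq> v"
  let ?f = "\<lambda>i. t i * ((sat (transpose (A i) *v u) - sat (transpose (A i) *v v)) \<bullet> (transpose (A i) *v u - transpose (A i) *v v))"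
  have pos: "(sat (transpose (A i) *v u) - sat (transpose (A i) *v v)) \<bullet> (transpose (A i) *v u - transpose (A i) *v v) > 0"
    if "i < m" for i
    using transpose_inject[OF that] ne by (intro sat_strict_monotone) auto
  have "0 = (sum_grad u - sum_grad v) \<bullet> (u - v)" using eq by simp
  also have "\<dots> = (\<Sum>i<m. ?f i)"
    unfolding sum_grad_def sum_subtractf[symmetric] inner_sum_left
    by (intro sum.cong refl)
      (simp add: scaleR_diff_right[symmetric] matrix_vector_mult_diff_distrib[symmetric] inner_matrix_vector_transpose
        del: transpose_matrix_vector)
  also have "\<dots> > 0"
  proof -
    obtain i where i: "i < m" "t i > 0" using assms by auto
    have nn: "?f j \<ge> 0" if "j < m" for j
      using pos[OF that] t0[OF that] by (intro mult_nonneg_nonneg less_imp_le[of 0 "_ \<bullet> _"])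
    have "?f i > 0" using i pos[OF i(1)] by (intro mult_pos_pos)
    then show ?thesis
      by (rule sum_pos2[of "{..<m}" i, rotated 2]) (use i nn in simp_all)
  qed
  finally show False by simp
qed

lemma range_sum_grad_subset: "range sum_grad \<subseteq> ell_sum"
proof
  fix x assume "x \<in> range sum_grad"
  then obtain u where u: "x = sum_grad u" by auto
  show "x \<in> ell_sum"
    unfolding u sum_grad_def
    by (rule image_eqI[of _ _ "\<lambda>i. sat (transpose (A i) *v u)"]) (auto intro: norm_sat_le)
qed

text \<open>A point \<open>x\<close> is a value of the gradient if the smoothed support function
  minus the linear function of \<open>x\<close> has a minimum. For interior \<open>x\<close> that
  difference, \<open>\<phi>\<close>, is coercive, so a minimum exists.\<close>

lemma interior_subset_range_sum_grad: "interior ell_sum \<subseteq> range sum_grad"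
proof
  fix x assume "x \<in> interior ell_sum"
  then obtain \<epsilon> where \<epsilon>: "\<epsilon> > 0" "cball x \<epsilon> \<subseteq> ell_sum" by (auto simp: mem_interior_cball)
  define \<phi> where "\<phi> u = (\<Sum>i<m. t i * sqrt (1 + (norm (transpose (A i) *v u))\<^sup>2)) - x \<bullet> u" for u
  have coercive: "\<phi> u \<ge> \<epsilon> * norm u" for u
  proof (cases "u = 0")
    case True
    then show ?thesis using t0 by (auto simp: \<phi>_def intro!: sum_nonneg)
  next
    case False
    \<comment> \<open>The point of the ball around \<open>x\<close> furthest in direction
      \<open>u\<close>. It lies in the body, so its inner product with \<open>u\<close> is at most
      the support function, and this leaves room for the term
      \<open>\<epsilon> * norm u\<close>.\<close>
    have "x + (\<epsilon> / norm u) *\<^sub>R u \<in> cball x \<epsilon>" using False \<epsilon> by (simp add: dist_norm)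
    then obtain b where b: "\<forall>i<m. norm (b i) \<le> 1" "x + (\<epsilon> / norm u) *\<^sub>R u = (\<Sum>i<m. t i *\<^sub>R (A i *v b i))"
      using \<epsilon>(2) by auto
    have "(x + (\<epsilon> / norm u) *\<^sub>R u) \<bullet> u = x \<bullet> u + \<epsilon> * norm u"
      using False by (simp add: inner_add_left power2_norm_eq_inner[symmetric] power2_eq_square)
    moreover have "(x + (\<epsilon> / norm u) *\<^sub>R u) \<bullet> u \<le> (\<Sum>i<m. t i * sqrt (1 + (norm (transpose (A i) *v u))\<^sup>2))"
      unfolding b(2) inner_sum_left
    proof (rule sum_mono)
      fix i assume "i \<in> {..<m}"
      then have i: "i < m" by simp
      let ?w = "transpose (A i) *v u"
      have "b i \<bullet> ?w \<le> norm (b i) * norm ?w" by (rule norm_cauchy_schwarz)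
      also have "\<dots> \<le> 1 * norm ?w" using b(1) i by (intro mult_right_mono) auto
      also have "\<dots> \<le> sqrt (1 + (norm ?w)\<^sup>2)" by (simp add: real_le_rsqrt)
      finally have "t i * (b i \<bullet> ?w) \<le> t i * sqrt (1 + (norm ?w)\<^sup>2)"
        using t0[OF i] by (rule mult_left_mono)
      then show "(t i *\<^sub>R (A i *v b i)) \<bullet> u \<le> t i * sqrt (1 + (norm ?w)\<^sup>2)"
        by (simp add: inner_matrix_vector_transpose)
    qed
    ultimately show ?thesis unfolding \<phi>_def by simp
  qed
  have d\<phi>: "(\<phi> has_derivative (\<lambda>v. (sum_grad u - x) \<bullet> v)) (at u)" for u
  proof -
    have bl: "((*v) B has_derivative (*v) B) F" for B :: "real ^ 'n ^ 'n" and F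
      by (intro bounded_linear_imp_has_derivative matrix_vector_mul_bounded_linear)
    have "((\<lambda>u. t i * sqrt (1 + (norm (transpose (A i) *v u))\<^sup>2)) has_derivative
        (\<lambda>v. t i * (sat (transpose (A i) *v u) \<bullet> (transpose (A i) *v v)))) (at u)" for i
      by (intro has_derivative_mult_right has_derivative_compose[OF bl has_derivative_sqrt_one_plus_norm])
    then have "(\<phi> has_derivative (\<lambda>v. (\<Sum>i<m. t i * (sat (transpose (A i) *v u) \<bullet> (transpose (A i) *v v))) - x \<bullet> v)) (at u)"
      unfolding \<phi>_def[abs_def]
      by (intro has_derivative_diff has_derivative_sum has_derivative_inner_right has_derivative_ident)
    then show ?thesis
      by (rule has_derivative_eq_rhs)
        (simp add: sum_grad_def inner_diff_left inner_sum_left inner_matrix_vector_transpose fun_eq_iff)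
  qed
  have cont: "continuous_on S \<phi>" for S
    by (intro continuous_at_imp_continuous_on ballI has_derivative_continuous[OF d\<phi>])
  \<comment> \<open>Beyond this radius coercivity forces \<open>\<phi>\<close> above \<phi> 0 +
    \<epsilon>, so a minimum over the ball is a global one.\<close>
  define R where "R = \<phi> 0 / \<epsilon> + 1"
  have R: "R \<ge> 0" using coercive[of 0] \<epsilon> by (simp add: R_def)
  obtain u where u: "u \<in> cball 0 R" "\<And>v. v \<in> cball 0 R \<Longrightarrow> \<phi> u \<le> \<phi> v"
    using continuous_attains_inf[OF compact_cball _ cont, of 0 R] R by auto
  have min: "\<phi> u \<le> \<phi> v" for v
  proof (cases "v \<in> cball 0 R")
    case False
    then have "norm v > R" by simp
    then have "\<epsilon> * R < \<epsilon> * norm v" using \<epsilon> by simp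
    moreover have "\<epsilon> * R = \<phi> 0 + \<epsilon>" using \<epsilon> by (simp add: R_def distrib_left)
    moreover have "\<phi> u \<le> \<phi> 0" using R by (intro u) simp
    ultimately show ?thesis using coercive[of v] \<epsilon> by simp
  qed (use u in simp)
  have "(\<lambda>v. (sum_grad u - x) \<bullet> v) = (\<lambda>v. 0)"
    by (rule differential_zero_maxmin[OF UNIV_I open_UNIV d\<phi>]) (use min in blast)
  then have "(sum_grad u - x) \<bullet> (sum_grad u - x) = 0" by (rule fun_cong)
  then show "x \<in> range sum_grad" by auto
qed

lemma bounded_ell_sum: "bounded ell_sum"
proof (rule boundedI)
  fix x assume "x \<in> ell_sum"
  then obtain b where b: "\<forall>i<m. norm (b i) \<le> 1" "x = (\<Sum>i<m. t i *\<^sub>R (A i *v b i))" by auto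
  have "norm x \<le> (\<Sum>i<m. norm (t i *\<^sub>R (A i *v b i)))" unfolding b(2) by (rule norm_sum)
  also have "\<dots> \<le> (\<Sum>i<m. t i * onorm ((*v) (A i)))"
  proof (rule sum_mono)
    fix i assume "i \<in> {..<m}"
    then have i: "i < m" by simp
    have "norm (A i *v b i) \<le> onorm ((*v) (A i)) * norm (b i)"
      by (rule onorm[OF matrix_vector_mul_bounded_linear])
    also have "\<dots> \<le> onorm ((*v) (A i)) * 1"
      using b(1) i by (intro mult_left_mono onorm_pos_le matrix_vector_mul_bounded_linear) auto
    finally show "norm (t i *\<^sub>R (A i *v b i)) \<le> t i * onorm ((*v) (A i))"
      using t0[OF i] by (simp add: mult_left_mono)
  qed
  finally show "norm x \<le> (\<Sum>i<m. t i * onorm ((*v) (A i)))" .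
qed

lemma convex_ell_sum: "convex ell_sum"
proof (rule convexI)
  fix x y and u v :: real assume xy: "x \<in> ell_sum" "y \<in> ell_sum" and uv: "0 \<le> u" "0 \<le> v" "u + v = 1"
  then obtain b c where bc: "\<forall>i<m. norm (b i) \<le> 1" "x = (\<Sum>i<m. t i *\<^sub>R (A i *v b i))"
    "\<forall>i<m. norm (c i) \<le> 1" "y = (\<Sum>i<m. t i *\<^sub>R (A i *v c i))" by auto
  show "u *\<^sub>R x + v *\<^sub>R y \<in> ell_sum"
  proof (rule image_eqI[of _ _ "\<lambda>i. u *\<^sub>R b i + v *\<^sub>R c i"])
    show "u *\<^sub>R x + v *\<^sub>R y = (\<Sum>i<m. t i *\<^sub>R (A i *v (u *\<^sub>R b i + v *\<^sub>R c i)))"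
      unfolding bc scaleR_sum_right sum.distrib[symmetric]
      by (intro sum.cong refl) (simp add: matrix_vector_right_distrib matrix_vector_mult_scaleR scaleR_add_right mult.commute)
    have "norm (u *\<^sub>R b i + v *\<^sub>R c i) \<le> 1" if "i < m" for i
    proof -
      have "norm (u *\<^sub>R b i + v *\<^sub>R c i) \<le> u * norm (b i) + v * norm (c i)"
        using uv norm_triangle_ineq[of "u *\<^sub>R b i" "v *\<^sub>R c i"] by simp
      also have "\<dots> \<le> u * 1 + v * 1" using uv bc that by (intro add_mono mult_left_mono) auto
      finally show ?thesis using uv by simp
    qed
    then show "(\<lambda>i. u *\<^sub>R b i + v *\<^sub>R c i) \<in> {b. \<forall>i<m. norm (b i) \<le> 1}" by simp
  qed
qed

lemma borel_range_sum_grad: "range sum_grad \<in> sets borel"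
proof -
  have "range sum_grad = (\<Union>n::nat. sum_grad ` cball 0 (real n))"
  proof
    show "range sum_grad \<subseteq> (\<Union>n::nat. sum_grad ` cball 0 (real n))"
    proof
      fix y assume "y \<in> range sum_grad"
      then obtain x where x: "y = sum_grad x" by auto
      obtain n :: nat where "norm x \<le> real n" using real_arch_simple by auto
      then show "y \<in> (\<Union>n::nat. sum_grad ` cball 0 (real n))" using x by (intro UN_I[of n]) auto
    qed
  qed auto
  moreover have "sum_grad ` cball 0 (real n) \<in> sets borel" for n
    by (intro borel_compact compact_continuous_image continuous_on_sum_grad compact_cball)
  ultimately show ?thesis by auto
qed

text \<open>The range lies between the interior of the convex body and the body itself, which differ
  by a null set.\<close>

lemma emeasure_range_sum_grad: "emeasure lborel (range sum_grad) = ennreal (measure lebesgue ell_sum)"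
proof -
  have lm: "ell_sum \<in> lmeasurable" by (intro measurable_convex convex_ell_sum bounded_ell_sum)
  have "bounded (range sum_grad)" using bounded_ell_sum range_sum_grad_subset by (rule bounded_subset)
  then have fin: "emeasure lborel (range sum_grad) < \<infinity>" by (rule emeasure_bounded_finite)
  have rl: "range sum_grad \<in> lmeasurable"
    using fin borel_range_sum_grad by (auto simp: fmeasurable_def)
  have "measure lebesgue (range sum_grad) \<le> measure lebesgue ell_sum"
    using rl lm by (intro measure_mono_fmeasurable range_sum_grad_subset) auto
  moreover have "measure lebesgue (interior ell_sum) \<le> measure lebesgue (range sum_grad)"
    using rl by (intro measure_mono_fmeasurable interior_subset_range_sum_grad) auto
  moreover have "measure lebesgue (interior ell_sum) = measure lebesgue ell_sum"
    by (intro measure_interior bounded_ell_sum negligible_convex_frontier convex_ell_sum)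
  ultimately have "measure lebesgue (range sum_grad) = measure lebesgue ell_sum" by simp
  moreover have "emeasure lborel (range sum_grad) = ennreal (measure lebesgue (range sum_grad))"
    using borel_range_sum_grad emeasure_eq_ennreal_measure[of lborel "range sum_grad"] fin
    by (simp add: measure_completion)
  ultimately show ?thesis by simp
qed

text \<open>By \<open>has_bochner_integral_std_gauss_exp_inner\<close> the Jacobian matrix is a sum
  of second-moment matrices of the weighted vectors \<open>X i\<close>, which is the form required
  by \<open>Cauchy_Binet_integral\<close>.\<close>

lemma det_sum_grad':
  "fact CARD('n) * det (matrix (sum_grad' u)) = (\<Sum>f\<in>PiE (UNIV :: 'n set) (\<lambda>_. {..<m}).
     \<integral>p. (\<Prod>a\<in>UNIV. t (f a)) * (exp (- (norm ((\<chi> a. A (f a) *v p a) *v u))\<^sup>2 / 2)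
        * (det (\<chi> a. A (f a) *v p a))\<^sup>2) \<partial>gauss_family UNIV)" (is ?eq)
  and integrable_det_sum_grad': "f \<in> PiE (UNIV :: 'n set) (\<lambda>_. {..<m}) \<Longrightarrow> integrable (gauss_family UNIV)
     (\<lambda>p. (\<Prod>a\<in>UNIV. t (f a)) * (exp (- (norm ((\<chi> a. A (f a) *v p a) *v u))\<^sup>2 / 2)
        * (det (\<chi> a. A (f a) *v p a))\<^sup>2))"
proof -
  \<comment> \<open>The weight t i exp (- (u . A i x)^2 / 2) is shared equally by the two factors of
    an entry, hence the square root and the denominator 4.\<close>
  define X where "X i x = (sqrt (t i) * exp (- (u \<bullet> (A i *v x))\<^sup>2 / 4)) *\<^sub>R (A i *v x)" for i x
  let ?w = "\<lambda>i. transpose (A i) *v u" and ?e = "\<lambda>i a. transpose (A i) *v axis a 1"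
  let ?c = "\<lambda>i a b. (1 / sqrt (1 + (norm (?w i))\<^sup>2)) * (?e i a \<bullet> ?e i b - (?e i a \<bullet> ?w i) * (?e i b \<bullet> ?w i) / (1 + (norm (?w i))\<^sup>2))"
  have comp: "(A i *v x) $ a = x \<bullet> ?e i a" and compu: "u \<bullet> (A i *v x) = x \<bullet> ?w i" for i x a
    by (simp_all only: inner_matrix_vector_transpose[symmetric] inner_axis real_inner_1_right inner_commute[of u])
  have XX: "X i x $ a * X i x $ b = t i * (exp (- (x \<bullet> ?w i)\<^sup>2 / 2) * ((x \<bullet> ?e i a) * (x \<bullet> ?e i b)))" if "i < m" for i x a b
  proof -
    have "exp (- (x \<bullet> ?w i)\<^sup>2 / 4) * exp (- (x \<bullet> ?w i)\<^sup>2 / 4) = exp (- (x \<bullet> ?w i)\<^sup>2 / 2)"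
      unfolding exp_add[symmetric] by simp
    moreover have "sqrt (t i) * sqrt (t i) = t i" using t0[OF that] by simp
    moreover have "X i x $ a * X i x $ b = (sqrt (t i) * sqrt (t i)) *
        ((exp (- (x \<bullet> ?w i)\<^sup>2 / 4) * exp (- (x \<bullet> ?w i)\<^sup>2 / 4)) * ((x \<bullet> ?e i a) * (x \<bullet> ?e i b)))"
      unfolding X_def vector_scaleR_component comp compu real_scaleR_def by (simp only: mult_ac)
    ultimately show ?thesis by (simp only:)
  qed
  have hb: "has_bochner_integral std_gauss (\<lambda>x. X i x $ a * X i x $ b) (t i * ?c i a b)" if "i < m" for i a b
    unfolding XX[OF that]
    by (intro has_bochner_integral_mult_right has_bochner_integral_std_gauss_exp_inner)
  have "matrix (sum_grad' u) = (\<chi> a b. \<Sum>i<m. \<integral>x. X i x $ a * X i x $ b \<partial>std_gauss)"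
  proof -
    have in_eq: "(s *\<^sub>R (eb - ((w \<bullet> eb) / n) *\<^sub>R w)) \<bullet> ea = s * (ea \<bullet> eb - (ea \<bullet> w) * (eb \<bullet> w) / n)"
      for s n :: real and eb ea w :: "real ^ 'n"
      by (simp add: inner_diff_left inner_diff_right inner_commute mult.commute)
    have "sum_grad' u (axis b 1) $ a = (\<Sum>i<m. t i * ?c i a b)" for a b
      unfolding sum_grad'_def sum_component vector_scaleR_component real_scaleR_def comp in_eq by (rule refl)
    moreover have "(\<integral>x. X i x $ a * X i x $ b \<partial>std_gauss) = t i * ?c i a b" if "i < m" for i a b
      using hb[OF that] by (rule has_bochner_integral_integral_eq)
    ultimately show ?thesis by (simp add: matrix_def vec_eq_iff)
  qed
  then have J: "det (matrix (sum_grad' u)) = det (\<chi> a b. \<Sum>i<m. \<integral>x. X i x $ a * X i x $ b \<partial>std_gauss)"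
    by simp
  have D: "(det (\<chi> a. X (f a) (p a)))\<^sup>2 = (\<Prod>a\<in>UNIV. t (f a)) * (exp (- (norm ((\<chi> a. A (f a) *v p a) *v u))\<^sup>2 / 2)
        * (det (\<chi> a. A (f a) *v p a))\<^sup>2)" if f: "f \<in> PiE (UNIV :: 'n set) (\<lambda>_. {..<m})" for f p
  proof -
    let ?Y = "\<chi> a. A (f a) *v p a"
    have tf: "t (f a) \<ge> 0" for a using f by (intro t0) (auto simp: PiE_iff)
    have "det (\<chi> a. X (f a) (p a)) = (\<Prod>a\<in>UNIV. sqrt (t (f a)) * exp (- (u \<bullet> ?Y $ a)\<^sup>2 / 4)) * det ?Y"
      unfolding X_def scalar_mult_eq_scaleR[symmetric] by (simp add: det_rows_mul)
    then have "(det (\<chi> a. X (f a) (p a)))\<^sup>2 = (\<Prod>a\<in>UNIV. (sqrt (t (f a)))\<^sup>2 * (exp (- (u \<bullet> ?Y $ a)\<^sup>2 / 4))\<^sup>2) * (det ?Y)\<^sup>2"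
      by (simp add: power_mult_distrib prod_power_distrib)
    also have "(\<Prod>a\<in>UNIV. (sqrt (t (f a)))\<^sup>2 * (exp (- (u \<bullet> ?Y $ a)\<^sup>2 / 4))\<^sup>2)
        = (\<Prod>a\<in>UNIV. t (f a)) * exp (\<Sum>a\<in>UNIV. - (u \<bullet> ?Y $ a)\<^sup>2 / 2)"
      using tf by (simp add: prod.distrib exp_sum exp_double[symmetric])
    also have "(\<Sum>a\<in>UNIV. - (u \<bullet> ?Y $ a)\<^sup>2 / 2) = - (norm (?Y *v u))\<^sup>2 / 2"
      using norm_matrix_rows_mult[of "\<lambda>a. A (f a) *v p a" u] by (simp add: sum_negf sum_divide_distrib)
    finally show ?thesis by (simp only: mult.assoc)
  qed
  note CB = Cauchy_Binet_integral[OF prob_space_std_gauss, of "{..<m}" X]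
  have int: "integrable std_gauss (\<lambda>x. X i x $ a * X i x $ b)" if "i \<in> {..<m}" for i a b
    using hb[of i a b] that by (auto simp: has_bochner_integral_iff)
  show ?eq
    unfolding J using CB(2)[OF finite_lessThan int] by (simp only: D cong: sum.cong)
  show "integrable (gauss_family UNIV)
     (\<lambda>p. (\<Prod>a\<in>UNIV. t (f a)) * (exp (- (norm ((\<chi> a. A (f a) *v p a) *v u))\<^sup>2 / 2)
        * (det (\<chi> a. A (f a) *v p a))\<^sup>2))" if "f \<in> PiE (UNIV :: 'n set) (\<lambda>_. {..<m})" for f
    using CB(1)[OF finite_lessThan int that] by (simp only: D[OF that])
qed

theorem emeasure_ell_sum:
  assumes "m > 0"
  shows "ennreal (measure lebesgue ell_sum) = ennreal ((2 * pi) powr (real CARD('n) / 2) / fact CARD('n)) *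
    (\<Sum>f\<in>PiE (UNIV :: 'n set) (\<lambda>_. {..<m}). ennreal (\<Prod>a\<in>UNIV. t (f a)) *
       (\<integral>\<^sup>+p. ennreal \<bar>det (\<chi> a. A (f a) *v p a)\<bar> \<partial>gauss_family UNIV))"
proof (cases "\<exists>i<m. t i > 0")
  \<comment> \<open>If all weights vanish the gradient map is constant and no change of variables is
    possible; both sides are then 0.\<close>
  case False
  then have z: "t i = 0" if "i < m" for i using that t0[OF that] by force
  have "ell_sum \<subseteq> {0}" by (auto simp: z)
  then have "negligible ell_sum" by (rule negligible_subset[OF negligible_sing])
  then have "measure lebesgue ell_sum = 0" by (rule negligible_imp_measure0)
  moreover
  have "(\<Prod>a\<in>UNIV. t (f a)) = 0" if "f \<in> PiE (UNIV :: 'n set) (\<lambda>_. {..<m})" for f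
    using that z by (intro prod_zero) (auto simp: PiE_iff)
  then have "(\<Sum>f\<in>PiE (UNIV :: 'n set) (\<lambda>_. {..<m}). ennreal (\<Prod>a\<in>UNIV. t (f a)) *
       (\<integral>\<^sup>+p. ennreal \<bar>det (\<chi> a. A (f a) *v p a)\<bar> \<partial>gauss_family UNIV)) = 0"
    by (intro sum.neutral ballI) (simp only: ennreal_0 mult_zero_left)
  ultimately show ?thesis by simp
next
  case True
  let ?\<F> = "PiE (UNIV :: 'n set) (\<lambda>_. {..<m})"
  let ?T = "\<lambda>f. \<Prod>a\<in>(UNIV :: 'n set). t (f a)"
  let ?Y = "\<lambda>f p. (\<chi> a. A (f a) *v p a) :: real ^ 'n ^ 'n"
  let ?G = "\<lambda>f u p. exp (- (norm (?Y f p *v u))\<^sup>2 / 2) * (det (?Y f p))\<^sup>2"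
  let ?P = "gauss_family UNIV :: ('n \<Rightarrow> real ^ 'n) measure"
  interpret P: prob_space ?P by (rule prob_space_PiM) (rule prob_space_std_gauss)
  have T0: "?T f \<ge> 0" if "f \<in> ?\<F>" for f using that t0 by (intro prod_nonneg) (auto simp: PiE_iff)
  have nnint: "(\<integral>\<^sup>+p. ennreal (?T f * ?G f u p) \<partial>?P) = ennreal (\<integral>p. ?T f * ?G f u p \<partial>?P)" if "f \<in> ?\<F>" for f u
    using integrable_det_sum_grad'[OF that] T0[OF that] by (intro nn_integral_eq_integral) auto
  have int0: "(\<integral>p. ?T f * ?G f u p \<partial>?P) \<ge> 0" if "f \<in> ?\<F>" for f u
    using T0[OF that] by (intro Bochner_Integration.integral_nonneg) auto
  have det0: "det (matrix (sum_grad' u)) = (\<Sum>f\<in>?\<F>. \<integral>p. ?T f * ?G f u p \<partial>?P) / fact CARD('n)" for u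
    using det_sum_grad'[of u] by (simp add: divide_simps mult.commute)
  have detnn: "ennreal \<bar>det (matrix (sum_grad' u))\<bar> = ennreal (1 / fact CARD('n)) * (\<Sum>f\<in>?\<F>. \<integral>\<^sup>+p. ennreal (?T f * ?G f u p) \<partial>?P)" for u
  proof -
    have s: "(\<Sum>f\<in>?\<F>. \<integral>p. ?T f * ?G f u p \<partial>?P) \<ge> 0" by (intro sum_nonneg int0)
    have "(\<Sum>f\<in>?\<F>. \<integral>\<^sup>+p. ennreal (?T f * ?G f u p) \<partial>?P) = ennreal (\<Sum>f\<in>?\<F>. \<integral>p. ?T f * ?G f u p \<partial>?P)"
      using int0 by (simp only: nnint cong: sum.cong) (rule sum_ennreal)
    then show ?thesis
      unfolding det0 using s by (simp add: ennreal_mult'[symmetric])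
  qed
  have measP: "(\<lambda>x. g x a) \<in> borel_measurable M" if "g \<in> M \<rightarrow>\<^sub>M ?P" for g and M :: "'z measure" and a
  proof -
    have "(\<lambda>p. p a) \<in> ?P \<rightarrow>\<^sub>M std_gauss" by (rule measurable_component_singleton) simp
    then have "(\<lambda>x. g x a) \<in> M \<rightarrow>\<^sub>M std_gauss" by (rule measurable_compose[OF that])
    then show ?thesis by (simp only: measurable_cong_sets[OF refl sets_std_gauss])
  qed
  have Yu: "(norm (?Y f p *v u))\<^sup>2 = (\<Sum>a\<in>UNIV. (u \<bullet> (A (f a) *v p a))\<^sup>2)" for f p u
    by (rule norm_matrix_rows_mult)
  have Gmeas: "(\<lambda>x. ennreal (?T f * ?G f (h x) (g x))) \<in> borel_measurable M"
    if [measurable]: "g \<in> M \<rightarrow>\<^sub>M ?P" "h \<in> borel_measurable M" for f g h and M :: "'z measure"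
  proof -
    note [measurable] = measP[OF that(1)]
    show ?thesis unfolding Yu by measurable
  qed
  have m [measurable]: "(\<lambda>u. \<integral>\<^sup>+p. ennreal (?T f * ?G f u p) \<partial>?P) \<in> borel_measurable borel" for f
  proof (rule P.borel_measurable_nn_integral)
    show "(\<lambda>(u, p). ennreal (?T f * ?G f u p)) \<in> borel_measurable (borel \<Otimes>\<^sub>M ?P)"
      unfolding case_prod_beta' by (rule Gmeas[OF measurable_snd measurable_fst])
  qed
  have "ennreal (measure lebesgue ell_sum) = (\<integral>\<^sup>+u. ennreal \<bar>det (matrix (sum_grad' u))\<bar> \<partial>lborel)"
  proof -
    have e: "(\<integral>\<^sup>+u\<in>UNIV. ennreal \<bar>det (matrix (sum_grad' u))\<bar> \<partial>lborel) = emeasure lborel (sum_grad ` UNIV)"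
    proof (rule emeasure_differentiable_image)
      \<comment> \<open>The Jacobian is nonnegative, so its measurability as a real function can be
        read off from the nonnegative integrals in \<open>detnn\<close>.\<close>
      have "(\<lambda>u. enn2real (ennreal (det (matrix (sum_grad' u))))) \<in> borel_measurable borel"
      proof -
        have "det (matrix (sum_grad' u)) \<ge> 0" for u
          unfolding det0 by (intro divide_nonneg_nonneg sum_nonneg int0) auto
        then have "ennreal (det (matrix (sum_grad' u))) = ennreal \<bar>det (matrix (sum_grad' u))\<bar>" for u by simp
        moreover have "(\<lambda>u. ennreal \<bar>det (matrix (sum_grad' u))\<bar>) \<in> borel_measurable borel"
          unfolding detnn by measurable
        ultimately show ?thesis by simp
      qed
      moreover have "enn2real (ennreal (det (matrix (sum_grad' u)))) = det (matrix (sum_grad' u))" for u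
        unfolding det0 by (intro enn2real_ennreal divide_nonneg_nonneg sum_nonneg int0) auto
      ultimately show "(\<lambda>u. det (matrix (sum_grad' u))) \<in> borel_measurable borel" by simp
      show "emeasure lborel (range sum_grad) < \<infinity>" by (simp add: emeasure_range_sum_grad)
    qed (use has_derivative_sum_grad inj_sum_grad[OF True] borel_range_sum_grad in auto)
    then show ?thesis by (simp add: emeasure_range_sum_grad)
  qed
  also have "\<dots> = ennreal (1 / fact CARD('n)) * (\<Sum>f\<in>?\<F>. \<integral>\<^sup>+u. (\<integral>\<^sup>+p. ennreal (?T f * ?G f u p) \<partial>?P) \<partial>lborel)"
  proof -
    have m': "(\<lambda>u. \<integral>\<^sup>+p. ennreal (?T f * ?G f u p) \<partial>?P) \<in> borel_measurable lborel" for f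
      using m[of f] by (simp only: measurable_lborel2)
    have "(\<integral>\<^sup>+u. ennreal \<bar>det (matrix (sum_grad' u))\<bar> \<partial>lborel)
        = ennreal (1 / fact CARD('n)) * (\<integral>\<^sup>+u. (\<Sum>f\<in>?\<F>. \<integral>\<^sup>+p. ennreal (?T f * ?G f u p) \<partial>?P) \<partial>lborel)"
      unfolding detnn by (rule nn_integral_cmult) (rule borel_measurable_sum, rule m')
    also have "(\<integral>\<^sup>+u. (\<Sum>f\<in>?\<F>. \<integral>\<^sup>+p. ennreal (?T f * ?G f u p) \<partial>?P) \<partial>lborel)
        = (\<Sum>f\<in>?\<F>. \<integral>\<^sup>+u. (\<integral>\<^sup>+p. ennreal (?T f * ?G f u p) \<partial>?P) \<partial>lborel)"
      by (rule nn_integral_sum) (rule m')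
    finally show ?thesis .
  qed
  also have "(\<Sum>f\<in>?\<F>. \<integral>\<^sup>+u. (\<integral>\<^sup>+p. ennreal (?T f * ?G f u p) \<partial>?P) \<partial>lborel)
      = (\<Sum>f\<in>?\<F>. ennreal ((2 * pi) powr (real CARD('n) / 2)) * (ennreal (?T f) * (\<integral>\<^sup>+p. ennreal \<bar>det (?Y f p)\<bar> \<partial>?P)))"
  proof (intro sum.cong refl)
    fix f assume f: "f \<in> ?\<F>"
    have mD: "(\<lambda>p. ennreal \<bar>det (?Y f p)\<bar>) \<in> borel_measurable ?P"
    proof -
      note [measurable] = measP[of "\<lambda>p. p" ?P, OF measurable_ident_sets[OF refl]]
      show ?thesis by measurable
    qed
    \<comment> \<open>With u innermost, the columns p are fixed and
      \<open>nn_integral_lborel_exp_matrix\<close> applies.\<close>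
    have "(\<integral>\<^sup>+u. (\<integral>\<^sup>+p. ennreal (?T f * ?G f u p) \<partial>?P) \<partial>lborel) = (\<integral>\<^sup>+p. (\<integral>\<^sup>+u. ennreal (?T f * ?G f u p) \<partial>lborel) \<partial>?P)"
    proof (rule pair_sigma_finite.Fubini'[symmetric])
      show "pair_sigma_finite (lborel :: (real ^ 'n) measure) ?P"
        by (rule pair_sigma_finite.intro[OF sigma_finite_lborel prob_space_imp_sigma_finite[OF P.prob_space_axioms]])
      show "(\<lambda>(u, p). ennreal (?T f * ?G f u p)) \<in> borel_measurable (lborel \<Otimes>\<^sub>M ?P)"
        unfolding case_prod_beta' by (rule Gmeas) measurable
    qed
    also have "\<dots> = (\<integral>\<^sup>+p. ennreal ((2 * pi) powr (real CARD('n) / 2)) * (ennreal (?T f) * ennreal \<bar>det (?Y f p)\<bar>) \<partial>?P)"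
    proof (intro nn_integral_cong)
      fix p
      have "(\<integral>\<^sup>+u. ennreal (?T f * ?G f u p) \<partial>lborel)
          = (\<integral>\<^sup>+u. ennreal (?T f) * ennreal ((det (?Y f p))\<^sup>2) * ennreal (exp (- (norm (?Y f p *v u))\<^sup>2 / 2)) \<partial>lborel)"
        using T0[OF f] by (intro nn_integral_cong) (simp add: ennreal_mult mult_ac)
      also have "\<dots> = ennreal (?T f) * ennreal ((det (?Y f p))\<^sup>2) * (\<integral>\<^sup>+u. ennreal (exp (- (norm (?Y f p *v u))\<^sup>2 / 2)) \<partial>lborel)"
        by (rule nn_integral_cmult) (rule measurable_exp_norm_matrix)
      also have "\<dots> = ennreal (?T f) * ennreal ((2 * pi) powr (real CARD('n) / 2) * \<bar>det (?Y f p)\<bar>)"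
        by (simp only: mult.assoc nn_integral_lborel_exp_matrix)
      finally show "(\<integral>\<^sup>+u. ennreal (?T f * ?G f u p) \<partial>lborel)
          = ennreal ((2 * pi) powr (real CARD('n) / 2)) * (ennreal (?T f) * ennreal \<bar>det (?Y f p)\<bar>)"
        by (simp add: ennreal_mult mult_ac)
    qed
    also have "\<dots> = ennreal ((2 * pi) powr (real CARD('n) / 2)) * (ennreal (?T f) * (\<integral>\<^sup>+p. ennreal \<bar>det (?Y f p)\<bar> \<partial>?P))"
      by (simp only: nn_integral_cmult mD borel_measurable_times_ennreal borel_measurable_const)
    finally show "(\<integral>\<^sup>+u. (\<integral>\<^sup>+p. ennreal (?T f * ?G f u p) \<partial>?P) \<partial>lborel)
        = ennreal ((2 * pi) powr (real CARD('n) / 2)) * (ennreal (?T f) * (\<integral>\<^sup>+p. ennreal \<bar>det (?Y f p)\<bar> \<partial>?P))" .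
  qed
  also have "ennreal (1 / fact CARD('n)) * \<dots> = ennreal ((2 * pi) powr (real CARD('n) / 2) / fact CARD('n)) *
      (\<Sum>f\<in>?\<F>. ennreal (?T f) * (\<integral>\<^sup>+p. ennreal \<bar>det (?Y f p)\<bar> \<partial>?P))"
  proof -
    have c: "ennreal (1 / fact CARD('n)) * ennreal ((2 * pi) powr (real CARD('n) / 2))
        = ennreal ((2 * pi) powr (real CARD('n) / 2) / fact CARD('n))"
      by (simp add: ennreal_mult'[symmetric])
    show ?thesis
      unfolding sum_distrib_left[symmetric] c[symmetric] by (rule mult.assoc[symmetric])
  qed
  finally show ?thesis .
qed

end

section \<open>Mixed volume of ellipsoids\<close>

text \<open>As a polynomial in one variable t j, with the others fixed, it has infinitely many zeros
  on the half-line. So its coefficients vanish, and these are polynomials in one variable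
  less.\<close>

lemma polynomial_zero_coeffs:
  fixes b :: "('i \<Rightarrow> nat) \<Rightarrow> real"
  assumes "finite I"
    and "\<And>t. (\<forall>i\<in>I. t i \<ge> 0) \<Longrightarrow> (\<Sum>\<alpha>\<in>PiE I (\<lambda>_. {..D}). b \<alpha> * (\<Prod>i\<in>I. t i ^ \<alpha> i)) = 0"
    and "\<alpha> \<in> PiE I (\<lambda>_. {..D})"
  shows "b \<alpha> = 0"
  using assms
proof (induction I arbitrary: b \<alpha> rule: finite_induct)
  case empty
  then show ?case by simp
next
  case (insert j I)
  let ?E = "PiE I (\<lambda>_. {..D})"
  let ?c = "\<lambda>t d. \<Sum>\<beta>\<in>?E. b (\<beta>(j := d)) * (\<Prod>i\<in>I. t i ^ \<beta> i)"
  have split: "(\<Sum>\<alpha>\<in>PiE (insert j I) (\<lambda>_. {..D}). b \<alpha> * (\<Prod>i\<in>insert j I. (t(j := x)) i ^ \<alpha> i)) = (\<Sum>d\<le>D. ?c t d * x ^ d)"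
    for t :: "'i \<Rightarrow> real" and x :: real
  proof -
    have "(\<Sum>\<alpha>\<in>PiE (insert j I) (\<lambda>_. {..D}). b \<alpha> * (\<Prod>i\<in>insert j I. (t(j := x)) i ^ \<alpha> i))
        = (\<Sum>(d, \<beta>)\<in>{..D} \<times> ?E. b (\<beta>(j := d)) * (\<Prod>i\<in>insert j I. (t(j := x)) i ^ (\<beta>(j := d)) i))"
      unfolding PiE_insert_eq by (subst sum.reindex[OF inj_combinator[OF insert.hyps(2)]]) (simp add: case_prod_beta' comp_def)
    also have "\<dots> = (\<Sum>d\<le>D. \<Sum>\<beta>\<in>?E. b (\<beta>(j := d)) * (\<Prod>i\<in>insert j I. (t(j := x)) i ^ (\<beta>(j := d)) i))"
      by (rule sum.cartesian_product[symmetric])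
    also have "\<dots> = (\<Sum>d\<le>D. ?c t d * x ^ d)"
    proof (intro sum.cong refl)
      fix d
      have pr: "(\<Prod>i\<in>insert j I. (t(j := x)) i ^ (\<beta>(j := d)) i) = x ^ d * (\<Prod>i\<in>I. t i ^ \<beta> i)" for \<beta>
      proof -
        have "(\<Prod>i\<in>I. (t(j := x)) i ^ (\<beta>(j := d)) i) = (\<Prod>i\<in>I. t i ^ \<beta> i)"
          using insert.hyps(2) by (intro prod.cong refl) auto
        then show ?thesis using insert.hyps by (subst prod.insert) simp_all
      qed
      show "(\<Sum>\<beta>\<in>?E. b (\<beta>(j := d)) * (\<Prod>i\<in>insert j I. (t(j := x)) i ^ (\<beta>(j := d)) i)) = ?c t d * x ^ d"
        unfolding pr sum_distrib_right by (intro sum.cong refl) (simp only: mult_ac)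
    qed
    finally show ?thesis .
  qed
  have c0: "?c t d = 0" if t: "\<forall>i\<in>I. t i \<ge> 0" and d: "d \<le> D" for t d
  proof (rule ccontr)
    assume "?c t d \<noteq> 0"
    then have "finite {x. (\<Sum>d\<le>D. ?c t d * x ^ d) = 0}"
      using d polyfun_finite_roots[of "?c t" D] by blast
    moreover have "{0..} \<subseteq> {x. (\<Sum>d\<le>D. ?c t d * x ^ d) = 0}"
    proof
      fix x :: real assume "x \<in> {0..}"
      then have "\<forall>i\<in>insert j I. (t(j := x)) i \<ge> 0" using t insert.hyps by auto
      from insert.prems(1)[OF this] show "x \<in> {x. (\<Sum>d\<le>D. ?c t d * x ^ d) = 0}"
        unfolding split by simp
    qed
    ultimately have "finite {0::real..}" by (rule rev_finite_subset)
    then show False using infinite_Ici[of "0::real"] by blast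
  qed
  from insert.prems(2) obtain d \<beta> where \<alpha>: "\<alpha> = \<beta>(j := d)" "d \<le> D" "\<beta> \<in> ?E"
    unfolding PiE_insert_eq by auto
  show ?case
    unfolding \<alpha>(1) by (rule insert.IH[OF _ \<alpha>(3)]) (rule c0[OF _ \<alpha>(2)])
qed

text \<open>The description in \<open>mixed_volume\<close> leaves the degree bound free, so a rival
  representation may have another one; both are extended by zero coefficients to the larger bound
  and compared. The bound 0 is the danger: the exponent (1, ..., 1) would lie outside the summation
  range and its coefficient would be arbitrary. A constant volume, which \<open>nonconst\<close>
  excludes, is the only case that allows it.\<close>

lemma mixed_volume_eqI:
  fixes K :: "nat \<Rightarrow> (real ^ 'n::finite) set" and a :: "(nat \<Rightarrow> nat) \<Rightarrow> real"
  assumes D: "D > 0"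
    and vol: "\<And>t. (\<forall>i<CARD('n). t i \<ge> 0) \<Longrightarrow> measure lebesgue (mink_comb CARD('n) t K)
        = (\<Sum>\<alpha>\<in>PiE {..<CARD('n)} (\<lambda>_. {..D}). a \<alpha> * (\<Prod>i<CARD('n). t i ^ \<alpha> i))"
    and nonconst: "measure lebesgue (mink_comb CARD('n) (\<lambda>_. 0) K) \<noteq> measure lebesgue (mink_comb CARD('n) (\<lambda>_. 1) K)"
  shows "mixed_volume K = a (restrict (\<lambda>_. 1) {..<CARD('n)}) / fact CARD('n)"
  unfolding mixed_volume_def
proof (rule the_equality)
  let ?m = "CARD('n)"
  let ?one = "restrict (\<lambda>_. 1) {..<?m} :: nat \<Rightarrow> nat"
  show "\<exists>(D::nat) (b :: (nat \<Rightarrow> nat) \<Rightarrow> real). (\<forall>t. (\<forall>i<?m. t i \<ge> 0) \<longrightarrow> measure lebesgue (mink_comb ?m t K)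
      = (\<Sum>\<alpha>\<in>PiE {..<?m} (\<lambda>_. {..D}). b \<alpha> * (\<Prod>i<?m. t i ^ \<alpha> i))) \<and> a ?one / fact ?m = b ?one / fact ?m"
    using vol by blast
  fix v
  assume "\<exists>(D::nat) (a :: (nat \<Rightarrow> nat) \<Rightarrow> real). (\<forall>t. (\<forall>i<?m. t i \<ge> 0) \<longrightarrow> measure lebesgue (mink_comb ?m t K)
      = (\<Sum>\<alpha>\<in>PiE {..<?m} (\<lambda>_. {..D}). a \<alpha> * (\<Prod>i<?m. t i ^ \<alpha> i))) \<and> v = a ?one / fact ?m"
  then obtain D' a' where vol': "\<And>t. (\<forall>i<?m. t i \<ge> 0) \<Longrightarrow> measure lebesgue (mink_comb ?m t K)
      = (\<Sum>\<alpha>\<in>PiE {..<?m} (\<lambda>_. {..D'}). a' \<alpha> * (\<Prod>i<?m. t i ^ \<alpha> i))" and v: "v = a' ?one / fact ?m"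
    by blast
  have D': "D' > 0"
  proof (rule ccontr)
    assume "\<not> D' > 0"
    then have "D' = 0" by simp
    then have "measure lebesgue (mink_comb ?m t K) = (\<Sum>\<alpha>\<in>PiE {..<?m} (\<lambda>_. {..0}). a' \<alpha>)" if "\<forall>i<?m. t i \<ge> 0" for t
      using vol'[OF that] by (auto intro!: sum.cong simp: PiE_iff)
    from this[of "\<lambda>_. 0"] this[of "\<lambda>_. 1"] nonconst show False by simp
  qed
  define E where "E = max D D'"
  have ext: "(\<Sum>\<alpha>\<in>PiE {..<?m} (\<lambda>_. {..d}). a \<alpha> * (\<Prod>i<?m. t i ^ \<alpha> i))
      = (\<Sum>\<alpha>\<in>PiE {..<?m} (\<lambda>_. {..E}). (if \<alpha> \<in> PiE {..<?m} (\<lambda>_. {..d}) then a \<alpha> else 0) * (\<Prod>i<?m. t i ^ \<alpha> i))"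
    if "d \<le> E" for d and a :: "(nat \<Rightarrow> nat) \<Rightarrow> real" and t :: "nat \<Rightarrow> real"
  proof -
    have "PiE {..<?m} (\<lambda>_. {..d}) \<subseteq> PiE {..<?m} (\<lambda>_. {..E})"
      using that by (intro PiE_mono) auto
    then show ?thesis
      by (intro sum.mono_neutral_cong_left) (auto intro!: finite_PiE)
  qed
  let ?b = "\<lambda>\<alpha>. (if \<alpha> \<in> PiE {..<?m} (\<lambda>_. {..D}) then a \<alpha> else 0) - (if \<alpha> \<in> PiE {..<?m} (\<lambda>_. {..D'}) then a' \<alpha> else 0)"
  have "?b ?one = 0"
  proof (rule polynomial_zero_coeffs[where I = "{..<?m}" and D = E and b = ?b and \<alpha> = ?one])
    fix t :: "nat \<Rightarrow> real" assume t: "\<forall>i\<in>{..<?m}. t i \<ge> 0"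
    then have t': "\<forall>i<?m. t i \<ge> 0" by simp
    show "(\<Sum>\<alpha>\<in>PiE {..<?m} (\<lambda>_. {..E}). ?b \<alpha> * (\<Prod>i<?m. t i ^ \<alpha> i)) = 0"
      unfolding left_diff_distrib sum_subtractf
      using vol[OF t'] vol'[OF t'] ext[of D a t] ext[of D' a' t] by (simp add: E_def)
  qed (use D in \<open>auto simp: E_def\<close>)
  moreover have "?one \<in> PiE {..<?m} (\<lambda>_. {..d})" if "d > 0" for d using that by auto
  ultimately show "v = a ?one / fact ?m"
    using D D' by (simp add: v)
qed

lemma card_bij_betw_lessThan: "card {f :: 'n::finite \<Rightarrow> nat. bij_betw f UNIV {..<CARD('n)}} = fact CARD('n)"
proof -
  obtain e :: "'n \<Rightarrow> nat" where e: "bij_betw e UNIV {..<CARD('n)}" using ex_bij_index by blast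
  have "bij_betw (\<lambda>\<sigma>. e \<circ> \<sigma>) {\<sigma>. \<sigma> permutes (UNIV :: 'n set)} {f. bij_betw f UNIV {..<CARD('n)}}"
  proof (rule bij_betwI[where g = "\<lambda>f. inv_into UNIV e \<circ> f"])
    show "(\<lambda>\<sigma>. e \<circ> \<sigma>) \<in> {\<sigma>. \<sigma> permutes (UNIV :: 'n set)} \<rightarrow> {f. bij_betw f UNIV {..<CARD('n)}}"
      using e by (auto intro: bij_betw_trans permutes_imp_bij)
    show "(\<lambda>f. inv_into UNIV e \<circ> f) \<in> {f. bij_betw f UNIV {..<CARD('n)}} \<rightarrow> {\<sigma>. \<sigma> permutes (UNIV :: 'n set)}"
      using bij_betw_inv_into[OF e] by (auto intro!: bij_imp_permutes intro: bij_betw_trans)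
    show "inv_into UNIV e \<circ> (e \<circ> \<sigma>) = \<sigma>" for \<sigma>
      using e by (auto simp: fun_eq_iff bij_betw_def inv_into_f_f)
    show "e \<circ> (inv_into UNIV e \<circ> f) = f" if "f \<in> {f. bij_betw f UNIV {..<CARD('n)}}" for f
    proof
      fix a
      have "f a \<in> range e" using e that by (auto simp: bij_betw_def)
      then show "(e \<circ> (inv_into UNIV e \<circ> f)) a = f a" by (simp add: f_inv_into_f)
    qed
  qed
  then show ?thesis
    using bij_betw_same_card card_permutations[of "UNIV :: 'n set" "CARD('n)"] by fastforce
qed

text \<open>The columns are independent and identically distributed, so relabelling them along
  \<open>f\<close> does not change the law, and |det| is the square root of the Gram determinant.
  The value is therefore the same for every bijection.\<close>

lemma nn_integral_det_bij:
  fixes A :: "nat \<Rightarrow> real ^ 'n::finite ^ 'n" and f :: "'n \<Rightarrow> nat"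
  assumes f: "bij_betw f UNIV {..<CARD('n)}"
  shows "(\<integral>\<^sup>+p. ennreal \<bar>det (\<chi> a. A (f a) *v p a)\<bar> \<partial>gauss_family UNIV)
    = (\<integral>\<^sup>+\<omega>. ennreal (gvol CARD('n) (\<lambda>i. A i *v \<omega> i)) \<partial>gauss_family {..<CARD('n)})"
proof -
  let ?P = "gauss_family UNIV :: ('n \<Rightarrow> real ^ 'n) measure" and ?Q = "gauss_family {..<CARD('n)} :: (nat \<Rightarrow> real ^ 'n) measure"
  have inj: "inj_on f UNIV" and ran: "f \<in> UNIV \<rightarrow> {..<CARD('n)}"
    using f by (auto simp: bij_betw_def)
  have distr: "distr ?Q ?P (\<lambda>\<omega>. \<lambda>n\<in>UNIV. \<omega> (f n)) = ?P"
    by (rule distr_PiM_reindex[OF prob_space_std_gauss inj ran])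
  have [measurable]: "(\<lambda>p. p a) \<in> borel_measurable ?P" for a
  proof -
    have "(\<lambda>p. p a) \<in> ?P \<rightarrow>\<^sub>M std_gauss" by (rule measurable_component_singleton) simp
    then show ?thesis by (simp only: measurable_cong_sets[OF refl sets_std_gauss])
  qed
  have md: "(\<lambda>p. ennreal \<bar>det (\<chi> a. A (f a) *v p a)\<bar>) \<in> borel_measurable ?P" by measurable
  have mr: "(\<lambda>\<omega>. \<lambda>n\<in>UNIV. \<omega> (f n)) \<in> ?Q \<rightarrow>\<^sub>M ?P"
    using ran by (intro measurable_restrict measurable_component_singleton) auto
  have "(\<integral>\<^sup>+p. ennreal \<bar>det (\<chi> a. A (f a) *v p a)\<bar> \<partial>?P)
      = (\<integral>\<^sup>+\<omega>. ennreal \<bar>det (\<chi> a. A (f a) *v (\<lambda>n\<in>UNIV. \<omega> (f n)) a)\<bar> \<partial>?Q)"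
    by (subst distr[symmetric], rule nn_integral_distr[OF mr]) (simp only: measurable_distr_eq1 md)
  also have "\<dots> = (\<integral>\<^sup>+\<omega>. ennreal (gvol CARD('n) (\<lambda>i. A i *v \<omega> i)) \<partial>?Q)"
    by (intro nn_integral_cong) (simp add: gvol_def gram_det_eq_det_square[OF f])
  finally show ?thesis .
qed

text \<open>Supplies \<open>nonconst\<close> in \<open>mixed_volume_eqI\<close>: with all but the
  first point taken to be 0, the sum contains the open image of a ball under
  \<open>A 0\<close>.\<close>

lemma measure_mink_comb_one_pos:
  fixes A :: "nat \<Rightarrow> real ^ 'n::finite ^ 'n"
  assumes inv: "\<And>i. i < CARD('n) \<Longrightarrow> invertible (A i)"
  shows "measure lebesgue (mink_comb CARD('n) (\<lambda>_. 1) (\<lambda>i. (*v) (A i) ` cball 0 1)) \<noteq> 0"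
proof
  let ?K = "mink_comb CARD('n) (\<lambda>_. 1) (\<lambda>i. (*v) (A i) ` cball 0 1)"
  assume z: "measure lebesgue ?K = 0"
  have lm: "?K \<in> lmeasurable"
    unfolding mink_comb_ellipsoids
    by (intro measurable_convex convex_ell_sum bounded_ell_sum inv) auto
  then have neg: "negligible ?K" using z by (simp add: negligible_iff_measure0)
  obtain B where B: "A 0 ** B = mat 1" "B ** A 0 = mat 1" using inv[of 0] by (auto simp: invertible_def)
  have AB: "A 0 *v (B *v x) = x" for x by (simp add: matrix_vector_mul_assoc B)
  let ?U = "(*v) B -` ball 0 1"
  have "open ?U"
    by (intro open_vimage open_ball matrix_vector_mult_linear_continuous_on)
  moreover have "?U \<noteq> {}"
  proof -
    have "0 \<in> ?U" by simp
    then show ?thesis by blast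
  qed
  moreover have "?U \<subseteq> ?K"
  proof
    fix x assume x: "x \<in> ?U"
    have "x = (\<Sum>i<CARD('n). 1 *\<^sub>R (A i *v (if i = 0 then B *v x else 0)))"
      by (simp add: if_distrib[of "\<lambda>y. _ *v y"] AB cong: if_cong)
    then show "x \<in> ?K"
      unfolding mink_comb_ellipsoids using x by (intro image_eqI[of _ _ "\<lambda>i. if i = 0 then B *v x else 0"]) auto
  qed
  ultimately show False
    using negligible_subset[OF neg] open_not_negligible by blast
qed

text \<open>The maps \<open>f\<close> in the volume formula that contribute to the monomial with all
  exponents 1 are the bijections. There are m! of them, each with integral \<open>W\<close>, and
  this count cancels the division by m! in \<open>mixed_volume\<close>.\<close>

theorem mixed_volume_ellipsoids:
  fixes A :: "nat \<Rightarrow> real ^ 'n::finite ^ 'n"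
  assumes inv: "\<And>i. i < CARD('n) \<Longrightarrow> invertible (A i)"
  defines "W \<equiv> (\<integral>\<^sup>+\<omega>. ennreal (gvol CARD('n) (\<lambda>i. A i *v \<omega> i)) \<partial>gauss_family {..<CARD('n)})"
  shows "W < \<infinity>"
    and "mixed_volume (\<lambda>i. (*v) (A i) ` cball 0 1) = (2 * pi) powr (real CARD('n) / 2) / fact CARD('n) * enn2real W"
proof -
  let ?m = "CARD('n)" and ?K = "\<lambda>i. (*v) (A i) ` cball (0 :: real ^ 'n) 1"
  let ?c = "(2 * pi) powr (real ?m / 2) / fact ?m"
  let ?F = "PiE (UNIV :: 'n set) (\<lambda>_. {..<?m})"
  have c: "?c > 0" by simp
  have finF: "finite ?F" by (intro finite_PiE) auto
  define I where "I f = (\<integral>\<^sup>+p. ennreal \<bar>det (\<chi> a. A (f a) *v p a)\<bar> \<partial>gauss_family UNIV)" for f :: "'n \<Rightarrow> nat"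
  have vol: "ennreal (measure lebesgue (mink_comb ?m t ?K)) = ennreal ?c * (\<Sum>f\<in>?F. ennreal (\<Prod>a\<in>UNIV. t (f a)) * I f)"
    if "\<forall>i<?m. t i \<ge> 0" for t
    unfolding mink_comb_ellipsoids I_def
    by (rule emeasure_ell_sum) (use inv that in auto)
  \<comment> \<open>At t = 1 every \<open>f\<close> has weight 1, and the volume is a real number,
    so each summand is finite.\<close>
  have fin: "I f < \<infinity>" if f: "f \<in> ?F" for f
  proof -
    have eq: "ennreal (measure lebesgue (mink_comb ?m (\<lambda>_. 1) ?K)) = ennreal ?c * (\<Sum>f\<in>?F. I f)"
      using vol[of "\<lambda>_. 1"] by simp
    have "ennreal ?c * (\<Sum>f\<in>?F. I f) < \<infinity>"
      unfolding eq[symmetric] by simp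
    then have "(\<Sum>f\<in>?F. I f) < \<infinity>"
      using c by (auto simp: ennreal_mult_less_top)
    then show ?thesis using finF f by (simp add: less_top)
  qed
  define r where "r f = enn2real (I f)" for f
  have Ir: "I f = ennreal (r f)" if "f \<in> ?F" for f
    using fin[OF that] by (simp add: r_def less_top)
  have r0: "r f \<ge> 0" for f by (simp add: r_def)
  have IW: "I f = W" if "bij_betw f UNIV {..<?m}" for f
    unfolding I_def W_def by (rule nn_integral_det_bij[OF that])
  obtain e :: "'n \<Rightarrow> nat" where e: "bij_betw e UNIV {..<?m}" using ex_bij_index by blast
  have "e \<in> ?F" using e by (auto simp: bij_betw_def)
  then show Wfin: "W < \<infinity>" using fin[of e] IW[OF e] by simp
  have volr: "measure lebesgue (mink_comb ?m t ?K) = (\<Sum>f\<in>?F. ?c * r f * (\<Prod>a\<in>UNIV. t (f a)))" if t: "\<forall>i<?m. t i \<ge> 0" for t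
  proof -
    have T0: "(\<Prod>a\<in>UNIV. t (f a)) \<ge> 0" if "f \<in> ?F" for f
      using that t by (intro prod_nonneg) (auto simp: PiE_iff)
    have "(\<Sum>f\<in>?F. ennreal (\<Prod>a\<in>UNIV. t (f a)) * I f) = (\<Sum>f\<in>?F. ennreal ((\<Prod>a\<in>UNIV. t (f a)) * r f))"
      by (intro sum.cong refl) (simp only: Ir ennreal_mult T0 r0)
    also have "\<dots> = ennreal (\<Sum>f\<in>?F. (\<Prod>a\<in>UNIV. t (f a)) * r f)"
      using T0 r0 by (intro sum_ennreal mult_nonneg_nonneg)
    finally have "ennreal (measure lebesgue (mink_comb ?m t ?K)) = ennreal (?c * (\<Sum>f\<in>?F. (\<Prod>a\<in>UNIV. t (f a)) * r f))"
      using vol[OF t] c by (simp only: ennreal_mult'[OF less_imp_le[OF c]])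
    moreover have "?c * (\<Sum>f\<in>?F. (\<Prod>a\<in>UNIV. t (f a)) * r f) \<ge> 0"
      by (rule mult_nonneg_nonneg[OF less_imp_le[OF c]], intro sum_nonneg mult_nonneg_nonneg T0 r0)
    ultimately have "measure lebesgue (mink_comb ?m t ?K) = ?c * (\<Sum>f\<in>?F. (\<Prod>a\<in>UNIV. t (f a)) * r f)"
      by (simp only: ennreal_inj measure_nonneg)
    then have "measure lebesgue (mink_comb ?m t ?K) = (\<Sum>f\<in>?F. ?c * ((\<Prod>a\<in>UNIV. t (f a)) * r f))"
      by (simp only: sum_distrib_left)
    then show ?thesis by (simp only: mult_ac)
  qed
  \<comment> \<open>The exponent vector of the monomial of \<open>f\<close>: it counts how often
    \<open>f\<close> takes each value.\<close>
  define \<epsilon> where "\<epsilon> f = restrict (\<lambda>i. card {a. f a = i}) {..<?m}" for f :: "'n \<Rightarrow> nat"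
  let ?E = "PiE {..<?m} (\<lambda>_. {..?m})"
  have \<epsilon>E: "\<epsilon> f \<in> ?E" for f
    by (auto simp: \<epsilon>_def intro!: card_mono)
  define a where "a \<alpha> = (\<Sum>f\<in>{f \<in> ?F. \<epsilon> f = \<alpha>}. ?c * r f)" for \<alpha>
  have poly: "measure lebesgue (mink_comb ?m t ?K) = (\<Sum>\<alpha>\<in>?E. a \<alpha> * (\<Prod>i<?m. t i ^ \<alpha> i))" if t: "\<forall>i<?m. t i \<ge> 0" for t
  proof -
    have mono: "(\<Prod>a\<in>UNIV. t (f a)) = (\<Prod>i<?m. t i ^ \<epsilon> f i)" if "f \<in> ?F" for f
    proof -
      have "(\<Prod>a\<in>UNIV. t (f a)) = (\<Prod>i<?m. \<Prod>a\<in>{a \<in> UNIV. f a = i}. t (f a))"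
        using that by (intro prod.group[symmetric]) (auto simp: PiE_iff)
      also have "\<dots> = (\<Prod>i<?m. t i ^ \<epsilon> f i)"
        by (intro prod.cong refl) (simp add: \<epsilon>_def)
      finally show ?thesis .
    qed
    have "measure lebesgue (mink_comb ?m t ?K) = (\<Sum>f\<in>?F. ?c * r f * (\<Prod>i<?m. t i ^ \<epsilon> f i))"
      unfolding volr[OF t] by (intro sum.cong refl) (simp only: mono)
    also have "\<dots> = (\<Sum>\<alpha>\<in>?E. \<Sum>f\<in>{f \<in> ?F. \<epsilon> f = \<alpha>}. ?c * r f * (\<Prod>i<?m. t i ^ \<epsilon> f i))"
      using finF \<epsilon>E by (intro sum.group[symmetric]) (auto intro!: finite_PiE)
    also have "\<dots> = (\<Sum>\<alpha>\<in>?E. a \<alpha> * (\<Prod>i<?m. t i ^ \<alpha> i))"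
      unfolding a_def sum_distrib_right by (intro sum.cong refl) auto
    finally show ?thesis .
  qed
  have "mixed_volume ?K = a (restrict (\<lambda>_. 1) {..<?m}) / fact ?m"
  proof (rule mixed_volume_eqI[where D = ?m])
    have "measure lebesgue (mink_comb ?m (\<lambda>_. 0) ?K) = 0"
      using volr[of "\<lambda>_. 0"] by (simp add: power_0_left)
    then show "measure lebesgue (mink_comb ?m (\<lambda>_. 0) ?K) \<noteq> measure lebesgue (mink_comb ?m (\<lambda>_. 1) ?K)"
      using measure_mink_comb_one_pos[of A] inv by simp
  qed (use poly in auto)
  also have "a (restrict (\<lambda>_. 1) {..<?m}) = fact ?m * (?c * enn2real W)"
  proof -
    have set: "{f \<in> ?F. \<epsilon> f = restrict (\<lambda>_. 1) {..<?m}} = {f. bij_betw f UNIV {..<?m}}"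
    proof (intro set_eqI iffI)
      fix f :: "'n \<Rightarrow> nat" assume f: "f \<in> {f \<in> ?F. \<epsilon> f = restrict (\<lambda>_. 1) {..<?m}}"
      then have fF: "\<And>a. f a < ?m" by (auto simp: PiE_iff)
      have card1: "card {a. f a = i} = 1" if "i < ?m" for i
      proof -
        have "\<epsilon> f = restrict (\<lambda>_. 1) {..<?m}" using f by simp
        from fun_cong[OF this, of i] show ?thesis using that by (simp add: \<epsilon>_def)
      qed
      have inj: "inj f"
      proof (rule injI)
        fix a b assume ab: "f a = f b"
        obtain x where x: "{a'. f a' = f a} = {x}" using card1[OF fF[of a]] by (auto simp: card_1_singleton_iff)
        have "a \<in> {a'. f a' = f a}" "b \<in> {a'. f a' = f a}" using ab by auto
        then show "a = b" unfolding x by simp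
      qed
      have "range f \<subseteq> {..<?m}" using fF by auto
      moreover have "card (range f) = ?m" using inj by (simp add: card_image)
      ultimately have "range f = {..<?m}" by (intro card_subset_eq) auto
      then show "f \<in> {f. bij_betw f UNIV {..<?m}}" using inj by (simp add: bij_betw_def)
    next
      fix f :: "'n \<Rightarrow> nat" assume "f \<in> {f. bij_betw f UNIV {..<?m}}"
      then have inj: "inj f" and ran: "range f = {..<?m}" by (auto simp: bij_betw_def)
      have "card {a. f a = i} = 1" if "i < ?m" for i
      proof -
        have "i \<in> range f" using ran that by simp
        then obtain x where x: "f x = i" by auto
        have "{a. f a = i} = {x}" using x inj by (auto simp: inj_def)
        then show ?thesis by simp
      qed
      then have "\<epsilon> f = restrict (\<lambda>_. 1) {..<?m}" by (auto simp: \<epsilon>_def restrict_def fun_eq_iff)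
      then show "f \<in> {f \<in> ?F. \<epsilon> f = restrict (\<lambda>_. 1) {..<?m}}" using ran by auto
    qed
    have "a (restrict (\<lambda>_. 1) {..<?m}) = (\<Sum>f\<in>{f :: 'n \<Rightarrow> nat. bij_betw f UNIV {..<?m}}. ?c * enn2real W)"
      unfolding a_def set by (intro sum.cong refl) (simp add: r_def IW)
    then show ?thesis by (simp add: card_bij_betw_lessThan)
  qed
  finally show "mixed_volume ?K = ?c * enn2real W" by simp
qed

section \<open>Exchanging columns\<close>

text \<open>The determinant is linear in column j; \<open>w\<close> is the vector of cofactors, the
  generalised cross product of the other columns.\<close>

lemma gvol_eq_abs_inner:
  fixes z :: "nat \<Rightarrow> real ^ 'n::finite"
  assumes j: "j < CARD('n)"
  obtains w where "\<And>v. gvol CARD('n) (z(j := v)) = \<bar>v \<bullet> w\<bar>"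
proof -
  obtain f :: "'n \<Rightarrow> nat" where f: "bij_betw f UNIV {..<CARD('n)}" using ex_bij_index by blast
  obtain b where b: "f b = j" using f j by (metis bij_betw_iff_bijections lessThan_iff)
  have fb: "f a = j \<longleftrightarrow> a = b" for a using f b by (auto simp: bij_betw_def inj_on_def)
  define w :: "real ^ 'n" where "w = (\<chi> i. det (\<chi> a. if a = b then axis i 1 else z (f a)))"
  have "det (\<chi> a. (z(j := v)) (f a)) = v \<bullet> w" for v
  proof -
    have "v = (\<Sum>i\<in>UNIV. v $ i *s axis i 1)" by (simp add: basis_expansion)
    then have "det (\<chi> a. (z(j := v)) (f a)) = det (\<chi> a. if a = b then (\<Sum>i\<in>UNIV. v $ i *s axis i 1) else z (f a))"
      by (simp add: fb cong: if_cong)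
    also have "\<dots> = (\<Sum>i\<in>UNIV. det (\<chi> a. if a = b then v $ i *s axis i 1 else z (f a)))"
      by (rule det_linear_row_sum[OF finite, where a = "\<lambda>_ i. v $ i *s axis i 1"])
    also have "\<dots> = (\<Sum>i\<in>UNIV. v $ i * w $ i)"
      unfolding w_def vec_lambda_beta by (intro sum.cong refl) (rule det_row_mul)
    finally show ?thesis by (simp add: inner_vec_def)
  qed
  then have "gvol CARD('n) (z(j := v)) = \<bar>v \<bullet> w\<bar>" for v
    by (simp only: gvol_def gram_det_eq_det_square[OF f] real_sqrt_abs)
  then show thesis by (rule that)
qed

lemma measurable_gvol_family:
  fixes g :: "nat \<Rightarrow> real ^ 'n \<Rightarrow> real ^ 'n::finite"
  assumes "\<And>i. i < k \<Longrightarrow> g i \<in> borel_measurable borel" and "k \<le> l"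
  shows "(\<lambda>\<omega>. gvol k (\<lambda>i. g i (\<omega> i))) \<in> borel_measurable (gauss_family {..<l})"
proof (rule measurable_gvol)
  fix i assume i: "i < k"
  have "(\<lambda>\<omega>. \<omega> i) \<in> gauss_family {..<l} \<rightarrow>\<^sub>M (std_gauss :: (real ^ 'n) measure)"
    using i assms(2) by (intro measurable_component_singleton) simp
  moreover have "g i \<in> borel_measurable std_gauss" using assms(1)[OF i] by simp
  ultimately show "(\<lambda>\<omega>. g i (\<omega> i)) \<in> borel_measurable (gauss_family {..<l})" by (rule measurable_compose)
qed

text \<open>Column j is integrated innermost, where the volume is |v . w| with \<open>w\<close>
  depending only on the other columns. The factor \<open>C\<close> serves both directions of the
  exchange: it is 1 for the upper bound and \<open>b_inf\<close> for the lower one.\<close>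

lemma nn_integral_gvol_replace:
  fixes g g' :: "nat \<Rightarrow> real ^ 'n \<Rightarrow> real ^ 'n::finite"
  assumes j: "j < CARD('n)"
    and g: "\<And>i. i < CARD('n) \<Longrightarrow> g i \<in> borel_measurable borel"
    and g': "\<And>i. i < CARD('n) \<Longrightarrow> g' i \<in> borel_measurable borel"
    and eq: "\<And>i. i \<noteq> j \<Longrightarrow> g i = g' i"
    and le: "\<And>w. C * (\<integral>\<^sup>+x. ennreal \<bar>g j x \<bullet> w\<bar> \<partial>std_gauss) \<le> (\<integral>\<^sup>+x. ennreal \<bar>g' j x \<bullet> w\<bar> \<partial>std_gauss)"
  shows "C * (\<integral>\<^sup>+\<omega>. ennreal (gvol CARD('n) (\<lambda>i. g i (\<omega> i))) \<partial>gauss_family {..<CARD('n)})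
    \<le> (\<integral>\<^sup>+\<omega>. ennreal (gvol CARD('n) (\<lambda>i. g' i (\<omega> i))) \<partial>gauss_family {..<CARD('n)})"
proof -
  let ?m = "CARD('n)" and ?J = "{..<CARD('n)} - {j}"
  have ins: "{..<?m} = insert j ?J" using j by auto
  let ?Q = "gauss_family ?J :: (nat \<Rightarrow> real ^ 'n) measure"
  have split: "(\<integral>\<^sup>+\<omega>. ennreal (gvol ?m (\<lambda>i. h i (\<omega> i))) \<partial>gauss_family {..<?m})
      = (\<integral>\<^sup>+\<omega>. (\<integral>\<^sup>+y. ennreal (gvol ?m (fun_upd (\<lambda>i. h i (\<omega> i)) j (h j y))) \<partial>std_gauss) \<partial>?Q)"
    and meas: "(\<lambda>\<omega>. \<integral>\<^sup>+y. ennreal (gvol ?m (fun_upd (\<lambda>i. h i (\<omega> i)) j (h j y))) \<partial>std_gauss) \<in> borel_measurable ?Q"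
    if h: "\<forall>i<?m. h i \<in> borel_measurable borel" for h :: "nat \<Rightarrow> real ^ 'n \<Rightarrow> real ^ 'n"
  proof -
    have m: "(\<lambda>\<omega>. ennreal (gvol ?m (\<lambda>i. h i (\<omega> i)))) \<in> borel_measurable (gauss_family {..<?m})"
      using measurable_gvol_family[of ?m h ?m] h by simp
    have upd: "(\<lambda>i. h i (fun_upd \<omega> j y i)) = fun_upd (\<lambda>i. h i (\<omega> i)) j (h j y)" for \<omega> y by auto
    show "(\<integral>\<^sup>+\<omega>. ennreal (gvol ?m (\<lambda>i. h i (\<omega> i))) \<partial>gauss_family {..<?m})
        = (\<integral>\<^sup>+\<omega>. (\<integral>\<^sup>+y. ennreal (gvol ?m (fun_upd (\<lambda>i. h i (\<omega> i)) j (h j y))) \<partial>std_gauss) \<partial>?Q)"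
      using gauss_family.product_nn_integral_insert[of ?J j "\<lambda>\<omega>. ennreal (gvol ?m (\<lambda>i. h i (\<omega> i)))"] m
      unfolding ins[symmetric] upd by simp
    have "(\<lambda>(\<omega>, y). ennreal (gvol ?m (fun_upd (\<lambda>i. h i (\<omega> i)) j (h j y)))) \<in> borel_measurable (?Q \<Otimes>\<^sub>M std_gauss)"
    proof -
      have "(\<lambda>(\<omega>, y). fun_upd \<omega> j y) \<in> ?Q \<Otimes>\<^sub>M (std_gauss :: (real ^ 'n) measure) \<rightarrow>\<^sub>M gauss_family {..<?m}"
        using measurable_add_dim[of j ?J "\<lambda>_. std_gauss :: (real ^ 'n) measure"] by (simp only: ins[symmetric])
      from measurable_compose[OF this m] show ?thesis by (simp only: case_prod_beta' upd)
    qed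
    then show "(\<lambda>\<omega>. \<integral>\<^sup>+y. ennreal (gvol ?m (fun_upd (\<lambda>i. h i (\<omega> i)) j (h j y))) \<partial>std_gauss) \<in> borel_measurable ?Q"
      by (rule std_gauss.borel_measurable_nn_integral)
  qed
  have gA: "\<forall>i<?m. g i \<in> borel_measurable borel" "\<forall>i<?m. g' i \<in> borel_measurable borel"
    using g g' by auto
  have "C * (\<integral>\<^sup>+\<omega>. ennreal (gvol ?m (\<lambda>i. g i (\<omega> i))) \<partial>gauss_family {..<?m})
      = (\<integral>\<^sup>+\<omega>. C * (\<integral>\<^sup>+y. ennreal (gvol ?m (fun_upd (\<lambda>i. g i (\<omega> i)) j (g j y))) \<partial>std_gauss) \<partial>?Q)"
    unfolding split[OF gA(1)] by (rule nn_integral_cmult[symmetric]) (rule meas[OF gA(1)])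
  also have "\<dots> \<le> (\<integral>\<^sup>+\<omega>. (\<integral>\<^sup>+y. ennreal (gvol ?m (fun_upd (\<lambda>i. g' i (\<omega> i)) j (g' j y))) \<partial>std_gauss) \<partial>?Q)"
  proof (rule nn_integral_mono)
    fix \<omega>
    obtain w where w: "\<And>v. gvol ?m (fun_upd (\<lambda>i. g i (\<omega> i)) j (v)) = \<bar>v \<bullet> w\<bar>"
      by (rule gvol_eq_abs_inner[OF j, of "\<lambda>i. g i (\<omega> i)"]) (rule that)
    have "fun_upd (\<lambda>i. g' i (\<omega> i)) j (v) = fun_upd (\<lambda>i. g i (\<omega> i)) j (v)" for v
      using eq by (auto simp: fun_eq_iff)
    then show "C * (\<integral>\<^sup>+y. ennreal (gvol ?m (fun_upd (\<lambda>i. g i (\<omega> i)) j (g j y))) \<partial>std_gauss)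
        \<le> (\<integral>\<^sup>+y. ennreal (gvol ?m (fun_upd (\<lambda>i. g' i (\<omega> i)) j (g' j y))) \<partial>std_gauss)"
      using le[of w] by (simp only: w)
  qed
  also have "\<dots> = (\<integral>\<^sup>+\<omega>. ennreal (gvol ?m (\<lambda>i. g' i (\<omega> i))) \<partial>gauss_family {..<?m})"
    by (rule split[OF gA(2), symmetric])
  finally show ?thesis .
qed

lemma linear_Tmap: "linear (Tmap c)"
proof (rule linearI)
  show "Tmap c (x + y) = Tmap c x + Tmap c y" for x y
    by (simp add: Tmap_def inner_add_left add_divide_distrib distrib_left scaleR_add_left)
  show "Tmap c (r *\<^sub>R x) = r *\<^sub>R Tmap c x" for r x
    by (simp add: Tmap_def scaleR_add_right mult.left_commute)
qed

text \<open>Since lam is at least 1, \<open>Tmap c\<close> never shortens a vector, so its kernel is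
  trivial.\<close>

lemma invertible_matrix_Tmap: "invertible (matrix (Tmap (c :: real ^ 'n::finite)))"
  unfolding invertible_left_inverse matrix_left_invertible_ker
proof (intro allI impI)
  fix x :: "real ^ 'n" assume "matrix (Tmap c) *v x = 0"
  then have T: "Tmap c x = 0" by (simp add: fun_cong[OF matrix_vector_mul(2)[OF linear_Tmap]])
  show "x = 0"
  proof (cases "c = 0")
    case True
    then show ?thesis using T by (simp add: Tmap_def)
  next
    case False
    have "1 \<le> (lam (norm c))\<^sup>2" using lam_ge_1[of "norm c"] by (simp add: one_le_power)
    then have "((lam (norm c))\<^sup>2 - 1) * (x \<bullet> c)\<^sup>2 / (norm c)\<^sup>2 \<ge> 0" by simp
    then have "(norm x)\<^sup>2 \<le> (norm (Tmap c x))\<^sup>2" unfolding norm_Tmap_square[OF False] by simp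
    then show ?thesis using T by simp
  qed
qed

theorem theorem3p2:
  fixes P :: "'a measure" and k :: nat
    and Mi :: "nat \<Rightarrow> real ^ 'n ^ 'n" and c :: "nat \<Rightarrow> real ^ 'n::finite"
    and \<xi> :: "nat \<Rightarrow> 'a \<Rightarrow> real ^ 'n"
  assumes "prob_space P"
    and "0 < k" and "k \<le> CARD('n)"
    and "\<And>i. i < k \<Longrightarrow> invertible (Mi i)"
    and "prob_space.indep_vars P (\<lambda>_. borel) \<xi> {..<k}"
    and "\<And>i. i < k \<Longrightarrow> distributed P lborel (\<xi> i)
           (\<lambda>x. ennreal ((2 * pi) powr (- real CARD('n) / 2) * exp (- (norm x ^ 2) / 2)))"
  defines "X \<equiv> (\<lambda>i \<omega>. Mi i *v (c i + \<xi> i \<omega>))"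
    and "MV \<equiv> mixed_volume (\<lambda>i. if i < k then (\<lambda>x. Mi i *v Tmap (c i) x) ` cball 0 1
                                      else cball 0 1)"
  shows "b_inf ^ k * alpha_mk CARD('n) k * MV
           \<le> prob_space.expectation P (\<lambda>\<omega>. sqrt (det_k k (\<lambda>i j. X i \<omega> \<bullet> X j \<omega>)))
       \<and> prob_space.expectation P (\<lambda>\<omega>. sqrt (det_k k (\<lambda>i j. X i \<omega> \<bullet> X j \<omega>)))
           \<le> alpha_mk CARD('n) k * MV"
proof -
  interpret P: prob_space P by fact
  note k = assms(2,3) and inv = assms(4) and indep = assms(5) and dist = assms(6)
  let ?m = "CARD('n)"
  define A where "A i = (if i < k then Mi i ** matrix (Tmap (c i)) else mat 1)" for i
  \<comment> \<open>Hybrid families: the first j columns are shifted Gaussians, the later ones are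
    images under \<open>A i\<close>. For j = 0 this is the mixed volume side, and for j = k it is
    the random matrix padded with plain Gaussian columns.\<close>
  define h where "h j i = (if i < j then (\<lambda>x. Mi i *v (c i + x)) else (\<lambda>x. A i *v x))" for j i :: nat
  define H where "H j = (\<integral>\<^sup>+\<omega>. ennreal (gvol ?m (\<lambda>i. h j i (\<omega> i))) \<partial>gauss_family {..<?m})" for j
  have invA: "invertible (A i)" for i
    unfolding A_def using inv[of i] invertible_matrix_Tmap[of "c i"]
    by (auto intro: invertible_mult simp: invertible_def[of "mat 1"] exI[of _ "mat 1"])
  have Av: "A i *v x = Mi i *v Tmap (c i) x" if "i < k" for i x
    using that by (simp add: A_def matrix_vector_mul_assoc[symmetric] fun_cong[OF matrix_vector_mul(2)[OF linear_Tmap]])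
  have hm: "h j i \<in> borel_measurable borel" for j i
    unfolding h_def by (cases "i < j") simp_all
  have step: "H (Suc j) \<le> H j \<and> ennreal b_inf * H j \<le> H (Suc j)" if j: "j < k" for j
  proof -
    have jm: "j < ?m" using j k by simp
    have ne: "h (Suc j) i = h j i" if "i \<noteq> j" for i using that by (auto simp: h_def less_Suc_eq)
    \<comment> \<open>Transposition moves \<open>Mi j\<close> to the test vector, so that the two
      columns differ only in c j + x against Tmap (c j) x.\<close>
    have l: "h (Suc j) j x \<bullet> w = (c j + x) \<bullet> (transpose (Mi j) *v w)"
      "h j j x \<bullet> w = Tmap (c j) x \<bullet> (transpose (Mi j) *v w)" for x w
      using j by (simp_all add: h_def Av inner_matrix_vector_transpose del: transpose_matrix_vector)
    have "1 * H (Suc j) \<le> H j"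
      unfolding H_def
      by (rule nn_integral_gvol_replace[OF jm hm hm ne])
        (assumption, simp only: l mult_1_left, rule Gaussian_comparison(1))
    moreover have "ennreal b_inf * H j \<le> H (Suc j)"
      unfolding H_def
      by (rule nn_integral_gvol_replace[OF jm hm hm ne[symmetric]])
        (assumption, simp only: l, rule Gaussian_comparison(2))
    ultimately show ?thesis by simp
  qed
  have hybrid: "H j \<le> H 0 \<and> ennreal (b_inf ^ j) * H 0 \<le> H j" if "j \<le> k" for j
    using that
  proof (induction j)
    case (Suc j)
    then have IH: "H j \<le> H 0" "ennreal (b_inf ^ j) * H 0 \<le> H j" and st: "H (Suc j) \<le> H j" "ennreal b_inf * H j \<le> H (Suc j)"
      using step[of j] by auto
    have "ennreal (b_inf ^ Suc j) * H 0 = ennreal b_inf * (ennreal (b_inf ^ j) * H 0)"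
      using b_inf_nonneg by (simp add: ennreal_mult mult.assoc)
    also have "\<dots> \<le> ennreal b_inf * H j" using IH by (intro mult_left_mono) auto
    finally show ?case using IH st by auto
  qed simp
  define C where "C = gauss_det_mean (?m - k)"
  have C: "C > 0" by (simp add: C_def gauss_det_mean_pos)
  let ?E = "prob_space.expectation P (\<lambda>\<omega>. sqrt (det_k k (\<lambda>i j. X i \<omega> \<bullet> X j \<omega>)))"
  have HW: "H 0 = (\<integral>\<^sup>+\<omega>. ennreal (gvol ?m (\<lambda>i. A i *v \<omega> i)) \<partial>gauss_family {..<?m})"
    by (simp add: H_def h_def)
  have MV: "MV = (2 * pi) powr (real ?m / 2) / fact ?m * enn2real (H 0)" and fin: "H 0 < \<infinity>"
  proof -
    have "(\<lambda>i. if i < k then (\<lambda>x. Mi i *v Tmap (c i) x) ` cball 0 1 else cball 0 1) = (\<lambda>i. (*v) (A i) ` cball 0 1)"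
    proof
      fix i
      show "(if i < k then (\<lambda>x. Mi i *v Tmap (c i) x) ` cball 0 1 else cball 0 1) = (*v) (A i) ` cball 0 1"
      proof (cases "i < k")
        case True
        then have eq: "(\<lambda>x. Mi i *v Tmap (c i) x) = (*v) (A i)" by (simp add: fun_eq_iff Av)
        show ?thesis using True by (simp only: eq if_True)
      next
        case False
        then have "(*v) (A i) = id" by (simp add: A_def fun_eq_iff)
        then show ?thesis using False by simp
      qed
    qed
    then show "MV = (2 * pi) powr (real ?m / 2) / fact ?m * enn2real (H 0)"
      unfolding MV_def HW using mixed_volume_ellipsoids(2)[of A, OF invA] by simp
    show "H 0 < \<infinity>" unfolding HW by (rule mixed_volume_ellipsoids(1)[of A, OF invA])
  qed
  \<comment> \<open>The factor (2 pi)^(m/2) / m! of the mixed volume cancels against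
    \<open>alpha_mk\<close> up to (2 pi)^((m - k)/2) / ((m - k)! \<kappa>), with \<kappa> the volume
    of the unit ball in dimension m - k. This is the reciprocal of
    \<open>gauss_det_mean (m - k)\<close>.\<close>
  have aMV: "alpha_mk ?m k * MV = enn2real (H 0) / C"
  proof -
    have "(2 * pi) powr (real ?m / 2) = (2 * pi) powr (real k / 2) * (2 * pi) powr (real (?m - k) / 2)"
      using k by (simp add: powr_add[symmetric] of_nat_diff add_divide_distrib[symmetric])
    moreover have "unit_ball_vol (real (?m - k)) > 0" by (rule unit_ball_vol_pos) simp
    ultimately show ?thesis
      by (simp add: MV alpha_mk_def C_def gauss_det_mean_def)
  qed
  \<comment> \<open>The padding is removed by \<open>nn_integral_gvol_completion\<close>, applied
    with all m columns on the left, where the constant is \<open>gauss_det_mean 0\<close>, that is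
    1.\<close>
  have EH: "?E = enn2real (H k) / C"
  proof -
    let ?G = "\<lambda>\<omega>. ennreal (gvol k (\<lambda>i. Mi i *v (c i + \<omega> i)))"
    let ?Q = "gauss_family {..<k} :: (nat \<Rightarrow> real ^ 'n) measure"
    let ?g = "\<lambda>i x. Mi i *v (c i + x)"
    have rv: "\<xi> i \<in> borel_measurable P" if "i < k" for i
      using distributed_measurable[OF dist[OF that]] by simp
    have di: "distr P borel (\<xi> i) = std_gauss" if "i < k" for i
    proof -
      have "distr P borel (\<xi> i) = distr P lborel (\<xi> i)" by (intro distr_cong) auto
      also have "\<dots> = std_gauss"
        using distributed_distr_eq_density[OF dist[OF that]] by (simp add: std_gauss_def)
      finally show ?thesis .
    qed
    have ne: "{..<k} \<noteq> {}" using k by auto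
    have joint: "distr P (PiM {..<k} (\<lambda>_. borel)) (\<lambda>\<omega>. \<lambda>i\<in>{..<k}. \<xi> i \<omega>) = ?Q"
    proof -
      have "distr P (PiM {..<k} (\<lambda>_. borel)) (\<lambda>\<omega>. \<lambda>i\<in>{..<k}. \<xi> i \<omega>) = PiM {..<k} (\<lambda>i. distr P borel (\<xi> i))"
        using P.indep_vars_iff_distr_eq_PiM'[OF ne, where M' = "\<lambda>_. borel" and X = \<xi>] rv indep by simp
      also have "\<dots> = ?Q" by (intro PiM_cong refl) (simp add: di)
      finally show ?thesis .
    qed
    have gm: "(\<lambda>\<omega>. gvol k (\<lambda>i. Mi i *v (c i + \<omega> i))) \<in> borel_measurable ?Q"
      by (rule measurable_gvol_family[of k ?g k]) simp_all
    have Xm: "(\<lambda>\<omega>. gvol k (\<lambda>i. X i \<omega>)) \<in> borel_measurable P"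
    proof (rule measurable_gvol)
      fix i assume "i < k"
      note [measurable] = rv[OF this]
      show "X i \<in> borel_measurable P" unfolding X_def by measurable
    qed
    have "?E = (\<integral>\<omega>. gvol k (\<lambda>i. X i \<omega>) \<partial>P)"
      by (simp add: gvol_def gram_det_def)
    also have "\<dots> = enn2real (\<integral>\<^sup>+\<omega>. ennreal (gvol k (\<lambda>i. X i \<omega>)) \<partial>P)"
      using Xm k by (intro integral_eq_nn_integral) (auto intro: gvol_nonneg)
    also have "(\<integral>\<^sup>+\<omega>. ennreal (gvol k (\<lambda>i. X i \<omega>)) \<partial>P) = (\<integral>\<^sup>+\<omega>. ?G (\<lambda>i\<in>{..<k}. \<xi> i \<omega>) \<partial>P)"
      by (intro nn_integral_cong arg_cong[where f = ennreal] gvol_cong) (simp add: X_def)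
    also have "\<dots> = (\<integral>\<^sup>+\<omega>. ?G \<omega> \<partial>?Q)"
    proof -
      have sQ: "sets ?Q = sets (PiM {..<k} (\<lambda>_. borel))" by (intro sets_PiM_cong refl) simp
      have gm': "?G \<in> borel_measurable (PiM {..<k} (\<lambda>_. borel))"
        using gm by (simp add: measurable_cong_sets[OF sQ refl])
      have mr: "(\<lambda>\<omega>. \<lambda>i\<in>{..<k}. \<xi> i \<omega>) \<in> P \<rightarrow>\<^sub>M PiM {..<k} (\<lambda>_. borel)"
        using rv by (intro measurable_restrict) simp
      show ?thesis
        by (subst joint[symmetric], subst nn_integral_distr[OF mr]) (simp_all only: measurable_distr_eq1 gm')
    qed
    finally have E: "?E = enn2real (\<integral>\<^sup>+\<omega>. ?G \<omega> \<partial>?Q)" .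
    have "ennreal (gauss_det_mean (?m - ?m)) * H k = ennreal (gauss_det_mean (?m - k)) * (\<integral>\<^sup>+\<omega>. ennreal (gvol k (\<lambda>i. h k i (\<omega> i))) \<partial>?Q)"
      unfolding H_def
      by (rule nn_integral_gvol_completion[OF k(2) order_refl hm]) (simp add: h_def A_def fun_eq_iff)
    also have "(\<integral>\<^sup>+\<omega>. ennreal (gvol k (\<lambda>i. h k i (\<omega> i))) \<partial>?Q) = (\<integral>\<^sup>+\<omega>. ?G \<omega> \<partial>?Q)"
      by (intro nn_integral_cong arg_cong[where f = ennreal] gvol_cong) (simp add: h_def)
    finally have "H k = ennreal C * (\<integral>\<^sup>+\<omega>. ?G \<omega> \<partial>?Q)" by (simp add: C_def)
    then have "enn2real (H k) = C * ?E" using C by (simp add: E enn2real_mult)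
    then show ?thesis using C by simp
  qed
  have "enn2real (H k) \<le> enn2real (H 0)"
    using hybrid[OF order_refl] fin by (intro enn2real_mono) auto
  then have upper: "?E \<le> alpha_mk ?m k * MV"
    unfolding EH aMV using C by (intro divide_right_mono) auto
  have "H k < \<infinity>" using hybrid[OF order_refl] fin by auto
  then have "enn2real (ennreal (b_inf ^ k) * H 0) \<le> enn2real (H k)"
    using hybrid[OF order_refl] by (intro enn2real_mono) auto
  then have "b_inf ^ k * enn2real (H 0) \<le> enn2real (H k)"
    using b_inf_nonneg by (simp add: enn2real_mult)
  from divide_right_mono[OF this less_imp_le[OF C]]
  have "b_inf ^ k * (alpha_mk ?m k * MV) \<le> ?E"
    unfolding EH aMV by simp
  then show ?thesis using upper by (simp add: mult.assoc)
qed

end
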